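(* Let $M\ge1$ be an integer and $N\ge0$. For $\tau>0$ let $G=\cosh^2\tau$ and let $\mathcal A_G$ be the single-mode quantum-limited amplifier channel of gain $G$. Let $|\psi\rangle_{AS}=\sum_{\mathbf n\ge\mathbf 0}\sqrt{p_{\mathbf n}}\,|\chi_{\mathbf n}\rangle_A|\mathbf n\rangle_S$ be a number-diagonal-signal (NDS) probe, i.e. $\{|\chi_{\mathbf n}\rangle_A\}$ is an orthonormal set of the ancilla $A$, $|\mathbf n\rangle_S$ are number states of the $M$ signal modes, and $\{p_{\mathbf n}\}$ is a probability distribution with $\sum_{n}np_n=N$, where $p_n=\sum_{\mathbf n:\,n_1+\cdots+n_M=n}p_{\mathbf n}$. Let $\rho_\tau=(\mathrm{id}_A\otimes\mathcal A_G^{\otimes M})(|\psi\rangle\langle\psi|)$. Then for all $\tau,\tau'$, $$\mathcal F(\rho_\tau,\rho_{\tau'})=\sum_{n=0}^\infty p_n\,\nu^{n+M},\qquad \nu=\mathrm{sech}(\tau'-\tau),$$ and the quantum Fisher information of the output state family with respect to $\tau$ and to $G$ is $$\mathcal K_\tau=4(N+M),\qquad \mathcal K_G=\frac{N+M}{G(G-1)} .$$ Moreover NDS probes are optimal: no probe state of $M$ signal modes and an arbitrary ancilla with average total signal photon number $N$ yields an output quantum Fisher information on $\tau$ (respectively $G$) larger than these values.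
   Context: Fidelity is $\mathcal F(\rho,\sigma)=\mathrm{Tr}\sqrt{\sqrt\rho\,\sigma\sqrt\rho}$. The quantum Fisher information of a family $\rho_\theta$ is $\mathcal K_\theta=\mathrm{Tr}[\rho_\theta\hat L_\theta^2]$ with $\partial_\theta\rho_\theta=\frac12(\hat L_\theta\rho_\theta+\rho_\theta\hat L_\theta)$; it is computed as $\mathcal K_\theta=-4\,\partial_{\theta'}^2\mathcal F(\rho_\theta,\rho_{\theta'})|_{\theta'=\theta}$. The quantum-limited amplifier $\mathcal A_G$, $G=\cosh^2\tau\ge1$, acts on a signal mode by a two-mode squeezing unitary $\hat U(\tau)$ with a vacuum environment mode $E$ that is then traced out, where $\hat U(\tau)|n\rangle_S|0\rangle_E=\mathrm{sech}^{\,n+1}\tau\sum_{a=0}^\infty\sqrt{\binom{n+a}{a}}\tanh^a\tau\,|n+a\rangle_S|a\rangle_E$. *)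

theory Defs
  imports "HOL-Analysis.Analysis"
begin

section \<open>Hilbert spaces and bounded operators in coordinates\<close>

text \<open>
  A Hilbert space is represented by an orthonormal basis indexed by a type \<open>'x\<close>, i.e. as
  the space of square-summable functions \<open>'x \<Rightarrow> complex\<close> (no countability is assumed).
  A tensor product is indexed by the product type.  Bounded operators are given by their matrix
  elements; inner products are conjugate-linear in the first argument.
\<close>

definition ell2 :: "('x \<Rightarrow> complex) \<Rightarrow> bool" where
  "ell2 f \<longleftrightarrow> (\<lambda>x. (cmod (f x))\<^sup>2) summable_on UNIV"

definition cinner :: "('x \<Rightarrow> complex) \<Rightarrow> ('x \<Rightarrow> complex) \<Rightarrow> complex" where
  "cinner f g = (\<Sum>\<^sub>\<infinity>x. cnj (f x) * g x)"

definition norm2 :: "('x \<Rightarrow> complex) \<Rightarrow> real" where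
  "norm2 f = sqrt (\<Sum>\<^sub>\<infinity>x. (cmod (f x))\<^sup>2)"

definition orthonormal_on :: "'i set \<Rightarrow> ('i \<Rightarrow> 'x \<Rightarrow> complex) \<Rightarrow> bool" where
  "orthonormal_on I \<xi> \<longleftrightarrow>
     (\<forall>i\<in>I. ell2 (\<xi> i)) \<and>
     (\<forall>i\<in>I. \<forall>j\<in>I. cinner (\<xi> i) (\<xi> j) = (if i = j then 1 else 0))"

definition bounded_map :: "(('x \<Rightarrow> complex) \<Rightarrow> ('y \<Rightarrow> complex)) \<Rightarrow> bool" where
  "bounded_map T \<longleftrightarrow> (\<exists>C. \<forall>f. ell2 f \<longrightarrow> ell2 (T f) \<and> norm2 (T f) \<le> C * norm2 f)"

type_synonym ('x, 'y) kernel = "'x \<Rightarrow> 'y \<Rightarrow> complex"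

definition kapp :: "('x, 'y) kernel \<Rightarrow> ('y \<Rightarrow> complex) \<Rightarrow> 'x \<Rightarrow> complex" where
  "kapp A f = (\<lambda>x. \<Sum>\<^sub>\<infinity>y. A x y * f y)"

definition kmult :: "('x, 'y) kernel \<Rightarrow> ('y, 'z) kernel \<Rightarrow> ('x, 'z) kernel" where
  "kmult A B = (\<lambda>x z. \<Sum>\<^sub>\<infinity>y. A x y * B y z)"

definition kadj :: "('x, 'y) kernel \<Rightarrow> ('y, 'x) kernel" where
  "kadj A = (\<lambda>y x. cnj (A x y))"

text \<open>Square-summability of the rows makes all sums in \<open>kapp A f\<close> absolutely convergent.\<close>

definition bounded_op :: "('x, 'x) kernel \<Rightarrow> bool" where
  "bounded_op A \<longleftrightarrow> (\<forall>x. ell2 (A x)) \<and> bounded_map (kapp A)"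

definition positive_op :: "('x, 'x) kernel \<Rightarrow> bool" where
  "positive_op A \<longleftrightarrow> bounded_op A \<and> (\<forall>f. ell2 f \<longrightarrow> cinner f (kapp A f) \<in> \<real>\<^sub>\<ge>\<^sub>0)"

definition trace_op :: "('x, 'x) kernel \<Rightarrow> complex" where
  "trace_op A = (\<Sum>\<^sub>\<infinity>x. A x x)"

definition density_op :: "('x, 'x) kernel \<Rightarrow> bool" where
  "density_op \<rho> \<longleftrightarrow> positive_op \<rho> \<and> ((\<lambda>x. \<rho> x x) has_sum 1) UNIV"

definition ketbra :: "('x \<Rightarrow> complex) \<Rightarrow> ('x, 'x) kernel" where
  "ketbra \<psi> = (\<lambda>x y. \<psi> x * cnj (\<psi> y))"

definition ptrace :: "('x \<times> 'e, 'x \<times> 'e) kernel \<Rightarrow> ('x, 'x) kernel" where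
  "ptrace R = (\<lambda>x y. \<Sum>\<^sub>\<infinity>e. R (x, e) (y, e))"


section \<open>Fidelity\<close>

definition is_op_sqrt :: "('x, 'x) kernel \<Rightarrow> ('x, 'x) kernel \<Rightarrow> bool" where
  "is_op_sqrt A B \<longleftrightarrow> positive_op B \<and> kmult B B = A"

definition op_sqrt :: "('x, 'x) kernel \<Rightarrow> ('x, 'x) kernel" where
  "op_sqrt A = (THE B. is_op_sqrt A B)"

definition fidelity :: "('x, 'x) kernel \<Rightarrow> ('x, 'x) kernel \<Rightarrow> real" where
  "fidelity \<rho> \<sigma> =
     Re (trace_op (op_sqrt (kmult (kmult (op_sqrt \<rho>) \<sigma>) (op_sqrt \<rho>))))"


section \<open>Quantum Fisher information\<close>

text \<open>
  In infinite dimension the symmetric logarithmic derivative \<open>L\<close> is in general unbounded, so it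
  is a linear operator on a domain \<open>D\<close> that is symmetric there.
\<close>

definition hermitian_on ::
  "('x \<Rightarrow> complex) set \<Rightarrow> (('x \<Rightarrow> complex) \<Rightarrow> ('x \<Rightarrow> complex)) \<Rightarrow> bool" where
  "hermitian_on D L \<longleftrightarrow>
     (\<lambda>x. 0) \<in> D \<and>
     (\<forall>f\<in>D. ell2 f \<and> ell2 (L f)) \<and>
     (\<forall>f\<in>D. \<forall>g\<in>D. (\<lambda>x. f x + g x) \<in> D \<and> L (\<lambda>x. f x + g x) = (\<lambda>x. L f x + L g x)) \<and>
     (\<forall>f\<in>D. \<forall>c. (\<lambda>x. c * f x) \<in> D \<and> L (\<lambda>x. c * f x) = (\<lambda>x. c * L f x)) \<and>
     (\<forall>f\<in>D. \<forall>g\<in>D. cinner f (L g) = cinner (L f) g)"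

text \<open>
  \<open>has_QFI \<rho> \<theta> K\<close>: the family \<open>\<rho>\<close> has a symmetric logarithmic derivative \<open>L\<close> at \<open>\<theta>\<close> and
  \<open>K = Tr[\<rho> L\<^sup>2]\<close>.  With \<open>R\<close> the square root of \<open>\<rho> \<theta>\<close>, the trace is read as
  \<open>Tr[R L\<^sup>2 R] = (\<Sum>\<^sub>x \<parallel>L R e\<^sub>x\<parallel>\<^sup>2)\<close>, which only needs \<open>L R\<close> to be a (bounded) Hilbert-Schmidt
  operator; \<open>\<lambda>z. R z x\<close> is the vector \<open>R e\<^sub>x\<close>.  Accordingly \<open>D\<close> has to contain the range of \<open>R\<close>
  and need not be dense: outside the support of \<open>\<rho> \<theta>\<close> the operator \<open>L\<close> is arbitrary anyway.
  In the equation \<open>\<rho>' = (L \<rho> + \<rho> L) / 2\<close> the matrix element of \<open>L \<rho>\<close> at \<open>(x, y)\<close> is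
  \<open>L (\<rho> e\<^sub>y) x\<close>, and \<open>\<rho> L\<close> is the adjoint of \<open>L \<rho>\<close>.
\<close>

definition is_SLD ::
  "(real \<Rightarrow> ('x, 'x) kernel) \<Rightarrow> real \<Rightarrow> ('x \<Rightarrow> complex) set
     \<Rightarrow> (('x \<Rightarrow> complex) \<Rightarrow> ('x \<Rightarrow> complex)) \<Rightarrow> bool" where
  "is_SLD \<rho> \<theta> D L \<longleftrightarrow>
     hermitian_on D L \<and>
     (\<forall>y. (\<lambda>z. \<rho> \<theta> z y) \<in> D) \<and>
     (\<forall>x y. ((\<lambda>t. \<rho> t x y) has_vector_derivative
               (1 / 2) * (L (\<lambda>z. \<rho> \<theta> z y) x + cnj (L (\<lambda>z. \<rho> \<theta> z x) y))) (at \<theta>))"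

definition has_QFI :: "(real \<Rightarrow> ('x, 'x) kernel) \<Rightarrow> real \<Rightarrow> real \<Rightarrow> bool" where
  "has_QFI \<rho> \<theta> K \<longleftrightarrow>
     (\<exists>D L R. is_SLD \<rho> \<theta> D L \<and>
        is_op_sqrt (\<rho> \<theta>) R \<and>
        (\<forall>f. ell2 f \<longrightarrow> kapp R f \<in> D) \<and>
        bounded_map (\<lambda>f. L (kapp R f)) \<and>
        ((\<lambda>x. (norm2 (L (\<lambda>z. R z x)))\<^sup>2) has_sum K) UNIV)"


section \<open>The quantum-limited amplifier on the signal modes\<close>

definition sech :: "real \<Rightarrow> real" where
  "sech x = 1 / cosh x"

text \<open>Coefficient of \<open>|k\<rangle>\<^sub>S |a\<rangle>\<^sub>E\<close> in \<open>U(\<tau>) |n\<rangle>\<^sub>S |0\<rangle>\<^sub>E\<close>.\<close>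

definition squeeze_coeff :: "real \<Rightarrow> nat \<Rightarrow> nat \<Rightarrow> nat \<Rightarrow> real" where
  "squeeze_coeff \<tau> n k a =
     (if k = n + a then sech \<tau> ^ (n + 1) * sqrt (real ((n + a) choose a)) * tanh \<tau> ^ a else 0)"

text \<open>
  The \<open>M\<close> signal modes are indexed by a finite type \<open>'m\<close> with \<open>M = CARD('m) \<ge> 1\<close>, and a number
  state of them by \<open>'m \<Rightarrow> nat\<close>; each signal mode has its own environment mode.
  \<open>dilation \<tau>\<close> is the isometry \<open>|\<psi>\<rangle>\<^sub>A\<^sub>S \<mapsto> (1\<^sub>A \<otimes> U(\<tau>)\<^sup>\<otimes>\<^sup>M) |\<psi>\<rangle>\<^sub>A\<^sub>S |0\<rangle>\<^sub>E\<close> from \<open>A \<otimes> S\<close> to \<open>(A \<otimes> S) \<otimes> E\<close>.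
\<close>

definition dilation ::
  "real \<Rightarrow> (('a \<times> ('m::finite \<Rightarrow> nat)) \<times> ('m \<Rightarrow> nat), 'a \<times> ('m \<Rightarrow> nat)) kernel" where
  "dilation \<tau> = (\<lambda>((a, k), e) (b, n).
     if a = b then complex_of_real (\<Prod>i\<in>UNIV. squeeze_coeff \<tau> (n i) (k i) (e i)) else 0)"

text \<open>\<open>id\<^sub>A \<otimes> \<A>\<^sub>G\<^sup>\<otimes>\<^sup>M\<close>, where \<open>\<tau> \<ge> 0\<close> is determined by \<open>G = (cosh \<tau>)\<^sup>2 \<ge> 1\<close>.\<close>

definition amplifier ::
  "real \<Rightarrow> ('a \<times> ('m::finite \<Rightarrow> nat), 'a \<times> ('m \<Rightarrow> nat)) kernel
     \<Rightarrow> ('a \<times> ('m \<Rightarrow> nat), 'a \<times> ('m \<Rightarrow> nat)) kernel" where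
  "amplifier G \<rho> =
     (let V = dilation (arcosh (sqrt G)) in ptrace (kmult (kmult V \<rho>) (kadj V)))"


section \<open>Probes\<close>

definition total_number :: "('m::finite \<Rightarrow> nat) \<Rightarrow> nat" where
  "total_number n = (\<Sum>i\<in>UNIV. n i)"

definition total_dist :: "(('m::finite \<Rightarrow> nat) \<Rightarrow> real) \<Rightarrow> nat \<Rightarrow> real" where
  "total_dist p n = (\<Sum>k | total_number k = n. p k)"

text \<open>Coordinates of \<open>\<Sum>\<^sub>n \<surd>(p n) |\<xi> n\<rangle>\<^sub>A |n\<rangle>\<^sub>S\<close>.\<close>

definition nds_vector ::
  "(('m::finite \<Rightarrow> nat) \<Rightarrow> real) \<Rightarrow> (('m \<Rightarrow> nat) \<Rightarrow> 'a \<Rightarrow> complex)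
     \<Rightarrow> 'a \<times> ('m \<Rightarrow> nat) \<Rightarrow> complex" where
  "nds_vector p \<xi> = (\<lambda>(a, n). complex_of_real (sqrt (p n)) * \<xi> n a)"

text \<open>
  Orthonormality of the ancilla vectors is required only where they occur in the state, so that
  finite-dimensional (in particular trivial) ancillas are included.
\<close>

definition nds_probe ::
  "(('m::finite \<Rightarrow> nat) \<Rightarrow> real) \<Rightarrow> (('m \<Rightarrow> nat) \<Rightarrow> 'a \<Rightarrow> complex) \<Rightarrow> real \<Rightarrow> bool" where
  "nds_probe p \<xi> N \<longleftrightarrow>
     (\<forall>n. 0 \<le> p n) \<and> (p has_sum 1) UNIV \<and>
     orthonormal_on {n. p n \<noteq> 0} \<xi> \<and>
     (\<lambda>n. real n * total_dist p n) sums N"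

definition has_mean_photon_number ::
  "('a \<times> ('m::finite \<Rightarrow> nat), 'a \<times> ('m \<Rightarrow> nat)) kernel \<Rightarrow> real \<Rightarrow> bool" where
  "has_mean_photon_number \<rho> N \<longleftrightarrow>
     ((\<lambda>(a, n). real (total_number n) * Re (\<rho> (a, n) (a, n))) has_sum N) UNIV"

end

theory Submission
  imports Defs
begin

text \<open>
  With vacuum in the environment the two-mode squeezer has the Kraus operators
  \<open>A e: |n\<rangle> \<mapsto> amp \<tau> n e |n + e\<rangle>\<close>, so an NDS probe is sent to \<open>\<Sum>\<^sub>e |\<Phi> e\<rangle>\<langle>\<Phi> e|\<close> with vectors
  \<open>\<Phi> e\<close> that are mutually orthogonal also for different values of \<open>\<tau>\<close>.  All square roots are
  therefore explicit, the fidelity is \<open>\<Sum>\<^sub>e \<langle>\<Phi>\<^sub>\<tau> e|\<Phi>\<^sub>\<tau>' e\<rangle>\<close>, a negative binomial series, and the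
  symmetric logarithmic derivative is diagonal in the vectors \<open>\<xi> n \<otimes> |n + e\<rangle>\<close>, so that the quantum
  Fisher information is the variance of a negative binomial distribution.

  Uniqueness and optimality both rest on
  \<open>K = sup\<^sub>H (2 Tr (\<rho>' H) - Tr (\<rho> H\<^sup>2))\<close> over finitely supported hermitian \<open>H\<close>.  For an arbitrary
  probe the objective is at most \<open>4 \<Sum>\<^sub>e Tr (A' e \<rho> (A' e)\<^sup>\<dagger>) = 4 (N + M)\<close>, because
  \<open>Tr ((2 A' e - H A e) \<rho> (2 A' e - H A e)\<^sup>\<dagger>) \<ge> 0\<close> for every \<open>e\<close>.
\<close>

text \<open>Two witnesses of \<open>has_QFI\<close> come with their own domain, operator
  \<open>L\<close> and square root \<open>R\<close>, and \<open>L\<close> may be unbounded, so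
  uniqueness cannot be read off the equation for the derivative. The variational objective sees only
  matrix entries of the state and of its derivative. One half of the formula is a completed square
  in Hilbert-Schmidt norm: the objective at \<open>H\<close> is \<open>K\<close> minus the squared
  distance from \<open>L R\<close> to \<open>H R\<close>. The other half, that finitely supported
  \<open>H\<close> bring this distance to 0, is where the work lies. The channel side stays
  elementary because the output number state \<open>k\<close> occurs only with environment numbers
  \<open>e \<le> k\<close>: every matrix entry is a finite sum over \<open>e\<close>, so entries are
  differentiated term by term and infinite combinations of branches make sense pointwise. The factor
  \<open>4\<close> is the square of the \<open>2\<close> by which the symmetric logarithmic
  derivative exceeds the logarithmic derivative of an amplitude. \<open>N + M\<close> is the average
  of \<open>n + M\<close>, the second moment of that logarithmic derivative for input number
  \<open>n\<close>.\<close>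

section \<open>Square-summable functions\<close>

text \<open>Serves where only finite partial sums are under control: pointwise limits in
  \<open>ell2_complete\<close>, infinite combinations in \<open>ell2_comb\<close>.\<close>

lemma ell2I:
  assumes "\<And>F. finite F \<Longrightarrow> (\<Sum>x\<in>F. (cmod (f x))\<^sup>2) \<le> B"
  shows "ell2 f" and "(norm2 f)\<^sup>2 \<le> B"
proof -
  show e: "ell2 f"
    unfolding ell2_def
    by (rule nonneg_bdd_above_summable_on) (auto intro!: bdd_aboveI[where M = B] assms)
  have "(norm2 f)\<^sup>2 = (\<Sum>\<^sub>\<infinity>x. (cmod (f x))\<^sup>2)"
    unfolding norm2_def by (simp add: infsum_nonneg)
  also have "\<dots> \<le> B"
    using e unfolding ell2_def by (rule infsum_le_finite_sums) (use assms in auto)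
  finally show "(norm2 f)\<^sup>2 \<le> B" .
qed

lemma norm2_nonneg [simp]: "0 \<le> norm2 f"
  unfolding norm2_def by (simp add: infsum_nonneg)

lemma norm2_power2: "(norm2 f)\<^sup>2 = (\<Sum>\<^sub>\<infinity>x. (cmod (f x))\<^sup>2)"
  unfolding norm2_def by (simp add: infsum_nonneg)

lemma norm2_power2_has_sum: "ell2 f \<Longrightarrow> ((\<lambda>x. (cmod (f x))\<^sup>2) has_sum (norm2 f)\<^sup>2) UNIV"
  unfolding ell2_def norm2_power2 by simp

lemma norm2_power2_eqI:
  assumes "((\<lambda>x. (cmod (f x))\<^sup>2) has_sum s) UNIV"
  shows "ell2 f" "(norm2 f)\<^sup>2 = s"
  using assms unfolding ell2_def norm2_power2 by (auto simp: has_sum_iff)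

lemma sum_le_norm2:
  assumes "ell2 f" "finite F"
  shows "(\<Sum>x\<in>F. (cmod (f x))\<^sup>2) \<le> (norm2 f)\<^sup>2"
  using assms unfolding norm2_power2 ell2_def by (intro finite_sum_le_infsum) auto

lemma cmod_le_norm2: "ell2 f \<Longrightarrow> cmod (f x) \<le> norm2 f"
  using sum_le_norm2[of f "{x}"] by (simp add: abs_le_square_iff[symmetric])

lemma norm2_eq_0: "ell2 f \<Longrightarrow> norm2 f = 0 \<longleftrightarrow> f = (\<lambda>_. 0)"
  using cmod_le_norm2[of f] by (auto simp: norm2_def)

lemma ell2_zero [simp]: "ell2 (\<lambda>_. 0)"
  by (simp add: ell2_def)

lemma norm2_zero [simp]: "norm2 (\<lambda>_. 0) = 0"
  by (simp add: norm2_def)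

lemma ell2_finite_support: "finite {x. f x \<noteq> 0} \<Longrightarrow> ell2 f"
  unfolding ell2_def by (rule finite_nonzero_values_imp_summable_on) auto

lemma ell2_cnj: "ell2 f \<Longrightarrow> ell2 (\<lambda>x. cnj (f x))"
  by (simp add: ell2_def)

lemma norm2_cnj: "norm2 (\<lambda>x. cnj (f x)) = norm2 f"
  by (simp add: norm2_def)

lemma ell2_scale: "ell2 f \<Longrightarrow> ell2 (\<lambda>x. c * f x)"
  by (auto simp: ell2_def norm_mult power_mult_distrib intro: summable_on_cmult_right)

lemma norm2_scale: "norm2 (\<lambda>x. c * f x) = cmod c * norm2 f"
  by (simp add: norm2_def norm_mult power_mult_distrib infsum_cmult_right' real_sqrt_mult)

lemma cmod_add_power2_le: "(cmod (a + b))\<^sup>2 \<le> 2 * (cmod a)\<^sup>2 + 2 * (cmod b)\<^sup>2"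
proof -
  have "(cmod (a + b))\<^sup>2 \<le> (cmod a + cmod b)\<^sup>2"
    by (intro power_mono norm_triangle_ineq) auto
  also have "\<dots> \<le> 2 * (cmod a)\<^sup>2 + 2 * (cmod b)\<^sup>2"
    using sum_squares_bound[of "cmod a" "cmod b"] by (simp add: power2_sum)
  finally show ?thesis .
qed

lemma ell2_add:
  assumes "ell2 f" "ell2 g"
  shows "ell2 (\<lambda>x. f x + g x)"
proof -
  have "(\<lambda>x. 2 * (cmod (f x))\<^sup>2 + 2 * (cmod (g x))\<^sup>2) summable_on UNIV"
    using assms unfolding ell2_def by (intro summable_on_add summable_on_cmult_right)
  then show ?thesis
    unfolding ell2_def by (rule summable_on_comparison_test) (use cmod_add_power2_le in auto)
qed

lemma ell2_uminus: "ell2 f \<Longrightarrow> ell2 (\<lambda>x. - f x)"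
  by (simp add: ell2_def)

lemma ell2_diff:
  assumes "ell2 f" "ell2 g"
  shows "ell2 (\<lambda>x. f x - g x)"
  using ell2_add[OF assms(1) ell2_uminus[OF assms(2)]] by simp

lemma ell2_sum: "(\<And>i. i \<in> I \<Longrightarrow> ell2 (f i)) \<Longrightarrow> ell2 (\<lambda>x. \<Sum>i\<in>I. f i x)"
  by (induction I rule: infinite_finite_induct) (auto intro: ell2_add)

section \<open>Inner products and the Cauchy-Schwarz inequality\<close>

lemma abs_summable_mult:
  assumes "ell2 f" "ell2 g"
  shows "(\<lambda>x. cmod (f x) * cmod (g x)) summable_on UNIV"
proof -
  have "(\<lambda>x. (cmod (f x))\<^sup>2 + (cmod (g x))\<^sup>2) summable_on UNIV"
    using assms unfolding ell2_def by (intro summable_on_add)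
  then show ?thesis
  proof (rule summable_on_comparison_test)
    show "cmod (f x) * cmod (g x) \<le> (cmod (f x))\<^sup>2 + (cmod (g x))\<^sup>2" for x
      using sum_squares_bound[of "cmod (f x)" "cmod (g x)"] mult_nonneg_nonneg[of "cmod (f x)" "cmod (g x)", OF norm_ge_zero norm_ge_zero]
      by linarith
  qed auto
qed

lemma summable_mult:
  assumes "ell2 f" "ell2 g"
  shows "(\<lambda>x. f x * g x) summable_on UNIV"
  by (rule abs_summable_summable) (use abs_summable_mult[OF assms] in \<open>simp add: norm_mult\<close>)

lemma cinner_has_sum:
  assumes "ell2 f" "ell2 g"
  shows "((\<lambda>x. cnj (f x) * g x) has_sum cinner f g) UNIV"
  unfolding cinner_def using summable_mult[OF ell2_cnj[OF assms(1)] assms(2)] by simp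

lemma cinner_eqI: "((\<lambda>x. cnj (f x) * g x) has_sum s) UNIV \<Longrightarrow> cinner f g = s"
  unfolding cinner_def by (rule infsumI)

lemma cnj_cinner: "cnj (cinner f g) = cinner g f"
  unfolding cinner_def infsum_cnj[symmetric] by (simp add: mult.commute)

lemma cinner_zero [simp]: "cinner f (\<lambda>_. 0) = 0" "cinner (\<lambda>_. 0) f = 0"
  by (simp_all add: cinner_def)

lemma cinner_add_right:
  "ell2 f \<Longrightarrow> ell2 g \<Longrightarrow> ell2 h \<Longrightarrow> cinner f (\<lambda>x. g x + h x) = cinner f g + cinner f h"
  by (rule cinner_eqI) (auto simp: ring_distribs intro!: has_sum_add cinner_has_sum)

lemma cinner_add_left:
  "ell2 f \<Longrightarrow> ell2 g \<Longrightarrow> ell2 h \<Longrightarrow> cinner (\<lambda>x. g x + h x) f = cinner g f + cinner h f"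
  by (rule cinner_eqI) (auto simp: ring_distribs intro!: has_sum_add cinner_has_sum)

lemma cinner_scale_right: "cinner f (\<lambda>x. c * g x) = c * cinner f g"
  unfolding cinner_def by (simp add: mult.left_commute infsum_cmult_right')

lemma cinner_scale_left: "cinner (\<lambda>x. c * f x) g = cnj c * cinner f g"
  unfolding cinner_def by (simp add: mult.assoc infsum_cmult_right')

lemma cinner_uminus_right: "cinner f (\<lambda>x. - g x) = - cinner f g"
  using cinner_scale_right[of f "-1" g] by simp

lemma cinner_uminus_left: "cinner (\<lambda>x. - f x) g = - cinner f g"
  using cinner_scale_left[of "-1" f g] by simp

lemma cinner_diff_right:
  "ell2 f \<Longrightarrow> ell2 g \<Longrightarrow> ell2 h \<Longrightarrow> cinner f (\<lambda>x. g x - h x) = cinner f g - cinner f h"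
  using cinner_add_right[of f g "\<lambda>x. - h x"] by (simp add: ell2_uminus cinner_uminus_right)

lemma cinner_diff_left:
  "ell2 f \<Longrightarrow> ell2 g \<Longrightarrow> ell2 h \<Longrightarrow> cinner (\<lambda>x. g x - h x) f = cinner g f - cinner h f"
  using cinner_add_left[of f g "\<lambda>x. - h x"] by (simp add: ell2_uminus cinner_uminus_left)

lemma cinner_sum_right:
  assumes "ell2 f" "\<And>i. i \<in> I \<Longrightarrow> ell2 (g i)"
  shows "cinner f (\<lambda>x. \<Sum>i\<in>I. g i x) = (\<Sum>i\<in>I. cinner f (g i))"
  using assms by (induction I rule: infinite_finite_induct) (auto simp: cinner_add_right ell2_sum)

lemma cinner_sum_left:
  assumes "ell2 f" "\<And>i. i \<in> I \<Longrightarrow> ell2 (g i)"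
  shows "cinner (\<lambda>x. \<Sum>i\<in>I. g i x) f = (\<Sum>i\<in>I. cinner (g i) f)"
  using assms by (induction I rule: infinite_finite_induct) (auto simp: cinner_add_left ell2_sum)

lemma cinner_self: "ell2 f \<Longrightarrow> cinner f f = complex_of_real ((norm2 f)\<^sup>2)"
  by (rule cinner_eqI)
    (use norm2_power2_has_sum[of f] in \<open>simp add: complex_norm_square[symmetric] mult.commute has_sum_of_real_iff del: of_real_power\<close>)

lemma Cauchy_Schwarz_cinner:
  assumes "ell2 f" "ell2 g"
  shows "cmod (cinner f g) \<le> norm2 f * norm2 g"
proof -
  have "cmod (cinner f g) \<le> (\<Sum>\<^sub>\<infinity>x. cmod (cnj (f x) * g x))"
    unfolding cinner_def
    by (rule norm_infsum_bound) (use abs_summable_mult[OF assms] in \<open>simp add: norm_mult\<close>)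
  also have "\<dots> = (\<Sum>\<^sub>\<infinity>x. cmod (f x) * cmod (g x))"
    by (simp add: norm_mult)
  also have "\<dots> \<le> norm2 f * norm2 g"
  proof (rule infsum_le_finite_sums[OF abs_summable_mult[OF assms]])
    fix F :: "'a set" assume F: "finite F"
    have "(\<Sum>x\<in>F. cmod (f x) * cmod (g x)) \<le> L2_set (\<lambda>x. cmod (f x)) F * L2_set (\<lambda>x. cmod (g x)) F"
      using L2_set_mult_ineq[of "\<lambda>x. cmod (f x)" "\<lambda>x. cmod (g x)" F] by simp
    also have "\<dots> \<le> norm2 f * norm2 g"
      unfolding L2_set_def
      by (intro mult_mono real_le_lsqrt sum_le_norm2 assms F norm2_nonneg real_sqrt_ge_zero sum_nonneg) auto
    finally show "(\<Sum>x\<in>F. cmod (f x) * cmod (g x)) \<le> norm2 f * norm2 g" .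
  qed
  finally show ?thesis .
qed

lemma norm2_add_power2:
  assumes "ell2 f" "ell2 g"
  shows "(norm2 (\<lambda>x. f x + g x))\<^sup>2 = (norm2 f)\<^sup>2 + 2 * Re (cinner f g) + (norm2 g)\<^sup>2"
proof -
  have "complex_of_real ((norm2 (\<lambda>x. f x + g x))\<^sup>2) = cinner (\<lambda>x. f x + g x) (\<lambda>x. f x + g x)"
    by (rule cinner_self[symmetric, OF ell2_add[OF assms]])
  also have "\<dots> = cinner f f + (cinner f g + cnj (cinner f g)) + cinner g g"
    using assms by (simp add: cinner_add_left cinner_add_right ell2_add cnj_cinner)
  also have "\<dots> = complex_of_real ((norm2 f)\<^sup>2 + 2 * Re (cinner f g) + (norm2 g)\<^sup>2)"
    using assms by (simp add: cinner_self complex_add_cnj)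
  finally show ?thesis by (simp only: of_real_eq_iff)
qed

lemma norm2_diff_power2:
  assumes "ell2 f" "ell2 g"
  shows "(norm2 (\<lambda>x. f x - g x))\<^sup>2 = (norm2 f)\<^sup>2 - 2 * Re (cinner f g) + (norm2 g)\<^sup>2"
  using norm2_add_power2[OF assms(1) ell2_uminus[OF assms(2)]]
  by (simp add: cinner_uminus_right norm2_def)

section \<open>Truncation, continuity of the inner product, completeness\<close>

definition restr :: "'x set \<Rightarrow> ('x \<Rightarrow> complex) \<Rightarrow> 'x \<Rightarrow> complex" where
  "restr F f = (\<lambda>x. if x \<in> F then f x else 0)"

definition basis :: "'x \<Rightarrow> 'x \<Rightarrow> complex" where
  "basis y = (\<lambda>x. if x = y then 1 else 0)"

lemma ell2_basis [simp]: "ell2 (basis y)"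
  by (rule ell2_finite_support) (simp add: basis_def)

lemma cinner_basis_left [simp]: "cinner (basis y) f = f y"
  by (rule cinner_eqI) (rule has_sum_finite_neutralI[where B = "{y}"], auto simp: basis_def)

lemma ell2_restr: "ell2 f \<Longrightarrow> ell2 (restr F f)"
  unfolding ell2_def restr_def
  by (rule summable_on_comparison_test[where f = "\<lambda>x. (cmod (f x))\<^sup>2"]) auto

lemma restr_eq_sum: "finite F \<Longrightarrow> restr F f = (\<lambda>x. \<Sum>y\<in>F. f y * basis y x)"
  by (auto simp: restr_def basis_def fun_eq_iff if_distrib cong: if_cong)

text \<open>Truncation to \<open>F\<close> keeps exactly the mass of \<open>f\<close> on
  \<open>F\<close>, so the squared distance is the squared norm minus one of its partial
  sums.\<close>

lemma norm2_restr_tendsto: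
  assumes "ell2 f"
  shows "((\<lambda>F. norm2 (\<lambda>x. f x - restr F f x)) \<longlongrightarrow> 0) (finite_subsets_at_top UNIV)"
proof -
  have "((\<lambda>F. sqrt ((norm2 f)\<^sup>2 - (\<Sum>x\<in>F. (cmod (f x))\<^sup>2))) \<longlongrightarrow> sqrt ((norm2 f)\<^sup>2 - (norm2 f)\<^sup>2))
          (finite_subsets_at_top UNIV)"
    using norm2_power2_has_sum[OF assms] unfolding has_sum_def by (intro tendsto_intros)
  moreover have "norm2 (\<lambda>x. f x - restr F f x) = sqrt ((norm2 f)\<^sup>2 - (\<Sum>x\<in>F. (cmod (f x))\<^sup>2))"
    if "finite F" for F
  proof -
    have "((\<lambda>x. (cmod (f x))\<^sup>2 - (if x \<in> F then (cmod (f x))\<^sup>2 else 0)) has_sum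
        ((norm2 f)\<^sup>2 - (\<Sum>x\<in>F. (cmod (f x))\<^sup>2))) UNIV"
    proof -
      have "((\<lambda>x. if x \<in> F then (cmod (f x))\<^sup>2 else 0) has_sum (\<Sum>x\<in>F. (cmod (f x))\<^sup>2)) UNIV"
        by (rule has_sum_finite_neutralI[OF that]) auto
      then have "((\<lambda>x. - (if x \<in> F then (cmod (f x))\<^sup>2 else 0)) has_sum - (\<Sum>x\<in>F. (cmod (f x))\<^sup>2)) UNIV"
        by (simp only: has_sum_uminus minus_minus)
      from has_sum_add[OF norm2_power2_has_sum[OF assms] this] show ?thesis by simp
    qed
    then have "((\<lambda>x. (cmod (f x - restr F f x))\<^sup>2) has_sum
        ((norm2 f)\<^sup>2 - (\<Sum>x\<in>F. (cmod (f x))\<^sup>2))) UNIV"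
      by (rule has_sum_cong[THEN iffD1, rotated]) (auto simp: restr_def)
    from norm2_power2_eqI(2)[OF this] show ?thesis
      by (metis norm2_nonneg real_sqrt_unique)
  qed
  ultimately show ?thesis
    by (subst tendsto_cong[where g = "\<lambda>F. sqrt ((norm2 f)\<^sup>2 - (\<Sum>x\<in>F. (cmod (f x))\<^sup>2))"])
      (auto intro: eventually_finite_subsets_at_top_weakI)
qed

text \<open>Cauchy-Schwarz applied to the difference. The filter is arbitrary since both sequences
  and the net of finite index sets occur.\<close>

lemma cinner_tendsto_right:
  assumes "ell2 f" "ell2 h" "\<And>k. ell2 (g k)" "((\<lambda>k. norm2 (\<lambda>x. h x - g k x)) \<longlongrightarrow> 0) F"
  shows "((\<lambda>k. cinner f (g k)) \<longlongrightarrow> cinner f h) F"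
proof (rule Lim_transform)
  show "((\<lambda>k. cinner f h) \<longlongrightarrow> cinner f h) F" by simp
  have "((\<lambda>k. norm2 f * norm2 (\<lambda>x. h x - g k x)) \<longlongrightarrow> 0) F"
    using tendsto_mult_left[OF assms(4), of "norm2 f"] by simp
  moreover have "\<forall>\<^sub>F k in F. cmod (cinner f (\<lambda>x. h x - g k x)) \<le> norm2 f * norm2 (\<lambda>x. h x - g k x)"
    by (intro always_eventually allI Cauchy_Schwarz_cinner assms(1) ell2_diff[OF assms(2,3)])
  ultimately have "((\<lambda>k. cinner f (\<lambda>x. h x - g k x)) \<longlongrightarrow> 0) F"
    by (rule Lim_null_comparison[rotated])
  then show "((\<lambda>k. cinner f (g k) - cinner f h) \<longlongrightarrow> 0) F"
    using tendsto_minus[of "\<lambda>k. cinner f (\<lambda>x. h x - g k x)" 0 F]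
    by (simp add: cinner_diff_right assms)
qed

lemma cinner_tendsto_left:
  assumes "ell2 f" "ell2 h" "\<And>k. ell2 (g k)" "((\<lambda>k. norm2 (\<lambda>x. h x - g k x)) \<longlongrightarrow> 0) F"
  shows "((\<lambda>k. cinner (g k) f) \<longlongrightarrow> cinner h f) F"
  using tendsto_cnj[OF cinner_tendsto_right[OF assms]] by (simp add: cnj_cinner)

text \<open>Coordinates are bounded by the norm, so the limit exists pointwise. Letting one index
  tend to infinity in finite partial sums, where the limit commutes with the sum, upgrades this to
  norm convergence.\<close>

lemma ell2_complete:
  fixes f :: "nat \<Rightarrow> 'x \<Rightarrow> complex"
  assumes ell: "\<And>k. ell2 (f k)"
    and cauchy: "\<And>\<epsilon>. \<epsilon> > 0 \<Longrightarrow> \<exists>K. \<forall>k\<ge>K. \<forall>l\<ge>K. norm2 (\<lambda>x. f k x - f l x) \<le> \<epsilon>"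
  obtains h where "ell2 h" "(\<lambda>k. norm2 (\<lambda>x. h x - f k x)) \<longlonglongrightarrow> 0"
proof -
  have "convergent (\<lambda>k. f k x)" for x
  proof (rule Cauchy_convergent, rule metric_CauchyI)
    fix \<epsilon> :: real assume "\<epsilon> > 0"
    then obtain K where K: "\<forall>k\<ge>K. \<forall>l\<ge>K. norm2 (\<lambda>x. f k x - f l x) \<le> \<epsilon> / 2"
      using cauchy[of "\<epsilon> / 2"] by auto
    have "dist (f k x) (f l x) < \<epsilon>" if "k \<ge> K" "l \<ge> K" for k l
      using cmod_le_norm2[OF ell2_diff[OF ell[of k] ell[of l]], of x] K that \<open>\<epsilon> > 0\<close>
      by (fastforce simp: dist_norm)
    then show "\<exists>K. \<forall>k\<ge>K. \<forall>l\<ge>K. dist (f k x) (f l x) < \<epsilon>" by blast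
  qed
  then obtain h where h: "\<And>x. (\<lambda>k. f k x) \<longlonglongrightarrow> h x"
    unfolding convergent_def by metis
  have key: "ell2 (\<lambda>x. h x - f k x) \<and> norm2 (\<lambda>x. h x - f k x) \<le> \<epsilon>"
    if "\<epsilon> > 0" "k \<ge> K" "\<forall>k\<ge>K. \<forall>l\<ge>K. norm2 (\<lambda>x. f k x - f l x) \<le> \<epsilon>" for k K \<epsilon>
  proof -
    have "(\<Sum>x\<in>F. (cmod (h x - f k x))\<^sup>2) \<le> \<epsilon>\<^sup>2" if "finite F" for F
    proof (rule Lim_bounded)
      show "(\<lambda>l. \<Sum>x\<in>F. (cmod (f l x - f k x))\<^sup>2) \<longlonglongrightarrow> (\<Sum>x\<in>F. (cmod (h x - f k x))\<^sup>2)"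
        by (intro tendsto_intros h)
      have "(\<Sum>x\<in>F. (cmod (f l x - f k x))\<^sup>2) \<le> \<epsilon>\<^sup>2" if "l \<ge> K" for l
        using sum_le_norm2[OF ell2_diff[OF ell[of l] ell[of k]] \<open>finite F\<close>]
          power_mono[of "norm2 (\<lambda>x. f l x - f k x)" \<epsilon> 2] \<open>\<forall>k\<ge>K. _\<close> \<open>k \<ge> K\<close> that
        by (meson norm2_nonneg order_trans)
      then show "\<forall>l\<ge>K. (\<Sum>x\<in>F. (cmod (f l x - f k x))\<^sup>2) \<le> \<epsilon>\<^sup>2" by blast
    qed
    from ell2I[OF this] show ?thesis
      using \<open>\<epsilon> > 0\<close> by (auto intro: power2_le_imp_le)
  qed
  have "ell2 h"
  proof -
    obtain K where "\<forall>k\<ge>K. \<forall>l\<ge>K. norm2 (\<lambda>x. f k x - f l x) \<le> 1"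
      using cauchy[of 1] by auto
    then have "ell2 (\<lambda>x. h x - f K x)" using key[of 1 K K] by simp
    from ell2_add[OF this ell[of K]] show ?thesis by simp
  qed
  moreover have "(\<lambda>k. norm2 (\<lambda>x. h x - f k x)) \<longlonglongrightarrow> 0"
  proof (rule LIMSEQ_I)
    fix \<epsilon> :: real assume "\<epsilon> > 0"
    then obtain K where K: "\<forall>k\<ge>K. \<forall>l\<ge>K. norm2 (\<lambda>x. f k x - f l x) \<le> \<epsilon> / 2"
      using cauchy[of "\<epsilon> / 2"] by auto
    have "norm (norm2 (\<lambda>x. h x - f k x) - 0) < \<epsilon>" if "k \<ge> K" for k
      using key[OF _ that K] \<open>\<epsilon> > 0\<close> by simp
    then show "\<exists>K. \<forall>k\<ge>K. norm (norm2 (\<lambda>x. h x - f k x) - 0) < \<epsilon>" by blast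
  qed
  ultimately show ?thesis using that by blast
qed

subsection \<open>Square-summable functions of two variables\<close>

lemma ell2_rows:
  assumes "ell2 F"
  shows "ell2 (\<lambda>y. F (x, y))" "ell2 (\<lambda>x. F (x, y))"
proof -
  have *: "ell2 (\<lambda>z. F (g z))" if "inj g" for g :: "'c \<Rightarrow> 'a \<times> 'b"
  proof -
    have "(\<lambda>z. (cmod (F z))\<^sup>2) summable_on range g"
      using assms unfolding ell2_def by (rule summable_on_subset_banach) auto
    then show ?thesis
      using summable_on_reindex[OF that, of "\<lambda>z. (cmod (F z))\<^sup>2"] by (simp add: ell2_def o_def)
  qed
  show "ell2 (\<lambda>y. F (x, y))" by (rule *) (auto simp: inj_def)
  show "ell2 (\<lambda>x. F (x, y))" 
  proof -
    have "(\<lambda>z. (cmod (F z))\<^sup>2) summable_on range (\<lambda>x. (x, y))"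
      using assms unfolding ell2_def by (rule summable_on_subset_banach) auto
    then show ?thesis
      using summable_on_reindex[of "\<lambda>x. (x, y)" UNIV "\<lambda>z. (cmod (F z))\<^sup>2"] by (auto simp: ell2_def o_def inj_def)
  qed
qed

lemma has_sum_prod_rows:
  fixes f :: "'x \<times> 'y \<Rightarrow> 'a :: banach"
  assumes "(f has_sum S) UNIV" "\<And>x. ((\<lambda>y. f (x, y)) has_sum g x) UNIV"
  shows "(g has_sum S) UNIV"
  using has_sum_SigmaD[where f = f and S = S and A = UNIV and B = "\<lambda>_. UNIV" and g = g] assms by (simp add: UNIV_Times_UNIV)

lemma has_sum_prod_cols:
  fixes f :: "'x \<times> 'y \<Rightarrow> 'a :: banach"
  assumes "(f has_sum S) UNIV" "\<And>y. ((\<lambda>x. f (x, y)) has_sum g y) UNIV"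
  shows "(g has_sum S) UNIV"
proof (rule has_sum_prod_rows)
  show "((\<lambda>(x, y). f (y, x)) has_sum S) UNIV"
    using assms(1) has_sum_swap[where f = f and S = S and A = UNIV and B = UNIV] by simp
qed (use assms(2) in simp)

lemma cinner_rows:
  assumes "ell2 F" "ell2 G"
  shows "((\<lambda>x. cinner (\<lambda>y. F (x, y)) (\<lambda>y. G (x, y))) has_sum cinner F G) UNIV"
  by (rule has_sum_prod_rows[OF cinner_has_sum[OF assms]]) (intro cinner_has_sum ell2_rows[OF assms(1)] ell2_rows[OF assms(2)])

lemma cinner_cols:
  assumes "ell2 F" "ell2 G"
  shows "((\<lambda>y. cinner (\<lambda>x. F (x, y)) (\<lambda>x. G (x, y))) has_sum cinner F G) UNIV"
  by (rule has_sum_prod_cols[OF cinner_has_sum[OF assms]]) (intro cinner_has_sum ell2_rows[OF assms(1)] ell2_rows[OF assms(2)])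

lemma norm2_cols:
  assumes "ell2 F"
  shows "((\<lambda>y. (norm2 (\<lambda>x. F (x, y)))\<^sup>2) has_sum (norm2 F)\<^sup>2) UNIV"
  using cinner_cols[OF assms assms] 
  by (simp add: cinner_self assms ell2_rows has_sum_of_real_iff del: of_real_power)

text \<open>A kernel read as a function on the product has its Hilbert-Schmidt norm as
  \<open>norm2\<close>; summation by columns is how the trace in \<open>has_QFI\<close> becomes a
  squared norm.\<close>

lemma ell2_colsI:
  assumes "\<And>y. ell2 (\<lambda>x. F (x, y))" "((\<lambda>y. (norm2 (\<lambda>x. F (x, y)))\<^sup>2) has_sum S) UNIV"
  shows "ell2 F" "(norm2 F)\<^sup>2 = S"
proof -
  have "(\<lambda>(y, x). (cmod (F (x, y)))\<^sup>2) summable_on UNIV \<times> UNIV"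
    by (rule summable_on_SigmaI[where g = "\<lambda>y. (norm2 (\<lambda>x. F (x, y)))\<^sup>2"])
      (use assms in \<open>auto intro: norm2_power2_has_sum has_sum_imp_summable\<close>)
  then have "(\<lambda>(x, y). (cmod (F (x, y)))\<^sup>2) summable_on UNIV \<times> UNIV"
    by (subst summable_on_swap) simp
  then show "ell2 F" by (simp add: ell2_def case_prod_unfold)
  from has_sum_unique[OF norm2_cols[OF this] assms(2)] show "(norm2 F)\<^sup>2 = S" .
qed

lemma ell2_swap: "ell2 F \<Longrightarrow> ell2 (\<lambda>(x, y). F (y, x))"
  using summable_on_swap[of "\<lambda>z. (cmod (F z))\<^sup>2" UNIV UNIV] 
  by (simp add: ell2_def case_prod_unfold)

lemma ell2_tensor:
  assumes "ell2 f" "ell2 g"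
  shows "ell2 (\<lambda>(x, y). f x * g y)"
proof (rule ell2_colsI(1))
  show "ell2 (\<lambda>x. case (x, y) of (x, y) \<Rightarrow> f x * g y)" for y
    using ell2_scale[OF assms(1), of "g y"] by (simp add: mult.commute)
  have "norm2 (\<lambda>x. case (x, y) of (x, y) \<Rightarrow> f x * g y) = cmod (g y) * norm2 f" for y
    using norm2_scale[of "g y" f] by (simp add: mult.commute)
  then show "((\<lambda>y. (norm2 (\<lambda>x. case (x, y) of (x, y) \<Rightarrow> f x * g y))\<^sup>2) has_sum (norm2 g)\<^sup>2 * (norm2 f)\<^sup>2) UNIV"
    by (simp add: power_mult_distrib has_sum_cmult_left norm2_power2_has_sum assms)
qed

section \<open>Operators given by kernels\<close>

lemma kapp_eq_cinner: "kapp A f x = cinner (\<lambda>y. cnj (A x y)) f"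
  by (simp add: kapp_def cinner_def)

lemma kmult_eq_kapp: "kmult A B x z = kapp A (\<lambda>y. B y z) x"
  by (simp add: kmult_def kapp_def)

lemma kapp_basis: "kapp A (basis y) = (\<lambda>x. A x y)"
  unfolding kapp_def
  by (intro ext infsumI, rule has_sum_finite_neutralI[where B = "{y}"]) (auto simp: basis_def)

lemma kapp_zero [simp]: "kapp A (\<lambda>_. 0) = (\<lambda>_. 0)"
  by (simp add: kapp_def)

lemma bounded_op_row: "bounded_op A \<Longrightarrow> ell2 (A x)"
  by (simp add: bounded_op_def)

lemma bounded_op_ell2: "bounded_op A \<Longrightarrow> ell2 f \<Longrightarrow> ell2 (kapp A f)"
  by (auto simp: bounded_op_def bounded_map_def)

lemma bounded_op_col: "bounded_op A \<Longrightarrow> ell2 (\<lambda>x. A x y)"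
  using bounded_op_ell2[of A "basis y"] by (simp add: kapp_basis)

lemma bounded_mapE:
  assumes "bounded_map T"
  obtains C where "C \<ge> 0" "\<And>f. ell2 f \<Longrightarrow> ell2 (T f)" "\<And>f. ell2 f \<Longrightarrow> norm2 (T f) \<le> C * norm2 f"
proof -
  obtain C where C: "\<And>f. ell2 f \<Longrightarrow> ell2 (T f) \<and> norm2 (T f) \<le> C * norm2 f"
    using assms by (auto simp: bounded_map_def)
  have "norm2 (T f) \<le> \<bar>C\<bar> * norm2 f" if "ell2 f" for f
  proof -
    have "norm2 (T f) \<le> C * norm2 f" using C[OF that] ..
    also have "\<dots> \<le> \<bar>C\<bar> * norm2 f" by (rule mult_right_mono) simp_all
    finally show ?thesis .
  qed
  moreover have "ell2 (T f)" if "ell2 f" for f using C[OF that] ..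
  ultimately show ?thesis using that[of "\<bar>C\<bar>"] abs_ge_zero by blast
qed

lemma kapp_add:
  "bounded_op A \<Longrightarrow> ell2 f \<Longrightarrow> ell2 g \<Longrightarrow> kapp A (\<lambda>x. f x + g x) = (\<lambda>x. kapp A f x + kapp A g x)"
  by (rule ext) (simp add: kapp_eq_cinner cinner_add_right ell2_cnj bounded_op_row)

lemma kapp_diff:
  "bounded_op A \<Longrightarrow> ell2 f \<Longrightarrow> ell2 g \<Longrightarrow> kapp A (\<lambda>x. f x - g x) = (\<lambda>x. kapp A f x - kapp A g x)"
  by (rule ext) (simp add: kapp_eq_cinner cinner_diff_right ell2_cnj bounded_op_row)

lemma kapp_scale: "kapp A (\<lambda>x. c * f x) = (\<lambda>x. c * kapp A f x)"
  by (rule ext) (simp add: kapp_eq_cinner cinner_scale_right)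

lemma positive_op_bounded: "positive_op A \<Longrightarrow> bounded_op A"
  by (simp add: positive_op_def)

lemma positive_op_cinner: "positive_op A \<Longrightarrow> ell2 f \<Longrightarrow> cinner f (kapp A f) \<in> \<real>\<^sub>\<ge>\<^sub>0"
  by (simp add: positive_op_def)

text \<open>Polarisation: the quadratic form is real at \<open>f + c g\<close>; \<open>c = 1\<close>
  gives the imaginary part and \<open>c = \<i>\<close> the real part of the identity.\<close>

lemma positive_op_hermitian:
  assumes A: "positive_op A" and f: "ell2 f" and g: "ell2 g"
  shows "cinner f (kapp A g) = cinner (kapp A f) g"
proof -
  note b = positive_op_bounded[OF A]
  have real: "Im (cinner h (kapp A h)) = 0" if "ell2 h" for h
    using positive_op_cinner[OF A that] by (simp add: complex_nonneg_Reals_iff)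
  have ex: "cinner (\<lambda>x. f x + c * g x) (kapp A (\<lambda>x. f x + c * g x))
      = cinner f (kapp A f) + c * cinner f (kapp A g) + cnj c * cinner g (kapp A f)
        + (c * cnj c) * cinner g (kapp A g)" for c
    using f g by (simp add: kapp_add[OF b] kapp_scale cinner_add_left cinner_add_right ell2_add ell2_scale
        bounded_op_ell2[OF b] cinner_scale_left cinner_scale_right algebra_simps)
  have 1: "Im (cinner f (kapp A g) + cinner g (kapp A f)) = 0"
    using real[OF ell2_add[OF f ell2_scale[OF g, of 1]]] real[OF f] real[OF g] unfolding ex by simp
  have 2: "Re (cinner f (kapp A g)) - Re (cinner g (kapp A f)) = 0"
    using real[OF ell2_add[OF f ell2_scale[OF g, of \<i>]]] real[OF f] real[OF g] unfolding ex by simp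
  have "cinner f (kapp A g) = cnj (cinner g (kapp A f))"
    using 1 2 by (simp add: complex_eq_iff)
  then show ?thesis by (simp add: cnj_cinner)
qed

lemma positive_op_cnj: "positive_op A \<Longrightarrow> cnj (A x y) = A y x"
proof -
  assume A: "positive_op A"
  have "cinner (basis y) (kapp A (basis x)) = cinner (kapp A (basis y)) (basis x)"
    by (rule positive_op_hermitian[OF A]) simp_all
  then have "A y x = cnj (cinner (basis x) (kapp A (basis y)))"
    unfolding cnj_cinner by (simp add: kapp_basis)
  then show ?thesis by (simp add: kapp_basis)
qed

lemma kapp_eq_cinner_col: "positive_op A \<Longrightarrow> kapp A f x = cinner (\<lambda>y. A y x) f"
  by (simp add: kapp_eq_cinner positive_op_cnj)

lemma
  assumes "is_op_sqrt A R"
  shows is_op_sqrt_positive: "positive_op R"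
    and is_op_sqrt_col: "(\<lambda>z. A z y) = kapp R (\<lambda>z. R z y)"
    and is_op_sqrt_cnj: "cnj (A x y) = A y x"
    and is_op_sqrt_entry: "A x y = cinner (\<lambda>z. R z x) (\<lambda>z. R z y)"
proof -
  show R: "positive_op R" using assms by (simp add: is_op_sqrt_def)
  have A: "A x y = kapp R (\<lambda>z. R z y) x" for x y
    using assms by (auto simp: is_op_sqrt_def kmult_eq_kapp)
  show "(\<lambda>z. A z y) = kapp R (\<lambda>z. R z y)" by (simp add: A)
  have e: "A x y = cinner (\<lambda>z. R z x) (\<lambda>z. R z y)" for x y
    by (simp add: A kapp_eq_cinner_col[OF R])
  then show "A x y = cinner (\<lambda>z. R z x) (\<lambda>z. R z y)" .
  show "cnj (A x y) = A y x" unfolding e by (rule cnj_cinner)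
qed

text \<open>\<open>kmult\<close> only records entries, so associativity of application would be an
  exchange of infinite sums; moving \<open>R\<close> across the inner product replaces it.\<close>

lemma kapp_is_op_sqrt:
  assumes "is_op_sqrt A R" "ell2 f"
  shows "kapp A f = kapp R (kapp R f)"
proof
  fix x
  note R = is_op_sqrt_positive[OF assms(1)] 
  note b = positive_op_bounded[OF R]
  have "kapp R (kapp R f) x = cinner (\<lambda>y. R y x) (kapp R f)"
    by (rule kapp_eq_cinner_col[OF R])
  also have "\<dots> = cinner (kapp R (\<lambda>y. R y x)) f"
    by (rule positive_op_hermitian[OF R bounded_op_col[OF b] assms(2)])
  also have "\<dots> = kapp A f x"
    unfolding is_op_sqrt_col[OF assms(1), symmetric] kapp_eq_cinner is_op_sqrt_cnj[OF assms(1)] ..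
  finally show "kapp A f x = kapp R (kapp R f) x" ..
qed

text \<open>Recovers the matrix of a map that is not given by a kernel: by boundedness the images of
  the truncations of \<open>f\<close> converge to \<open>T f\<close>. It is meant for
  \<open>L\<close> after \<open>R\<close>, where \<open>L\<close> alone may be unbounded.\<close>

lemma bounded_map_has_sum:
  assumes T: "bounded_map T"
    and add: "\<And>f g. ell2 f \<Longrightarrow> ell2 g \<Longrightarrow> T (\<lambda>x. f x + g x) = (\<lambda>x. T f x + T g x)"
    and scale: "\<And>c f. ell2 f \<Longrightarrow> T (\<lambda>x. c * f x) = (\<lambda>x. c * T f x)"
    and f: "ell2 f"
  shows "((\<lambda>y. T (basis y) x * f y) has_sum T f x) UNIV"
proof -
  obtain C where C: "C \<ge> 0" "\<And>f. ell2 f \<Longrightarrow> ell2 (T f)" "\<And>f. ell2 f \<Longrightarrow> norm2 (T f) \<le> C * norm2 f"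
    using bounded_mapE[OF T] by metis
  have zero: "T (\<lambda>_. 0) = (\<lambda>_. 0)"
    using scale[OF ell2_zero, of 0] by simp
  have fin: "T (\<lambda>x. \<Sum>y\<in>F. f y * basis y x) = (\<lambda>x. \<Sum>y\<in>F. f y * T (basis y) x)" for F
  proof (induction F rule: infinite_finite_induct)
    case (insert a F)
    have "T (\<lambda>x. f a * basis a x + (\<Sum>y\<in>F. f y * basis y x))
        = (\<lambda>x. f a * T (basis a) x + (\<Sum>y\<in>F. f y * T (basis y) x))"
      by (subst add) (auto intro!: ell2_scale ell2_sum simp: scale insert.IH)
    with insert.hyps show ?case by simp
  qed (simp_all add: zero)
  have "((\<lambda>F. T f x - (\<Sum>y\<in>F. T (basis y) x * f y)) \<longlongrightarrow> 0) (finite_subsets_at_top UNIV)"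
  proof (rule Lim_null_comparison)
    show "((\<lambda>F. C * norm2 (\<lambda>x. f x - restr F f x)) \<longlongrightarrow> 0) (finite_subsets_at_top UNIV)"
      using tendsto_mult_left[OF norm2_restr_tendsto[OF f], of C] by simp
    have "cmod (T f x - (\<Sum>y\<in>F. T (basis y) x * f y)) \<le> C * norm2 (\<lambda>x. f x - restr F f x)"
      if "finite F" for F
    proof -
      let ?g = "\<lambda>x. f x - restr F f x"
      have g: "ell2 ?g" by (intro ell2_diff ell2_restr f)
      have "T f = T (\<lambda>x. ?g x + restr F f x)" by simp
      also have "\<dots> = (\<lambda>x. T ?g x + T (restr F f) x)"
        by (rule add[OF g ell2_restr[OF f]])
      also have "T (restr F f) = (\<lambda>x. \<Sum>y\<in>F. f y * T (basis y) x)"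
        unfolding restr_eq_sum[OF that] by (rule fin)
      finally have "T f x - (\<Sum>y\<in>F. T (basis y) x * f y) = T ?g x"
        by (simp add: mult.commute)
      also have "cmod \<dots> \<le> norm2 (T ?g)" by (rule cmod_le_norm2[OF C(2)[OF g]])
      also have "\<dots> \<le> C * norm2 ?g" by (rule C(3)[OF g])
      finally show ?thesis .
    qed
    then show "\<forall>\<^sub>F F in finite_subsets_at_top UNIV.
        cmod (T f x - (\<Sum>y\<in>F. T (basis y) x * f y)) \<le> C * norm2 (\<lambda>x. f x - restr F f x)"
      by (intro eventually_finite_subsets_at_top_weakI)
  qed
  from tendsto_diff[OF tendsto_const[of "T f x"] this] show ?thesis
    unfolding has_sum_def by simp
qed

text \<open>The ideal property of Hilbert-Schmidt operators, from the operator bound applied to each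
  column.\<close>

lemma ell2_kapp_cols:
  assumes R: "bounded_op R" and Z: "ell2 Z"
  shows "ell2 (\<lambda>(x, y). kapp R (\<lambda>z. Z (z, y)) x)"
proof -
  obtain C where C: "C \<ge> 0" "\<And>f. ell2 f \<Longrightarrow> norm2 (kapp R f) \<le> C * norm2 f"
    using R bounded_mapE[of "kapp R"] unfolding bounded_op_def by metis
  have "(\<lambda>y. (norm2 (kapp R (\<lambda>z. Z (z, y))))\<^sup>2) summable_on UNIV"
  proof (rule summable_on_comparison_test)
    show "(\<lambda>y. C\<^sup>2 * (norm2 (\<lambda>z. Z (z, y)))\<^sup>2) summable_on UNIV"
      by (rule summable_on_cmult_right) (rule has_sum_imp_summable[OF norm2_cols[OF Z]])
    show "(norm2 (kapp R (\<lambda>z. Z (z, y))))\<^sup>2 \<le> C\<^sup>2 * (norm2 (\<lambda>z. Z (z, y)))\<^sup>2" for y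
      using power_mono[OF C(2)[OF ell2_rows(2)[OF Z]] norm2_nonneg] by (simp add: power_mult_distrib)
  qed simp
  then show ?thesis
    by (intro ell2_colsI(1)[where S = "\<Sum>\<^sub>\<infinity>y. (norm2 (kapp R (\<lambda>z. Z (z, y))))\<^sup>2"])
      (auto intro!: bounded_op_ell2[OF R] ell2_rows[OF Z])
qed

section \<open>A variational characterisation of the quantum Fisher information\<close>

text \<open>Projection onto the closure of \<open>V\<close> with residual \<open>Z\<close>; a
  minimising sequence stands in for the closure. Scalars are real because hermitian matrices form
  only a real vector space, so orthogonality concerns the real part only.\<close>

lemma ell2_approx_orthogonal:
  assumes \<tau>: "ell2 \<tau>" and V: "\<And>v. v \<in> V \<Longrightarrow> ell2 v" and V0: "(\<lambda>_. 0) \<in> V"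
    and comb: "\<And>v w a b. v \<in> V \<Longrightarrow> w \<in> V \<Longrightarrow> (\<lambda>x. complex_of_real a * v x + complex_of_real b * w x) \<in> V"
  obtains v :: "nat \<Rightarrow> 'x \<Rightarrow> complex" and Z where
    "\<And>k. v k \<in> V" "ell2 Z" "(\<lambda>k. norm2 (\<lambda>x. Z x - (\<tau> x - v k x))) \<longlonglongrightarrow> 0"
    "\<And>w. w \<in> V \<Longrightarrow> Re (cinner w Z) = 0"
proof -
  define Q where "Q v = (norm2 (\<lambda>x. \<tau> x - v x))\<^sup>2" for v
  define d where "d = Inf (Q ` V)"
  have bdd: "bdd_below (Q ` V)" by (rule bdd_belowI[of _ 0]) (auto simp: Q_def)
  have d_le: "d \<le> Q v" if "v \<in> V" for v
    unfolding d_def using that bdd by (intro cInf_lower) auto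
  have "\<exists>v\<in>V. Q v < d + 1 / real (Suc k)" for k
  proof -
    have "Inf (Q ` V) < d + 1 / real (Suc k)" by (simp add: d_def)
    then show ?thesis using bdd V0 by (subst (asm) cInf_less_iff) auto
  qed
  then obtain v where v: "\<And>k. v k \<in> V" "\<And>k. Q (v k) < d + 1 / real (Suc k)" by metis
  define Zk where "Zk = (\<lambda>k x. \<tau> x - v k x)"
  have ellZ: "ell2 (Zk k)" for k unfolding Zk_def by (intro ell2_diff \<tau> V v)
  have Qv: "Q (v k) = (norm2 (Zk k))\<^sup>2" for k by (simp add: Q_def Zk_def)
  \<comment> \<open>Parallelogram law: the midpoint of \<open>v k\<close> and \<open>v l\<close>
    lies in \<open>V\<close>, so half the sum of their residuals has squared norm at least
    \<open>d\<close>.\<close>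
  have par: "(norm2 (\<lambda>x. Zk k x - Zk l x))\<^sup>2 \<le> 2 / real (Suc k) + 2 / real (Suc l)" for k l
  proof -
    have "(\<lambda>x. complex_of_real (1/2) * v k x + complex_of_real (1/2) * v l x) \<in> V" by (intro comb v)
    from d_le[OF this] have "d \<le> (norm2 (\<lambda>x. (1/2) * (Zk k x + Zk l x)))\<^sup>2"
      by (simp add: Q_def Zk_def field_simps)
    then have "4 * d \<le> (norm2 (\<lambda>x. Zk k x + Zk l x))\<^sup>2"
      by (simp only: norm2_scale) (simp add: power_mult_distrib field_simps)
    moreover have "(norm2 (\<lambda>x. Zk k x - Zk l x))\<^sup>2 + (norm2 (\<lambda>x. Zk k x + Zk l x))\<^sup>2
        = 2 * Q (v k) + 2 * Q (v l)"
      by (simp add: norm2_diff_power2 norm2_add_power2 ellZ Qv)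
    ultimately show ?thesis using v(2)[of k] v(2)[of l] by simp
  qed
  obtain Z where Z: "ell2 Z" "(\<lambda>k. norm2 (\<lambda>x. Z x - Zk k x)) \<longlonglongrightarrow> 0"
  proof (rule ell2_complete[of Zk])
    fix \<epsilon> :: real assume "\<epsilon> > 0"
    then obtain K where K: "4 / \<epsilon>\<^sup>2 < real K" using reals_Archimedean2 by blast
    have "norm2 (\<lambda>x. Zk k x - Zk l x) \<le> \<epsilon>" if "k \<ge> K" "l \<ge> K" for k l
    proof (rule power2_le_imp_le)
      have "4 < real K * \<epsilon>\<^sup>2" using K \<open>\<epsilon> > 0\<close> by (simp add: field_simps)
      then have "0 < K" by (cases K) auto
      have "2 / real (Suc k) \<le> 2 / real K" "2 / real (Suc l) \<le> 2 / real K"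
        using that \<open>0 < K\<close> by (auto intro!: divide_left_mono)
      moreover have "4 / real K \<le> \<epsilon>\<^sup>2" using \<open>4 < _\<close> \<open>0 < K\<close> by (simp add: field_simps)
      ultimately show "(norm2 (\<lambda>x. Zk k x - Zk l x))\<^sup>2 \<le> \<epsilon>\<^sup>2" using par[of k l] by simp
    qed (use \<open>\<epsilon> > 0\<close> in simp)
    then show "\<exists>K. \<forall>k\<ge>K. \<forall>l\<ge>K. norm2 (\<lambda>x. Zk k x - Zk l x) \<le> \<epsilon>" by blast
  qed (use ellZ in auto)
  have orth: "Re (cinner w Z) = 0" if w: "w \<in> V" for w
  proof -
    have lim: "(\<lambda>k. Re (cinner w (Zk k))) \<longlonglongrightarrow> Re (cinner w Z)"
      by (intro tendsto_intros cinner_tendsto_right V w Z ellZ)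
    \<comment> \<open>First-order optimality against the competitor \<open>v k + t w\<close>; the
      defect \<open>1 / Suc k\<close> of the minimising sequence disappears in the limit.\<close>
    have ineq: "2 * t * Re (cinner w Z) \<le> t\<^sup>2 * (norm2 w)\<^sup>2" for t :: real
    proof -
      have fin: "2 * t * Re (cinner w (Zk k)) - 1 / real (Suc k) \<le> t\<^sup>2 * (norm2 w)\<^sup>2" for k
      proof -
        have "(\<lambda>x. complex_of_real 1 * v k x + complex_of_real t * w x) \<in> V" by (intro comb v w)
        from d_le[OF this] have "d \<le> (norm2 (\<lambda>x. Zk k x - complex_of_real t * w x))\<^sup>2"
          by (simp add: Q_def Zk_def algebra_simps)
        also have "\<dots> = (norm2 (Zk k))\<^sup>2 - 2 * t * Re (cinner w (Zk k)) + t\<^sup>2 * (norm2 w)\<^sup>2"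
          using arg_cong[OF cnj_cinner[of w "Zk k"], of Re]
          by (simp add: norm2_diff_power2 ellZ ell2_scale V w cinner_scale_right norm2_scale power_mult_distrib)
        finally show ?thesis using v(2)[of k] Qv[of k] by simp
      qed
      have "(\<lambda>k. 2 * t * Re (cinner w (Zk k)) - 1 / real (Suc k)) \<longlonglongrightarrow> 2 * t * Re (cinner w Z) - 0"
        by (intro tendsto_diff tendsto_mult_left lim LIMSEQ_Suc[OF lim_1_over_n])
      from LIMSEQ_le_const2[OF this] fin show ?thesis by auto
    qed
    show ?thesis
    proof (cases "norm2 w = 0")
      case True
      with ineq[of 1] ineq[of "-1"] show ?thesis by simp
    next
      case False
      let ?r = "Re (cinner w Z)" and ?n = "(norm2 w)\<^sup>2"
      have n: "?n > 0" using False by simp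
      \<comment> \<open>The choice \<open>t = ?r / ?n\<close> makes the linear term twice the
        quadratic one.\<close>
      have "2 * (?r / ?n) * ?r \<le> (?r / ?n)\<^sup>2 * ?n" by (rule ineq)
      also have "\<dots> = (?r / ?n) * ?r" using False by (simp add: power2_eq_square)
      finally have "?r\<^sup>2 / ?n \<le> 0" by (simp add: power2_eq_square)
      then have "?r\<^sup>2 \<le> 0" using n by (simp only: divide_le_0_iff) auto
      then show ?thesis by simp
    qed
  qed
  show ?thesis by (rule that[of v Z]) (use v Z orth in \<open>auto simp: Zk_def\<close>)
qed

text \<open>\<open>sandwich R Z\<close> collects the closed conditions satisfied by \<open>L R\<close> for a symmetric \<open>L\<close>:
  \<open>R Z\<close> is hermitian and \<open>Z\<close> vanishes on the kernel of \<open>R\<close>.\<close>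

definition sandwich :: "('x, 'x) kernel \<Rightarrow> ('x \<times> 'x \<Rightarrow> complex) \<Rightarrow> bool" where
  "sandwich R Z \<longleftrightarrow> ell2 Z \<and>
     (\<forall>x y. cinner (\<lambda>z. R z x) (\<lambda>z. Z (z, y)) = cinner (\<lambda>z. Z (z, x)) (\<lambda>z. R z y)) \<and>
     (\<forall>f x. ell2 f \<longrightarrow> kapp R f = (\<lambda>_. 0) \<longrightarrow> cinner (\<lambda>y. cnj (Z (x, y))) f = 0)"

text \<open>If in addition \<open>Z R\<close> is anti-hermitian, then
  \<open>\<parallel>R Z\<parallel>\<^sup>2 = Tr (R Z R Z) = - \<parallel>Z R\<parallel>\<^sup>2\<close>, hence \<open>R Z = Z R = 0\<close>.\<close>

lemma sandwich_eq_0: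
  assumes R: "positive_op R" and Z: "sandwich R Z"
    and anti: "\<And>x y. cinner (\<lambda>z. cnj (Z (x, z))) (\<lambda>z. R z y)
                  + cnj (cinner (\<lambda>z. cnj (Z (y, z))) (\<lambda>z. R z x)) = 0"
  shows "Z = (\<lambda>_. 0)"
proof -
  note b = positive_op_bounded[OF R]
  have ellZ: "ell2 Z"
    and herm: "\<And>x y. cinner (\<lambda>z. R z x) (\<lambda>z. Z (z, y)) = cinner (\<lambda>z. Z (z, x)) (\<lambda>z. R z y)"
    and ker: "\<And>f x. ell2 f \<Longrightarrow> kapp R f = (\<lambda>_. 0) \<Longrightarrow> cinner (\<lambda>y. cnj (Z (x, y))) f = 0"
    using Z unfolding sandwich_def by blast+
  define A where "A = (\<lambda>(x, y). kapp R (\<lambda>z. Z (z, y)) x)"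
  define B where "B x y = cinner (\<lambda>z. cnj (Z (x, z))) (\<lambda>z. R z y)" for x y
  have ellA: "ell2 A" unfolding A_def by (rule ell2_kapp_cols[OF b ellZ])
  have ellr: "ell2 (\<lambda>z. Z (x, z))" "ell2 (\<lambda>z. cnj (Z (x, z)))" "ell2 (\<lambda>z. Z (z, x))" for x
    using ellZ by (auto intro: ell2_rows ell2_cnj)
  have ellR: "ell2 (\<lambda>z. R z x)" "ell2 (R x)" for x 
    by (auto intro: bounded_op_col[OF b] bounded_op_row[OF b])
  have Bc: "cnj (B x y) = kapp R (\<lambda>z. cnj (Z (x, z))) y" for x y
    unfolding B_def cnj_cinner kapp_eq_cinner_col[OF R] ..
  have Ba: "B x y = - cnj (B y x)" for x y
    using anti[of x y] by (simp add: B_def add_eq_0_iff2)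
  have ellB: "ell2 (\<lambda>y. cnj (B x y))" for x
    unfolding Bc by (intro bounded_op_ell2[OF b] ellr)
  have A_herm: "A (z, y) = cinner (\<lambda>w. Z (w, z)) (\<lambda>w. R w y)" for z y
    by (simp add: A_def kapp_eq_cinner_col[OF R] herm)
  \<comment> \<open>With \<open>A = R Z\<close> and \<open>B = Z R\<close>, \<open>U\<close> is
    \<open>R A\<close>. Since \<open>A\<close> is hermitian and \<open>B\<close> anti-hermitian,
    \<open>R R Z = R Z' R = - Z R R\<close>, where \<open>Z'\<close> is the adjoint of
    \<open>Z\<close>; this takes the place of cyclicity of the trace.\<close>
  define U where "U = (\<lambda>(x, y). kapp R (\<lambda>z. A (z, y)) x)"
  have ellU: "ell2 U" unfolding U_def by (rule ell2_kapp_cols[OF b ellA])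
  have U_eq: "U (x, y) = - cnj (kapp R (\<lambda>w. cnj (B x w)) y)" for x y
  proof -
    have "U (x, y) = (\<Sum>\<^sub>\<infinity>z. \<Sum>\<^sub>\<infinity>w. R x z * (cnj (Z (w, z)) * R w y))"
      unfolding U_def by (simp add: kapp_def A_herm cinner_def infsum_cmult_right')
    also have "\<dots> = (\<Sum>\<^sub>\<infinity>w. \<Sum>\<^sub>\<infinity>z. R x z * (cnj (Z (w, z)) * R w y))"
    \<comment> \<open>The summand is a product of two functions square-summable in
      \<open>(z, w)\<close>: the tensor product of a row and a column of \<open>R\<close>, and the
      adjoint of \<open>Z\<close>.\<close>
    proof (rule infsum_swap_banach)
      have "ell2 (\<lambda>(z, w). R x z * R w y)" by (rule ell2_tensor[OF ellR(2) ellR(1)])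
      moreover have "ell2 (\<lambda>(z, w). cnj (Z (w, z)))"
        using ell2_swap[OF ell2_cnj[OF ellZ]] by simp
      ultimately have "(\<lambda>p. (case p of (z, w) \<Rightarrow> R x z * R w y) * (case p of (z, w) \<Rightarrow> cnj (Z (w, z)))) summable_on UNIV"
        by (rule summable_mult)
      then show "(\<lambda>(z, w). R x z * (cnj (Z (w, z)) * R w y)) summable_on UNIV \<times> UNIV"
        by (simp add: case_prod_unfold mult_ac)
    qed
    also have "\<dots> = (\<Sum>\<^sub>\<infinity>w. kapp R (\<lambda>z. cnj (Z (w, z))) x * R w y)"
      by (simp add: kapp_def infsum_cmult_left'[symmetric] mult.assoc)
    also have "\<dots> = (\<Sum>\<^sub>\<infinity>w. - (B x w * R w y))"
      unfolding Bc[symmetric] by (simp add: Ba[of x])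
    also have "\<dots> = - (\<Sum>\<^sub>\<infinity>w. cnj (R y w * cnj (B x w)))"
      by (simp add: infsum_uminus positive_op_cnj[OF R] mult.commute)
    finally show ?thesis by (simp only: kapp_def infsum_cnj)
  qed
  have "((\<lambda>y. cinner (\<lambda>x. A (x, y)) (\<lambda>x. A (x, y))) has_sum cinner A A) UNIV"
    by (rule cinner_cols[OF ellA ellA])
  moreover have "cinner (\<lambda>x. A (x, y)) (\<lambda>x. A (x, y)) = cinner (\<lambda>x. U (x, y)) (\<lambda>x. Z (x, y))" for y
  proof -
    have "cinner (\<lambda>x. A (x, y)) (\<lambda>x. A (x, y)) = cinner (\<lambda>x. A (x, y)) (kapp R (\<lambda>x. Z (x, y)))"
      by (simp add: A_def)
    also have "\<dots> = cinner (kapp R (\<lambda>x. A (x, y))) (\<lambda>x. Z (x, y))"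
      by (rule positive_op_hermitian[OF R ell2_rows(2)[OF ellA] ellr(3)])
    finally show ?thesis by (simp add: U_def)
  qed
  ultimately have "((\<lambda>y. cinner (\<lambda>x. U (x, y)) (\<lambda>x. Z (x, y))) has_sum cinner A A) UNIV"
    by simp
  then have AU: "cinner A A = cinner U Z"
    using cinner_cols[OF ellU ellZ] by (rule has_sum_unique)
  \<comment> \<open>The pairing of \<open>U\<close> with \<open>Z\<close> is now summed by rows,
    where it equals minus a sum of squares.\<close>
  have "cinner (\<lambda>y. U (x, y)) (\<lambda>y. Z (x, y)) = - complex_of_real ((norm2 (\<lambda>y. cnj (B x y)))\<^sup>2)" for x
  proof -
    have "cinner (\<lambda>y. U (x, y)) (\<lambda>y. Z (x, y))
        = - (\<Sum>\<^sub>\<infinity>y. cnj (cnj (Z (x, y))) * kapp R (\<lambda>w. cnj (B x w)) y)"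
      by (simp add: cinner_def U_eq infsum_uminus mult.commute)
    also have "\<dots> = - cinner (\<lambda>y. cnj (Z (x, y))) (kapp R (\<lambda>w. cnj (B x w)))"
      by (simp add: cinner_def)
    also have "\<dots> = - cinner (kapp R (\<lambda>y. cnj (Z (x, y)))) (\<lambda>w. cnj (B x w))"
      by (simp only: positive_op_hermitian[OF R ellr(2) ellB])
    also have "kapp R (\<lambda>y. cnj (Z (x, y))) = (\<lambda>w. cnj (B x w))"
      by (simp add: Bc)
    also have "cinner (\<lambda>w. cnj (B x w)) (\<lambda>w. cnj (B x w)) = complex_of_real ((norm2 (\<lambda>y. cnj (B x y)))\<^sup>2)"
      by (rule cinner_self[OF ellB])
    finally show ?thesis .
  qed
  then have "((\<lambda>x. - complex_of_real ((norm2 (\<lambda>y. cnj (B x y)))\<^sup>2)) has_sum cinner U Z) UNIV"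
    using cinner_rows[OF ellU ellZ] by simp
  then have "((\<lambda>x. - (- complex_of_real ((norm2 (\<lambda>y. cnj (B x y)))\<^sup>2))) has_sum - cinner U Z) UNIV"
    by (simp only: has_sum_uminus minus_minus)
  then have "((\<lambda>x. complex_of_real ((norm2 (\<lambda>y. cnj (B x y)))\<^sup>2)) has_sum complex_of_real (- (norm2 A)\<^sup>2)) UNIV"
    using AU cinner_self[OF ellA] by simp
  then have s: "((\<lambda>x. (norm2 (\<lambda>y. cnj (B x y)))\<^sup>2) has_sum (- (norm2 A)\<^sup>2)) UNIV"
    by (simp only: has_sum_of_real_iff)
  have "(norm2 (\<lambda>y. cnj (B x y)))\<^sup>2 = 0" for x
    by (rule nonneg_has_sum_le_0D[OF s]) auto
  then have B0: "(\<lambda>y. cnj (B x y)) = (\<lambda>_. 0)" for x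
    using norm2_eq_0[OF ellB[of x]] by simp
  \<comment> \<open>Since \<open>Z R = 0\<close>, the conjugate of each row of \<open>Z\<close> lies
    in the kernel of \<open>R\<close>, so the kernel condition may pair it with itself.\<close>
  have "cinner (\<lambda>y. cnj (Z (x, y))) (\<lambda>y. cnj (Z (x, y))) = 0" for x
    by (rule ker[OF ellr(2)]) (use B0[of x] in \<open>simp add: Bc\<close>)
  then have "(\<lambda>y. cnj (Z (x, y))) = (\<lambda>_. 0)" for x
    using cinner_self[OF ellr(2)[of x]] norm2_eq_0[OF ellr(2)[of x]] by simp
  then show ?thesis by (auto simp: fun_eq_iff)
qed

text \<open>Every condition in \<open>sandwich\<close> is an equation between inner products against
  fixed vectors, and the norms of rows and columns are dominated by the Hilbert-Schmidt
  norm.\<close>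

lemma sandwich_limit:
  assumes R: "positive_op R" and V: "\<And>k. sandwich R (V k)" and Z: "ell2 Z"
    and lim: "(\<lambda>k. norm2 (\<lambda>p. Z p - V k p)) \<longlonglongrightarrow> 0"
  shows "sandwich R Z"
proof -
  have ellV: "ell2 (V k)" for k using V unfolding sandwich_def by blast
  note ellR = bounded_op_col[OF positive_op_bounded[OF R]]
  have limc: "(\<lambda>k. norm2 (\<lambda>x. Z (x, y) - V k (x, y))) \<longlonglongrightarrow> 0" for y
  proof (rule tendsto_sandwich[OF _ _ tendsto_const lim])
    have "norm2 (\<lambda>x. Z (x, y) - V k (x, y)) \<le> norm2 (\<lambda>p. Z p - V k p)" for k
    proof (rule power2_le_imp_le)
      show "(norm2 (\<lambda>x. Z (x, y) - V k (x, y)))\<^sup>2 \<le> (norm2 (\<lambda>p. Z p - V k p))\<^sup>2"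
        using finite_sum_le_has_sum[OF norm2_cols[OF ell2_diff[OF Z ellV[of k]]], of "{y}"] by simp
    qed simp
    then show "\<forall>\<^sub>F k in sequentially. norm2 (\<lambda>x. Z (x, y) - V k (x, y)) \<le> norm2 (\<lambda>p. Z p - V k p)"
      by simp
  qed simp
  have limr: "(\<lambda>k. norm2 (\<lambda>y. cnj (Z (x, y)) - cnj (V k (x, y)))) \<longlonglongrightarrow> 0" for x
  proof (rule tendsto_sandwich[OF _ _ tendsto_const lim])
    have "norm2 (\<lambda>y. cnj (Z (x, y)) - cnj (V k (x, y))) \<le> norm2 (\<lambda>p. Z p - V k p)" for k
    proof (rule power2_le_imp_le)
      have d: "ell2 (\<lambda>p. Z p - V k p)" by (rule ell2_diff[OF Z ellV])
      have "((\<lambda>x. (norm2 (\<lambda>y. Z (x, y) - V k (x, y)))\<^sup>2) has_sum (norm2 (\<lambda>p. Z p - V k p))\<^sup>2) UNIV"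
        using cinner_rows[OF d d]
        by (simp add: cinner_self ell2_rows[OF d] d has_sum_of_real_iff del: of_real_power)
      from finite_sum_le_has_sum[OF this, of "{x}"]
      show "(norm2 (\<lambda>y. cnj (Z (x, y)) - cnj (V k (x, y))))\<^sup>2 \<le> (norm2 (\<lambda>p. Z p - V k p))\<^sup>2"
        using norm2_cnj[of "\<lambda>y. Z (x, y) - V k (x, y)"] by simp
    qed simp
    then show "\<forall>\<^sub>F k in sequentially. norm2 (\<lambda>y. cnj (Z (x, y)) - cnj (V k (x, y))) \<le> norm2 (\<lambda>p. Z p - V k p)"
      by simp
  qed simp
  show ?thesis
    unfolding sandwich_def
  proof (intro conjI allI impI)
    fix x y
    have "cinner (\<lambda>z. R z x) (\<lambda>z. V k (z, y)) = cinner (\<lambda>z. V k (z, x)) (\<lambda>z. R z y)" for k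
      using V unfolding sandwich_def by blast
    moreover have "(\<lambda>k. cinner (\<lambda>z. R z x) (\<lambda>z. V k (z, y))) \<longlonglongrightarrow> cinner (\<lambda>z. R z x) (\<lambda>z. Z (z, y))"
      by (intro cinner_tendsto_right ellR ell2_rows(2) Z ellV limc)
    ultimately have "(\<lambda>k. cinner (\<lambda>z. V k (z, x)) (\<lambda>z. R z y)) \<longlonglongrightarrow> cinner (\<lambda>z. R z x) (\<lambda>z. Z (z, y))"
      by simp
    moreover have "(\<lambda>k. cinner (\<lambda>z. V k (z, x)) (\<lambda>z. R z y)) \<longlonglongrightarrow> cinner (\<lambda>z. Z (z, x)) (\<lambda>z. R z y)"
      by (intro cinner_tendsto_left ellR ell2_rows(2) Z ellV limc)
    ultimately show "cinner (\<lambda>z. R z x) (\<lambda>z. Z (z, y)) = cinner (\<lambda>z. Z (z, x)) (\<lambda>z. R z y)"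
      by (rule LIMSEQ_unique)
  next
    fix f :: "'a \<Rightarrow> complex" and x assume f: "ell2 f" "kapp R f = (\<lambda>_. 0)"
    have "(\<lambda>k. cinner (\<lambda>y. cnj (V k (x, y))) f) \<longlonglongrightarrow> cinner (\<lambda>y. cnj (Z (x, y))) f"
      by (intro cinner_tendsto_left f ell2_cnj ell2_rows(1) Z ellV limr)
    moreover have "cinner (\<lambda>y. cnj (V k (x, y))) f = 0" for k
      using V f unfolding sandwich_def by blast
    ultimately show "cinner (\<lambda>y. cnj (Z (x, y))) f = 0"
      by (simp add: LIMSEQ_const_iff)
  qed (rule Z)
qed

text \<open>The set \<open>F\<close> is carried along so that products with \<open>H\<close> are
  finite sums; it may exceed the actual support, which lets two matrices share one set.\<close>

definition fin_herm :: "'x set \<Rightarrow> ('x, 'x) kernel \<Rightarrow> bool" where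
  "fin_herm F H \<longleftrightarrow> finite F \<and> (\<forall>x y. H x y \<noteq> 0 \<longrightarrow> x \<in> F \<and> y \<in> F) \<and> (\<forall>x y. cnj (H x y) = H y x)"

lemma fin_herm_comb:
  assumes "fin_herm F H" "fin_herm F' H'"
  shows "fin_herm (F \<union> F') (\<lambda>x y. complex_of_real a * H x y + complex_of_real b * H' x y)"
proof -
  have "x \<in> F \<union> F' \<and> y \<in> F \<union> F'" if "complex_of_real a * H x y + complex_of_real b * H' x y \<noteq> 0" for x y
  proof -
    from that have "H x y \<noteq> 0 \<or> H' x y \<noteq> 0" by auto
    then show ?thesis using assms unfolding fin_herm_def by blast
  qed
  then show ?thesis using assms unfolding fin_herm_def by simp
qed

definition mult_fin :: "('x, 'x) kernel \<Rightarrow> ('x, 'x) kernel \<Rightarrow> 'x set \<Rightarrow> 'x \<times> 'x \<Rightarrow> complex" where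
  "mult_fin H R F = (\<lambda>(x, z). \<Sum>y\<in>F. H x y * R y z)"

lemma mult_fin_mono:
  assumes "fin_herm F H" "F \<subseteq> F'" "finite F'"
  shows "mult_fin H R F' = mult_fin H R F"
proof (rule ext, clarify)
  fix x z
  have "(\<Sum>y\<in>F. H x y * R y z) = (\<Sum>y\<in>F'. H x y * R y z)"
  proof (rule sum.mono_neutral_left[OF assms(3,2)], rule ballI)
    fix y assume "y \<in> F' - F"
    then have "H x y = 0" using assms(1) unfolding fin_herm_def by blast
    then show "H x y * R y z = 0" by simp
  qed
  then show "mult_fin H R F' (x, z) = mult_fin H R F (x, z)" by (simp add: mult_fin_def)
qed

lemma ell2_mult_fin:
  assumes R: "bounded_op R" and H: "fin_herm F H"
  shows "ell2 (mult_fin H R F)"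
proof -
  have "ell2 (\<lambda>p. \<Sum>y\<in>F. (case p of (x, z) \<Rightarrow> H x y * R y z))"
  proof (rule ell2_sum, rule ell2_tensor)
    fix y
    have "{x. H x y \<noteq> 0} \<subseteq> F" "finite F" using H unfolding fin_herm_def by auto
    then show "ell2 (\<lambda>x. H x y)" by (intro ell2_finite_support) (rule finite_subset)
    show "ell2 (R y)" by (rule bounded_op_row[OF R])
  qed
  then show ?thesis by (simp add: mult_fin_def case_prod_unfold)
qed

text \<open>\<open>R H R\<close> is hermitian when \<open>H\<close> is, and \<open>H R\<close> kills
  whatever \<open>R\<close> kills.\<close>

lemma sandwich_mult_fin:
  assumes R: "positive_op R" and H: "fin_herm F H"
  shows "sandwich R (mult_fin H R F)"
proof -
  note b = positive_op_bounded[OF R]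
  have F: "finite F" and Hs: "\<And>x y. H x y \<noteq> 0 \<Longrightarrow> x \<in> F \<and> y \<in> F" and Hc: "\<And>x y. cnj (H x y) = H y x"
    using H unfolding fin_herm_def by auto
  have Hcol: "{z. H z y \<noteq> 0} \<subseteq> F" for y using Hs by auto
  have ellH: "ell2 (\<lambda>z. H z y)" for y
    by (rule ell2_finite_support) (rule finite_subset[OF Hcol F])
  have Hin: "cinner f (\<lambda>z. H z y) = (\<Sum>z\<in>F. cnj (f z) * H z y)" for f y
    by (rule cinner_eqI, rule has_sum_finite_neutralI[OF F]) (use Hs in auto)
  have 1: "cinner (\<lambda>z. R z x) (\<lambda>z. mult_fin H R F (z, y)) = (\<Sum>w\<in>F. \<Sum>z\<in>F. R x z * H z w * R w y)" for x y
  proof -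
    have "cinner (\<lambda>z. R z x) (\<lambda>z. mult_fin H R F (z, y)) = cinner (\<lambda>z. R z x) (\<lambda>z. \<Sum>w\<in>F. R w y * H z w)"
      by (simp add: mult_fin_def mult.commute)
    also have "\<dots> = (\<Sum>w\<in>F. R w y * cinner (\<lambda>z. R z x) (\<lambda>z. H z w))"
      by (subst cinner_sum_right) (auto intro: bounded_op_col[OF b] ell2_scale ellH simp: cinner_scale_right)
    also have "\<dots> = (\<Sum>w\<in>F. \<Sum>z\<in>F. R x z * H z w * R w y)"
      by (simp add: Hin positive_op_cnj[OF R] sum_distrib_left mult_ac)
    finally show ?thesis .
  qed
  have 2: "cinner (\<lambda>z. mult_fin H R F (z, x)) (\<lambda>z. R z y) = (\<Sum>w\<in>F. \<Sum>z\<in>F. R x w * H w z * R z y)" for x y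
  proof -
    have "cinner (\<lambda>z. mult_fin H R F (z, x)) (\<lambda>z. R z y) = cnj (\<Sum>w\<in>F. \<Sum>z\<in>F. R y z * H z w * R w x)"
      unfolding 1[symmetric] by (rule cnj_cinner[symmetric])
    then show ?thesis by (simp add: Hc positive_op_cnj[OF R] mult_ac)
  qed
  show ?thesis
    unfolding sandwich_def
  proof (intro conjI allI impI)
    show "ell2 (mult_fin H R F)" by (rule ell2_mult_fin[OF b H])
    show "cinner (\<lambda>z. R z x) (\<lambda>z. mult_fin H R F (z, y)) = cinner (\<lambda>z. mult_fin H R F (z, x)) (\<lambda>z. R z y)" for x y
      unfolding 1 2 by (rule sum.swap)
    fix f :: "'a \<Rightarrow> complex" and x assume f: "ell2 f" "kapp R f = (\<lambda>_. 0)"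
    have "cinner (\<lambda>y. cnj (mult_fin H R F (x, y))) f = cinner (\<lambda>y. \<Sum>w\<in>F. cnj (H x w) * cnj (R w y)) f"
      by (simp add: mult_fin_def)
    also have "\<dots> = (\<Sum>w\<in>F. H x w * kapp R f w)"
      by (subst cinner_sum_left[OF f(1) ell2_scale[OF ell2_cnj[OF bounded_op_row[OF b]]]])
        (simp add: cinner_scale_left kapp_eq_cinner)
    finally show "cinner (\<lambda>y. cnj (mult_fin H R F (x, y))) f = 0" by (simp add: f)
  qed
qed

text \<open>\<open>2 Tr (\<rho>' H) - Tr (\<rho> H\<^sup>2)\<close> for \<open>H\<close> supported on \<open>F\<close>; its supremum over \<open>H\<close> is the quantum
  Fisher information.\<close>

definition qfi_objective :: "'x set \<Rightarrow> ('x, 'x) kernel \<Rightarrow> ('x, 'x) kernel \<Rightarrow> ('x, 'x) kernel \<Rightarrow> real" where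
  "qfi_objective F \<rho>' \<rho> H =
     2 * Re (\<Sum>x\<in>F. \<Sum>y\<in>F. \<rho>' x y * H y x) - Re (\<Sum>x\<in>F. \<Sum>y\<in>F. \<Sum>w\<in>F. H x y * \<rho> y w * H w x)"

text \<open>Completing the square: with \<open>\<tau> = L R\<close> as a Hilbert-Schmidt operator,
  the objective is twice the real inner product of \<open>H R\<close> with \<open>\<tau>\<close>,
  minus the squared norm of \<open>H R\<close>. Symmetry and linearity of \<open>L\<close> put
  \<open>\<tau>\<close> into \<open>sandwich\<close>.\<close>

lemma has_QFI_objective:
  assumes Q: "has_QFI \<rho> \<theta> K"
    and d: "\<And>x y. ((\<lambda>t. \<rho> t x y) has_vector_derivative \<rho>' x y) (at \<theta>)"
  obtains R \<tau> where "positive_op R" "sandwich R \<tau>" "K = (norm2 \<tau>)\<^sup>2"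
    "\<And>F H. fin_herm F H \<Longrightarrow>
       qfi_objective F \<rho>' (\<rho> \<theta>) H = K - (norm2 (\<lambda>p. \<tau> p - mult_fin H R F p))\<^sup>2"
proof -
  obtain D L R where sld: "is_SLD \<rho> \<theta> D L" and sq: "is_op_sqrt (\<rho> \<theta>) R"
    and dom: "\<And>f. ell2 f \<Longrightarrow> kapp R f \<in> D" and bd: "bounded_map (\<lambda>f. L (kapp R f))"
    and K: "((\<lambda>x. (norm2 (L (\<lambda>z. R z x)))\<^sup>2) has_sum K) UNIV"
    using Q unfolding has_QFI_def by blast
  note R = is_op_sqrt_positive[OF sq]
  note b = positive_op_bounded[OF R]
  have herm: "hermitian_on D L"
    and der: "\<And>x y. ((\<lambda>t. \<rho> t x y) has_vector_derivative
               (1 / 2) * (L (\<lambda>z. \<rho> \<theta> z y) x + cnj (L (\<lambda>z. \<rho> \<theta> z x) y))) (at \<theta>)"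
    using sld unfolding is_SLD_def by blast+
  have ellL: "\<And>f. f \<in> D \<Longrightarrow> ell2 (L f)"
    and addL: "\<And>f g. f \<in> D \<Longrightarrow> g \<in> D \<Longrightarrow> L (\<lambda>x. f x + g x) = (\<lambda>x. L f x + L g x)"
    and scaleL: "\<And>f c. f \<in> D \<Longrightarrow> L (\<lambda>x. c * f x) = (\<lambda>x. c * L f x)"
    and symL: "\<And>f g. f \<in> D \<Longrightarrow> g \<in> D \<Longrightarrow> cinner f (L g) = cinner (L f) g"
    and D0: "(\<lambda>_. 0) \<in> D"
    using herm unfolding hermitian_on_def by blast+
  have L0: "L (\<lambda>_. 0) = (\<lambda>_. 0)" using scaleL[OF D0, of 0] by simp
  define \<tau> where "\<tau> = (\<lambda>(x, y). L (\<lambda>z. R z y) x)"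
  have domR: "(\<lambda>z. R z y) \<in> D" for y using dom[of "basis y"] by (simp add: kapp_basis)
  have ell\<tau>: "ell2 \<tau>" and norm\<tau>: "(norm2 \<tau>)\<^sup>2 = K"
    by (rule ell2_colsI[where S = K]; use K in \<open>simp add: \<tau>_def ellL domR\<close>)+
  \<comment> \<open>\<open>L\<close> itself has no matrix, but \<open>L R\<close> is bounded and
    linear, hence acts through the entries of \<open>\<tau>\<close>.\<close>
  have app: "L (kapp R f) x = cinner (\<lambda>y. cnj (\<tau> (x, y))) f" if "ell2 f" for f x
  proof -
    have "((\<lambda>y. L (kapp R (basis y)) x * f y) has_sum L (kapp R f) x) UNIV"
      by (rule bounded_map_has_sum[OF bd])
        (auto simp: that kapp_add[OF b] kapp_scale addL scaleL dom)
    then show ?thesis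
      by (intro cinner_eqI[symmetric]) (simp add: \<tau>_def kapp_basis)
  qed
  have sand: "sandwich R \<tau>"
    unfolding sandwich_def
  proof (intro conjI allI impI)
    show "cinner (\<lambda>z. R z x) (\<lambda>z. \<tau> (z, y)) = cinner (\<lambda>z. \<tau> (z, x)) (\<lambda>z. R z y)" for x y
      using symL[OF domR[of x] domR[of y]] by (simp add: \<tau>_def)
    show "cinner (\<lambda>y. cnj (\<tau> (x, y))) f = 0" if "ell2 f" "kapp R f = (\<lambda>_. 0)" for f x
      using app[OF that(1), of x] that(2) L0 by simp
  qed (rule ell\<tau>)
  \<comment> \<open>\<open>X\<close> is \<open>\<tau> R\<close>, which is \<open>L\<close> applied
    to the columns of the state because the state is \<open>R R\<close>.\<close>
  define X where "X x y = cinner (\<lambda>z. cnj (\<tau> (x, z))) (\<lambda>z. R z y)" for x y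
  have X: "L (\<lambda>z. \<rho> \<theta> z y) x = X x y" for x y
    unfolding is_op_sqrt_col[OF sq] X_def by (rule app[OF bounded_op_col[OF b]])
  have \<rho>': "\<rho>' x y = (1 / 2) * (X x y + cnj (X y x))" for x y
    using vector_derivative_unique_at[OF d der] unfolding X .
  have obj: "qfi_objective F \<rho>' (\<rho> \<theta>) H = K - (norm2 (\<lambda>p. \<tau> p - mult_fin H R F p))\<^sup>2"
    if H: "fin_herm F H" for F H
  proof -
    have F: "finite F" and Hs: "\<And>x y. H x y \<noteq> 0 \<Longrightarrow> x \<in> F \<and> y \<in> F" and Hc: "\<And>x y. cnj (H x y) = H y x"
      using H unfolding fin_herm_def by auto
    let ?M = "mult_fin H R F"
    note ellM = ell2_mult_fin[OF b H]
    have M0: "?M (x, z) = 0" if "x \<notin> F" for x z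
    proof -
      have "H x y = 0" for y using Hs that by blast
      then show ?thesis by (simp add: mult_fin_def)
    qed
    have "((\<lambda>x. cinner (\<lambda>z. ?M (x, z)) (\<lambda>z. \<tau> (x, z))) has_sum cinner ?M \<tau>) UNIV"
      by (rule cinner_rows[OF ellM ell\<tau>])
    moreover have "((\<lambda>x. cinner (\<lambda>z. ?M (x, z)) (\<lambda>z. \<tau> (x, z))) has_sum
        (\<Sum>x\<in>F. cinner (\<lambda>z. ?M (x, z)) (\<lambda>z. \<tau> (x, z)))) UNIV"
      by (rule has_sum_finite_neutralI[OF F]) (simp_all add: M0)
    ultimately have "cinner ?M \<tau> = (\<Sum>x\<in>F. cinner (\<lambda>z. ?M (x, z)) (\<lambda>z. \<tau> (x, z)))"
      by (rule has_sum_unique)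
    also have "\<dots> = (\<Sum>x\<in>F. \<Sum>y\<in>F. X x y * H y x)"
    proof (rule sum.cong[OF refl])
      fix x
      have "cinner (\<lambda>z. ?M (x, z)) (\<lambda>z. \<tau> (x, z)) = (\<Sum>y\<in>F. cnj (H x y) * cinner (R y) (\<lambda>z. \<tau> (x, z)))"
        unfolding mult_fin_def prod.case
        by (subst cinner_sum_left)
          (auto intro: ell2_scale bounded_op_row[OF b] ell2_rows[OF ell\<tau>] simp: cinner_scale_left)
      also have "\<dots> = (\<Sum>y\<in>F. X x y * H y x)"
        by (intro sum.cong refl) (simp add: X_def cinner_def Hc positive_op_cnj[OF R] mult.commute)
      finally show "cinner (\<lambda>z. ?M (x, z)) (\<lambda>z. \<tau> (x, z)) = (\<Sum>y\<in>F. X x y * H y x)" .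
    qed
    finally have lin: "cinner ?M \<tau> = (\<Sum>x\<in>F. \<Sum>y\<in>F. X x y * H y x)" .
    \<comment> \<open>The two halves of the derivative contribute complex conjugate traces, so
      together they give twice the real part of one, halved.\<close>
    have "(\<Sum>x\<in>F. \<Sum>y\<in>F. cnj (X y x) * H y x) = cnj (\<Sum>x\<in>F. \<Sum>y\<in>F. X y x * H x y)"
      by (simp add: Hc)
    also have "(\<Sum>x\<in>F. \<Sum>y\<in>F. X y x * H x y) = (\<Sum>x\<in>F. \<Sum>y\<in>F. X x y * H y x)"
      by (rule sum.swap)
    finally have "2 * Re (\<Sum>x\<in>F. \<Sum>y\<in>F. \<rho>' x y * H y x) = 2 * Re (cinner ?M \<tau>)"
      unfolding lin \<rho>' by (simp add: sum.distrib ring_distribs flip: sum_divide_distrib)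
    moreover have "(norm2 ?M)\<^sup>2 = Re (\<Sum>x\<in>F. \<Sum>y\<in>F. \<Sum>w\<in>F. H x y * \<rho> \<theta> y w * H w x)"
    proof -
      have "((\<lambda>x. cinner (\<lambda>z. ?M (x, z)) (\<lambda>z. ?M (x, z))) has_sum cinner ?M ?M) UNIV"
        by (rule cinner_rows[OF ellM ellM])
      moreover have "((\<lambda>x. cinner (\<lambda>z. ?M (x, z)) (\<lambda>z. ?M (x, z))) has_sum
          (\<Sum>x\<in>F. cinner (\<lambda>z. ?M (x, z)) (\<lambda>z. ?M (x, z)))) UNIV"
        by (rule has_sum_finite_neutralI[OF F]) (simp_all add: M0)
      ultimately have "cinner ?M ?M = (\<Sum>x\<in>F. cinner (\<lambda>z. ?M (x, z)) (\<lambda>z. ?M (x, z)))"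
        by (rule has_sum_unique)
      also have "\<dots> = (\<Sum>x\<in>F. \<Sum>w\<in>F. \<Sum>y\<in>F. H x y * \<rho> \<theta> y w * H w x)"
      proof (rule sum.cong[OF refl])
        fix x
        have "cinner (\<lambda>z. ?M (x, z)) (\<lambda>z. ?M (x, z))
            = (\<Sum>w\<in>F. \<Sum>y\<in>F. cnj (H x w) * (H x y * cinner (R w) (R y)))"
          unfolding mult_fin_def prod.case
          by (simp add: cinner_sum_left cinner_sum_right ell2_sum ell2_scale bounded_op_row[OF b]
              cinner_scale_left cinner_scale_right sum_distrib_left)
        also have "\<dots> = (\<Sum>w\<in>F. \<Sum>y\<in>F. H x y * \<rho> \<theta> y w * H w x)"
        proof -
          have "cinner (R w) (R y) = \<rho> \<theta> y w" for w y
            unfolding is_op_sqrt_entry[OF sq] cinner_def by (simp add: positive_op_cnj[OF R] mult.commute)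
          then show ?thesis by (simp add: Hc mult_ac)
        qed
        finally show "cinner (\<lambda>z. ?M (x, z)) (\<lambda>z. ?M (x, z)) = (\<Sum>w\<in>F. \<Sum>y\<in>F. H x y * \<rho> \<theta> y w * H w x)" .
      qed
      also have "\<dots> = (\<Sum>x\<in>F. \<Sum>y\<in>F. \<Sum>w\<in>F. H x y * \<rho> \<theta> y w * H w x)"
        by (intro sum.cong refl sum.swap)
      finally show ?thesis using cinner_self[OF ellM] by (metis Re_complex_of_real)
    qed
    ultimately show ?thesis
      unfolding qfi_objective_def
      using norm2_diff_power2[OF ell\<tau> ellM] norm\<tau> arg_cong[OF cnj_cinner[of \<tau> ?M], of Re] by simp
  qed
  show ?thesis by (rule that[OF R sand norm\<tau>[symmetric] obj])
qed

lemma has_QFI_ge_objective: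
  assumes "has_QFI \<rho> \<theta> K"
    and "\<And>x y. ((\<lambda>t. \<rho> t x y) has_vector_derivative \<rho>' x y) (at \<theta>)"
    and "fin_herm F H"
  shows "qfi_objective F \<rho>' (\<rho> \<theta>) H \<le> K"
proof -
  obtain R \<tau> where "qfi_objective F \<rho>' (\<rho> \<theta>) H = K - (norm2 (\<lambda>p. \<tau> p - mult_fin H R F p))\<^sup>2"
    using has_QFI_objective[OF assms(1,2)] assms(3) by metis
  then show ?thesis by simp
qed

text \<open>The content is that the matrices \<open>H R\<close> come arbitrarily close to
  \<open>\<tau>\<close>. The residual \<open>Z\<close> of the best approximation stays in
  \<open>sandwich\<close>, and its orthogonality to all \<open>H R\<close> forces \<open>Z R\<close>
  to be anti-hermitian; \<open>sandwich_eq_0\<close> then leaves no residual.\<close>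

lemma has_QFI_le:
  assumes Q: "has_QFI \<rho> \<theta> K"
    and d: "\<And>x y. ((\<lambda>t. \<rho> t x y) has_vector_derivative \<rho>' x y) (at \<theta>)"
    and le: "\<And>F H. fin_herm F H \<Longrightarrow> qfi_objective F \<rho>' (\<rho> \<theta>) H \<le> B"
  shows "K \<le> B"
proof -
  obtain R \<tau> where R: "positive_op R" and sand: "sandwich R \<tau>" and K: "K = (norm2 \<tau>)\<^sup>2"
    and obj: "\<And>F H. fin_herm F H \<Longrightarrow>
       qfi_objective F \<rho>' (\<rho> \<theta>) H = K - (norm2 (\<lambda>p. \<tau> p - mult_fin H R F p))\<^sup>2"
    using has_QFI_objective[OF Q d] by metis
  note b = positive_op_bounded[OF R]
  have ell\<tau>: "ell2 \<tau>" using sand by (simp add: sandwich_def)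
  define V where "V = {mult_fin H R F |F H. fin_herm F H}"
  have V0: "(\<lambda>_. 0) \<in> V"
  proof -
    have "fin_herm {} (\<lambda>_ _. 0 :: complex)" by (simp add: fin_herm_def)
    moreover have "mult_fin (\<lambda>_ _. 0) R {} = (\<lambda>_. 0)" by (auto simp: mult_fin_def)
    ultimately show ?thesis unfolding V_def by force
  qed
  have comb: "(\<lambda>p. complex_of_real a * v p + complex_of_real c * w p) \<in> V" if v: "v \<in> V" and w: "w \<in> V" for v w a c
  proof -
    obtain F H where H: "fin_herm F H" "v = mult_fin H R F" using v unfolding V_def by blast
    obtain F' H' where H': "fin_herm F' H'" "w = mult_fin H' R F'" using w unfolding V_def by blast
    have fin: "finite (F \<union> F')" using H H' by (simp add: fin_herm_def)
    have "v = mult_fin H R (F \<union> F')" "w = mult_fin H' R (F \<union> F')"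
      unfolding H(2) H'(2) using fin
      by (simp_all add: mult_fin_mono[OF H(1), of "F \<union> F'"] mult_fin_mono[OF H'(1), of "F \<union> F'"])
    then have "(\<lambda>p. complex_of_real a * v p + complex_of_real c * w p)
        = mult_fin (\<lambda>x y. complex_of_real a * H x y + complex_of_real c * H' x y) R (F \<union> F')"
      by (auto simp: mult_fin_def sum_distrib_left sum.distrib ring_distribs mult.assoc fun_eq_iff)
    then show ?thesis unfolding V_def using fin_herm_comb[OF H(1) H'(1)] by blast
  qed
  have ellV: "ell2 v" if "v \<in> V" for v
    using that ell2_mult_fin[OF b] unfolding V_def by blast
  obtain v :: "nat \<Rightarrow> 'a \<times> 'a \<Rightarrow> complex" and Z where v: "\<And>k. v k \<in> V" and Z: "ell2 Z"
    and lim: "(\<lambda>k. norm2 (\<lambda>x. Z x - (\<tau> x - v k x))) \<longlonglongrightarrow> 0"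
    and orth: "\<And>w. w \<in> V \<Longrightarrow> Re (cinner w Z) = 0"
    by (rule ell2_approx_orthogonal[OF ell\<tau> ellV V0 comb]) (assumption | rule that)+
  have "sandwich R (\<lambda>p. \<tau> p - v k p)" for k
  proof -
    obtain F H where H: "fin_herm F H" "v k = mult_fin H R F" using v[of k] unfolding V_def by blast
    have s: "sandwich R (v k)" unfolding H(2) by (rule sandwich_mult_fin[OF R H(1)])
    have e: "ell2 (v k)" by (rule ellV[OF v])
    note c = bounded_op_col[OF b]
    show ?thesis
      using sand s unfolding sandwich_def
      by (simp add: ell2_diff ell\<tau> e cinner_diff_left cinner_diff_right c ell2_rows[OF e] ell2_rows[OF ell\<tau>]
          ell2_cnj)
  qed
  then have sZ: "sandwich R Z" by (rule sandwich_limit[OF R _ Z lim])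
  have "Z = (\<lambda>_. 0)"
  proof (rule sandwich_eq_0[OF R sZ])
    fix x y
    define W where "W x y = cinner (\<lambda>z. cnj (Z (x, z))) (\<lambda>z. R z y)" for x y
    have main: "Re (c * W x y + cnj c * W y x) = 0" for c
    proof -
      \<comment> \<open>A hermitian test matrix with entry \<open>c\<close> at \<open>(y, x)\<close>
        and its conjugate at \<open>(x, y)\<close>, written as a sum so that \<open>x = y\<close> is
        covered; \<open>c = 1\<close> and \<open>c = \<i>\<close> separate real and imaginary
        parts.\<close>
      define H where "H a b = (if a = y \<and> b = x then c else 0) + (if a = x \<and> b = y then cnj c else 0)" for a b
      have H: "fin_herm {x, y} H"
        unfolding fin_herm_def
      proof (intro conjI allI)
        show "H a b \<noteq> 0 \<longrightarrow> a \<in> {x, y} \<and> b \<in> {x, y}" for a b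
          by (cases "a = x"; cases "b = x"; cases "a = y"; cases "b = y") (simp_all add: H_def)
        show "cnj (H a b) = H b a" for a b
          by (cases "a = x"; cases "b = x"; cases "a = y"; cases "b = y") (simp_all add: H_def)
      qed simp
      have "mult_fin H R {x, y} = (\<lambda>(a, z). (if a = y then c * R x z else 0) + (if a = x then cnj c * R y z else 0))"
        by (cases "x = y") (auto simp: mult_fin_def H_def fun_eq_iff ring_distribs)
      also have "\<dots> = (\<lambda>p. c * (case p of (a, z) \<Rightarrow> basis y a * R x z) + cnj c * (case p of (a, z) \<Rightarrow> basis x a * R y z))"
        by (auto simp: basis_def fun_eq_iff)
      finally have "cinner (mult_fin H R {x, y}) Z
          = cnj c * cinner (\<lambda>(a, z). basis y a * R x z) Z + c * cinner (\<lambda>(a, z). basis x a * R y z) Z"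
        by (simp add: cinner_add_left cinner_scale_left Z ell2_scale ell2_tensor bounded_op_row[OF b])
      moreover have "cinner (\<lambda>(a, z). basis y a * R x z) Z = W y x" for x y
      proof -
        have "((\<lambda>a. cinner (\<lambda>z. basis y a * R x z) (\<lambda>z. Z (a, z))) has_sum
            cinner (\<lambda>(a, z). basis y a * R x z) Z) UNIV"
          using cinner_rows[OF ell2_tensor[OF ell2_basis bounded_op_row[OF b]] Z] by simp
        moreover have "((\<lambda>a. cinner (\<lambda>z. basis y a * R x z) (\<lambda>z. Z (a, z))) has_sum W y x) UNIV"
        proof (rule has_sum_finite_neutralI[of "{y}"])
          have "cinner (R x) (\<lambda>z. Z (y, z)) = W y x"
            unfolding W_def cinner_def by (simp add: positive_op_cnj[OF R] mult.commute)
          then show "W y x = (\<Sum>a\<in>{y}. cinner (\<lambda>z. basis y a * R x z) (\<lambda>z. Z (a, z)))"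
            by (simp add: cinner_scale_left basis_def)
        qed (auto simp: basis_def)
        ultimately show ?thesis by (rule has_sum_unique)
      qed
      ultimately have "cinner (mult_fin H R {x, y}) Z = cnj c * W y x + c * W x y"
        by (simp only:)
      moreover have "mult_fin H R {x, y} \<in> V" unfolding V_def using H by blast
      ultimately show ?thesis using orth by (metis add.commute)
    qed
    have "W x y + cnj (W y x) = 0"
      using main[of 1] main[of \<i>] by (simp add: complex_eq_iff)
    then show "cinner (\<lambda>z. cnj (Z (x, z))) (\<lambda>z. R z y) + cnj (cinner (\<lambda>z. cnj (Z (y, z))) (\<lambda>z. R z x)) = 0"
      unfolding W_def .
  qed
  with lim have lim0: "(\<lambda>k. norm2 (\<lambda>x. \<tau> x - v k x)) \<longlonglongrightarrow> 0"
    by (simp add: norm2_def norm_minus_commute)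
  have "K - (norm2 (\<lambda>x. \<tau> x - v k x))\<^sup>2 \<le> B" for k
  proof -
    obtain F H where H: "fin_herm F H" "v k = mult_fin H R F" using v[of k] unfolding V_def by blast
    show ?thesis using le[OF H(1)] unfolding obj[OF H(1)] H(2) .
  qed
  moreover have "(\<lambda>k. K - (norm2 (\<lambda>x. \<tau> x - v k x))\<^sup>2) \<longlonglongrightarrow> K - 0\<^sup>2"
    by (intro tendsto_intros lim0)
  ultimately show ?thesis using LIMSEQ_le_const2[of "\<lambda>k. K - (norm2 (\<lambda>x. \<tau> x - v k x))\<^sup>2" K B] by simp
qed

text \<open>Each value is the least upper bound of one and the same objective, because the entrywise
  derivative does not depend on the witness.\<close>

lemma has_QFI_unique:
  assumes "has_QFI \<rho> \<theta> K" "has_QFI \<rho> \<theta> K'"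
  shows "K = K'"
proof -
  obtain \<rho>' where d: "\<And>x y. ((\<lambda>t. \<rho> t x y) has_vector_derivative \<rho>' x y) (at \<theta>)"
  proof -
    obtain D L where "is_SLD \<rho> \<theta> D L" using assms(1) unfolding has_QFI_def by blast
    then show ?thesis by (intro that) (auto simp: is_SLD_def)
  qed
  show ?thesis
  proof (rule antisym)
    show "K \<le> K'" by (rule has_QFI_le[OF assms(1) d has_QFI_ge_objective[OF assms(2) d]])
    show "K' \<le> K" by (rule has_QFI_le[OF assms(2) d has_QFI_ge_objective[OF assms(1) d]])
  qed
qed

text \<open>Chain rule: \<open>c L\<close> is a symmetric logarithmic derivative on the same domain,
  with the same root. Equality of the families is asked only near \<open>\<eta>\<close>, since the
  identifications made later are proved for nonnegative \<open>\<tau>\<close> and for gains above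
  1.\<close>

lemma has_QFI_reparam:
  assumes Q: "has_QFI \<rho> \<theta> K"
    and \<phi>: "\<phi> \<eta> = \<theta>" "(\<phi> has_real_derivative c) (at \<eta>)"
    and ev: "eventually (\<lambda>t. \<sigma> t = \<rho> (\<phi> t)) (at \<eta>)" "\<sigma> \<eta> = \<rho> \<theta>"
  shows "has_QFI \<sigma> \<eta> (c\<^sup>2 * K)"
proof -
  obtain D L R where sld: "is_SLD \<rho> \<theta> D L" and sq: "is_op_sqrt (\<rho> \<theta>) R"
    and dom: "\<And>f. ell2 f \<Longrightarrow> kapp R f \<in> D" and bd: "bounded_map (\<lambda>f. L (kapp R f))"
    and K: "((\<lambda>x. (norm2 (L (\<lambda>z. R z x)))\<^sup>2) has_sum K) UNIV"
    using Q unfolding has_QFI_def by blast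
  let ?c = "complex_of_real c"
  define L' where "L' f = (\<lambda>x. ?c * L f x)" for f
  have herm: "hermitian_on D L'"
    using sld unfolding is_SLD_def hermitian_on_def L'_def
    by (auto simp: ell2_scale cinner_scale_left cinner_scale_right ring_distribs mult_ac)
  have der: "((\<lambda>t. \<sigma> t x y) has_vector_derivative
               (1 / 2) * (L' (\<lambda>z. \<sigma> \<eta> z y) x + cnj (L' (\<lambda>z. \<sigma> \<eta> z x) y))) (at \<eta>)" for x y
  proof -
    let ?d = "(1 / 2) * (L (\<lambda>z. \<rho> \<theta> z y) x + cnj (L (\<lambda>z. \<rho> \<theta> z x) y))"
    have "((\<lambda>t. \<rho> t x y) has_vector_derivative ?d) (at (\<phi> \<eta>))"
      using sld \<phi> unfolding is_SLD_def by blast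
    then have "((\<lambda>t. \<rho> t x y) \<circ> \<phi> has_vector_derivative c *\<^sub>R ?d) (at \<eta>)"
      by (intro vector_diff_chain_at) (use \<phi> in \<open>simp_all add: has_real_derivative_iff_has_vector_derivative\<close>)
    then have "((\<lambda>t. \<rho> (\<phi> t) x y) has_vector_derivative c *\<^sub>R ?d) (at \<eta>)" by (simp add: o_def)
    then have "((\<lambda>t. \<sigma> t x y) has_vector_derivative c *\<^sub>R ?d) (at \<eta>)"
      unfolding has_vector_derivative_def
      by (rule has_derivative_transform_eventually)
        (use ev \<phi> in \<open>auto elim: eventually_mono\<close>)
    moreover have "c *\<^sub>R ?d = (1 / 2) * (L' (\<lambda>z. \<sigma> \<eta> z y) x + cnj (L' (\<lambda>z. \<sigma> \<eta> z x) y))"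
      by (simp add: L'_def ev(2) scaleR_conv_of_real ring_distribs)
    ultimately show ?thesis by (simp only:)
  qed
  obtain C where C: "C \<ge> 0" "\<And>f. ell2 f \<Longrightarrow> ell2 (L (kapp R f))" "\<And>f. ell2 f \<Longrightarrow> norm2 (L (kapp R f)) \<le> C * norm2 f"
    using bounded_mapE[OF bd] by metis
  have "bounded_map (\<lambda>f. L' (kapp R f))"
    unfolding bounded_map_def
  proof (intro exI[of _ "\<bar>c\<bar> * C"] allI impI conjI)
    fix f :: "'a \<Rightarrow> complex" assume f: "ell2 f"
    show "ell2 (L' (kapp R f))" unfolding L'_def by (rule ell2_scale[OF C(2)[OF f]])
    show "norm2 (L' (kapp R f)) \<le> \<bar>c\<bar> * C * norm2 f"
      using mult_left_mono[OF C(3)[OF f], of "\<bar>c\<bar>"] by (simp add: L'_def norm2_scale mult.assoc)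
  qed
  moreover have "((\<lambda>x. (norm2 (L' (\<lambda>z. R z x)))\<^sup>2) has_sum c\<^sup>2 * K) UNIV"
    using has_sum_cmult_right[OF K, of "c\<^sup>2"] by (simp add: L'_def norm2_scale power_mult_distrib)
  moreover have "is_SLD \<sigma> \<eta> D L'"
    using sld herm der unfolding is_SLD_def ev(2) by blast
  ultimately show ?thesis
    unfolding has_QFI_def ev(2) using sq dom by blast
qed

section \<open>Locally finite orthogonal families\<close>

text \<open>Only finitely many members are non-zero at a given point, so that combinations of the members
  can be formed pointwise by finite sums.\<close>

definition ortho_family :: "('e \<Rightarrow> 'x \<Rightarrow> complex) \<Rightarrow> ('e \<Rightarrow> real) \<Rightarrow> bool" where
  "ortho_family u q \<longleftrightarrow>
     (\<forall>e. ell2 (u e) \<and> (norm2 (u e))\<^sup>2 = q e) \<and>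
     (\<forall>e e'. e \<noteq> e' \<longrightarrow> cinner (u e) (u e') = 0) \<and>
     (\<forall>x. finite {e. u e x \<noteq> 0})"

definition comb :: "('e \<Rightarrow> complex) \<Rightarrow> ('e \<Rightarrow> 'x \<Rightarrow> complex) \<Rightarrow> 'x \<Rightarrow> complex" where
  "comb a u x = (\<Sum>e | u e x \<noteq> 0. a e * u e x)"

lemma comb_eq:
  assumes "finite E" "{e. u e x \<noteq> 0 \<and> a e \<noteq> 0} \<subseteq> E" "finite {e. u e x \<noteq> 0}"
  shows "comb a u x = (\<Sum>e\<in>E. a e * u e x)"
proof -
  have "comb a u x = (\<Sum>e\<in>E \<union> {e. u e x \<noteq> 0}. a e * u e x)"
    unfolding comb_def by (rule sum.mono_neutral_left) (use assms in auto)
  also have "\<dots> = (\<Sum>e\<in>E. a e * u e x)"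
    by (rule sum.mono_neutral_right) (use assms in auto)
  finally show ?thesis .
qed

lemma ortho_family_cinner:
  "ortho_family u q \<Longrightarrow> cinner (u e) (u e') = (if e = e' then complex_of_real (q e) else 0)"
  unfolding ortho_family_def using cinner_self by metis

lemma ortho_family_nonneg: "ortho_family u q \<Longrightarrow> 0 \<le> q e"
  unfolding ortho_family_def by (metis zero_le_power2)

lemma pythagoras:
  assumes u: "ortho_family u q" and E: "finite E"
  shows "(norm2 (\<lambda>x. \<Sum>e\<in>E. a e * u e x))\<^sup>2 = (\<Sum>e\<in>E. (cmod (a e))\<^sup>2 * q e)"
proof -
  have ell: "ell2 (u e)" for e using u by (simp add: ortho_family_def)
  let ?s = "\<lambda>x. \<Sum>e\<in>E. a e * u e x"
  have "complex_of_real ((norm2 ?s)\<^sup>2) = cinner ?s ?s"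
    by (rule cinner_self[symmetric]) (intro ell2_sum ell2_scale ell)
  also have "\<dots> = (\<Sum>e\<in>E. \<Sum>e'\<in>E. cnj (a e) * (a e' * cinner (u e) (u e')))"
    by (simp add: cinner_sum_left cinner_sum_right ell2_sum ell2_scale ell cinner_scale_left cinner_scale_right
        sum_distrib_left)
  also have "\<dots> = (\<Sum>e\<in>E. cnj (a e) * a e * q e)"
    using E by (simp add: ortho_family_cinner[OF u] if_distrib sum.delta' mult.assoc cong: if_cong)
  also have "\<dots> = complex_of_real (\<Sum>e\<in>E. (cmod (a e))\<^sup>2 * q e)"
    by (simp add: complex_norm_square mult.commute del: of_real_power)
  finally show ?thesis by (simp only: of_real_eq_iff)
qed

text \<open>On finitely many points only finitely many members are non-zero, so partial sums of
  squares reduce to \<open>pythagoras\<close>.\<close>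

lemma ell2_comb:
  assumes u: "ortho_family u q" and le: "\<And>E. finite E \<Longrightarrow> (\<Sum>e\<in>E. (cmod (a e))\<^sup>2 * q e) \<le> S"
  shows "ell2 (comb a u)" "(norm2 (comb a u))\<^sup>2 \<le> S"
proof -
  have ell: "ell2 (u e)" for e using u by (simp add: ortho_family_def)
  have fin: "finite {e. u e x \<noteq> 0}" for x using u by (simp add: ortho_family_def)
  have "(\<Sum>x\<in>F. (cmod (comb a u x))\<^sup>2) \<le> S" if F: "finite F" for F
  proof -
    define E where "E = (\<Union>x\<in>F. {e. u e x \<noteq> 0})"
    have E: "finite E" unfolding E_def using F fin by auto
    have "comb a u x = (\<Sum>e\<in>E. a e * u e x)" if "x \<in> F" for x
      by (rule comb_eq[OF E _ fin]) (use that in \<open>auto simp: E_def\<close>)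
    then have "(\<Sum>x\<in>F. (cmod (comb a u x))\<^sup>2) = (\<Sum>x\<in>F. (cmod (\<Sum>e\<in>E. a e * u e x))\<^sup>2)"
      by simp
    also have "\<dots> \<le> (norm2 (\<lambda>x. \<Sum>e\<in>E. a e * u e x))\<^sup>2"
      by (rule sum_le_norm2[OF _ F]) (intro ell2_sum ell2_scale ell)
    also have "\<dots> \<le> S" unfolding pythagoras[OF u E] by (rule le[OF E])
    finally show ?thesis .
  qed
  from ell2I[OF this] show "ell2 (comb a u)" "(norm2 (comb a u))\<^sup>2 \<le> S" by auto
qed

text \<open>\<open>comb\<close> is defined pointwise; the proof shows that it is also the norm limit
  of its finite partial sums. The error is again a combination, with the coefficients in
  \<open>E\<close> set to 0.\<close>

lemma cinner_comb_has_sum: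
  assumes u: "ortho_family u q" and s: "(\<lambda>e. (cmod (a e))\<^sup>2 * q e) summable_on UNIV" and g: "ell2 g"
  shows "((\<lambda>e. a e * cinner g (u e)) has_sum cinner g (comb a u)) UNIV"
proof -
  have ell: "ell2 (u e)" for e using u by (simp add: ortho_family_def)
  have fin: "finite {e. u e x \<noteq> 0}" for x using u by (simp add: ortho_family_def)
  note q = ortho_family_nonneg[OF u]
  let ?S = "\<Sum>\<^sub>\<infinity>e. (cmod (a e))\<^sup>2 * q e"
  have le: "(\<Sum>e\<in>E. (cmod (a e))\<^sup>2 * q e) \<le> ?S" if "finite E" for E
    by (rule finite_sum_le_infsum[OF s that]) (auto simp: q)
  note ellc = ell2_comb(1)[OF u le]
  have tail: "(norm2 (\<lambda>x. comb a u x - (\<Sum>e\<in>E. a e * u e x)))\<^sup>2 \<le> ?S - (\<Sum>e\<in>E. (cmod (a e))\<^sup>2 * q e)"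
    if E: "finite E" for E
  proof -
    let ?a = "\<lambda>e. if e \<in> E then 0 else a e"
    have "comb a u x - (\<Sum>e\<in>E. a e * u e x) = comb ?a u x" for x
    proof -
      let ?E = "E \<union> {e. u e x \<noteq> 0}"
      have "comb a u x = (\<Sum>e\<in>?E. a e * u e x)" "comb ?a u x = (\<Sum>e\<in>?E. ?a e * u e x)"
        by (rule comb_eq; use E fin in auto)+
      moreover have "(\<Sum>e\<in>?E. ?a e * u e x) = (\<Sum>e\<in>?E - E. a e * u e x)"
        by (rule sum.mono_neutral_cong_right) (use E fin in auto)
      ultimately show ?thesis
        using sum_diff[of ?E E "\<lambda>e. a e * u e x"] E fin[of x] by simp
    qed
    moreover have "(norm2 (comb ?a u))\<^sup>2 \<le> ?S - (\<Sum>e\<in>E. (cmod (a e))\<^sup>2 * q e)"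
    proof (rule ell2_comb(2)[OF u])
      fix E' :: "'a set" assume E': "finite E'"
      have "(\<Sum>e\<in>E'. (cmod (?a e))\<^sup>2 * q e) = (\<Sum>e\<in>E' - E. (cmod (a e))\<^sup>2 * q e)"
        by (rule sum.mono_neutral_cong_right) (use E' in auto)
      moreover have "(\<Sum>e\<in>E' - E. (cmod (a e))\<^sup>2 * q e) + (\<Sum>e\<in>E. (cmod (a e))\<^sup>2 * q e)
          = (\<Sum>e\<in>(E' - E) \<union> E. (cmod (a e))\<^sup>2 * q e)"
        by (rule sum.union_disjoint[symmetric]) (use E E' in auto)
      ultimately show "(\<Sum>e\<in>E'. (cmod (?a e))\<^sup>2 * q e) \<le> ?S - (\<Sum>e\<in>E. (cmod (a e))\<^sup>2 * q e)"
        using le[of "(E' - E) \<union> E"] E E' by simp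
    qed
    ultimately show ?thesis by simp
  qed
  have "((\<lambda>E. norm2 (\<lambda>x. comb a u x - (\<Sum>e\<in>E. a e * u e x))) \<longlongrightarrow> 0) (finite_subsets_at_top UNIV)"
  proof (rule tendsto_sandwich[OF _ _ tendsto_const])
    have "((\<lambda>E. sqrt (?S - (\<Sum>e\<in>E. (cmod (a e))\<^sup>2 * q e))) \<longlongrightarrow> sqrt (?S - ?S)) (finite_subsets_at_top UNIV)"
      using has_sum_infsum[OF s] unfolding has_sum_def by (intro tendsto_intros)
    then show "((\<lambda>E. sqrt (?S - (\<Sum>e\<in>E. (cmod (a e))\<^sup>2 * q e))) \<longlongrightarrow> 0) (finite_subsets_at_top UNIV)"
      by simp
    show "\<forall>\<^sub>F E in finite_subsets_at_top UNIV. norm2 (\<lambda>x. comb a u x - (\<Sum>e\<in>E. a e * u e x))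
        \<le> sqrt (?S - (\<Sum>e\<in>E. (cmod (a e))\<^sup>2 * q e))"
      by (rule eventually_finite_subsets_at_top_weakI) (auto intro!: real_le_rsqrt tail)
  qed auto
  then have "((\<lambda>E. cinner g (\<lambda>x. \<Sum>e\<in>E. a e * u e x)) \<longlongrightarrow> cinner g (comb a u)) (finite_subsets_at_top UNIV)"
    by (intro cinner_tendsto_right g ellc ell2_sum ell2_scale ell)
  moreover have "cinner g (\<lambda>x. \<Sum>e\<in>E. a e * u e x) = (\<Sum>e\<in>E. a e * cinner g (u e))" for E
    by (simp add: cinner_sum_right g ell2_scale ell cinner_scale_right)
  ultimately show ?thesis unfolding has_sum_def by simp
qed

text \<open>The members are not normalised, whence the division by \<open>q e\<close>; the
  inequality is nonnegativity of the squared distance from \<open>f\<close> to its projection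
  \<open>?g\<close>.\<close>

lemma bessel:
  assumes u: "ortho_family u q" and q: "\<And>e. 0 < q e" and f: "ell2 f" and E: "finite E"
  shows "(\<Sum>e\<in>E. (cmod (cinner (u e) f))\<^sup>2 / q e) \<le> (norm2 f)\<^sup>2"
proof -
  have ell: "ell2 (u e)" for e using u by (simp add: ortho_family_def)
  let ?a = "\<lambda>e. cinner (u e) f / q e" and ?S = "\<Sum>e\<in>E. (cmod (cinner (u e) f))\<^sup>2 / q e"
  let ?g = "\<lambda>x. \<Sum>e\<in>E. ?a e * u e x"
  have g: "ell2 ?g" by (intro ell2_sum ell2_scale ell)
  have "(norm2 ?g)\<^sup>2 = ?S"
    unfolding pythagoras[OF u E]
    by (rule sum.cong[OF refl]) (use q in \<open>simp add: norm_divide power_divide power2_eq_square less_imp_neq[symmetric]\<close>)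
  moreover have "cinner f ?g = complex_of_real ?S"
  proof -
    have "cinner f ?g = (\<Sum>e\<in>E. ?a e * cnj (cinner (u e) f))"
      by (simp only: cinner_sum_right[OF f ell2_scale[OF ell]] cinner_scale_right cnj_cinner)
    also have "\<dots> = complex_of_real ?S"
      by (simp add: complex_norm_square[symmetric] mult.commute del: of_real_power)
    finally show ?thesis .
  qed
  ultimately show ?thesis
    using norm2_diff_power2[OF f g] zero_le_power2[of "norm2 (\<lambda>x. f x - ?g x)"] by simp
qed

text \<open>The operator with weights \<open>b e\<close> on the rank-one maps from
  \<open>v e\<close> to \<open>u e\<close>. As members are not normalised,
  \<open>gkern b u u\<close> has eigenvalue \<open>b e * q e\<close> at \<open>u e\<close>, and
  squaring turns weights \<open>d\<close> into \<open>d * d * q\<close>; this explains the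
  coefficients in all square roots below.\<close>

definition gkern :: "('e \<Rightarrow> real) \<Rightarrow> ('e \<Rightarrow> 'x \<Rightarrow> complex) \<Rightarrow> ('e \<Rightarrow> 'y \<Rightarrow> complex) \<Rightarrow> ('x, 'y) kernel" where
  "gkern b u v x y = (\<Sum>e | u e x \<noteq> 0. b e * u e x * cnj (v e y))"

lemma gkern_eq_cols:
  assumes "finite {e. u e x \<noteq> 0}" "finite {e. v e y \<noteq> 0}"
  shows "gkern b u v x y = (\<Sum>e | v e y \<noteq> 0. b e * cnj (v e y) * u e x)"
proof -
  have "gkern b u v x y = (\<Sum>e\<in>{e. u e x \<noteq> 0} \<union> {e. v e y \<noteq> 0}. b e * u e x * cnj (v e y))"
    unfolding gkern_def by (rule sum.mono_neutral_left) (use assms in auto)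
  also have "\<dots> = (\<Sum>e | v e y \<noteq> 0. b e * u e x * cnj (v e y))"
    by (rule sum.mono_neutral_right) (use assms in auto)
  finally show ?thesis by (simp add: mult_ac)
qed

lemma ell2_gkern_row: "(\<And>e. ell2 (v e)) \<Longrightarrow> ell2 (gkern b u v x)"
  unfolding gkern_def by (intro ell2_sum ell2_scale ell2_cnj)

lemma kapp_gkern:
  assumes v: "\<And>e. ell2 (v e)" and f: "ell2 f"
  shows "kapp (gkern b u v) f = comb (\<lambda>e. b e * cinner (v e) f) u"
proof
  fix x
  have "kapp (gkern b u v) f x = cinner (\<lambda>y. \<Sum>e | u e x \<noteq> 0. cnj (b e * u e x) * v e y) f"
    by (simp add: kapp_eq_cinner gkern_def)
  also have "\<dots> = (\<Sum>e | u e x \<noteq> 0. b e * u e x * cinner (v e) f)"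
    by (simp add: cinner_sum_left[OF f ell2_scale[OF v]] cinner_scale_left)
  finally show "kapp (gkern b u v) f x = comb (\<lambda>e. b e * cinner (v e) f) u x"
    by (simp add: comb_def mult_ac)
qed

text \<open>Biorthogonality collapses the double sum to its diagonal. Several families are allowed
  because the fidelity multiplies operators built from the branches at \<open>\<tau>\<close> and at
  \<open>\<tau>'\<close>.\<close>

lemma kmult_gkern:
  assumes u: "\<And>x. finite {e. u e x \<noteq> 0}" and v: "\<And>e. ell2 (v e)"
    and w: "\<And>e. ell2 (w e)" "\<And>x. finite {e. w e x \<noteq> 0}" and z: "\<And>x. finite {e. z e x \<noteq> 0}"
    and s: "\<And>e e'. cinner (v e) (w e') = (if e = e' then complex_of_real (s e) else 0)"
  shows "kmult (gkern b u v) (gkern d w z) = gkern (\<lambda>e. b e * d e * s e) u z"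
proof (intro ext)
  fix x y
  have col: "(\<lambda>t. gkern d w z t y) = (\<lambda>t. \<Sum>e | z e y \<noteq> 0. d e * cnj (z e y) * w e t)"
    by (rule ext) (rule gkern_eq_cols[OF w(2) z])
  have "cinner (v e) (\<lambda>t. gkern d w z t y) = d e * s e * cnj (z e y)" for e
  proof -
    have "cinner (v e) (\<lambda>t. gkern d w z t y) = (\<Sum>e' | z e' y \<noteq> 0. d e' * cnj (z e' y) * cinner (v e) (w e'))"
      unfolding col by (simp add: cinner_sum_right[OF v ell2_scale[OF w(1)]] cinner_scale_right)
    also have "\<dots> = (\<Sum>e' | z e' y \<noteq> 0. if e = e' then d e * cnj (z e y) * s e else 0)"
      by (rule sum.cong) (auto simp: s)
    also have "\<dots> = d e * s e * cnj (z e y)"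
      using z[of y] by (simp add: sum.delta)
    finally show ?thesis .
  qed
  moreover have "ell2 (\<lambda>t. gkern d w z t y)"
    unfolding col by (intro ell2_sum ell2_scale w)
  ultimately show "kmult (gkern b u v) (gkern d w z) x y = gkern (\<lambda>e. b e * d e * s e) u z x y"
    unfolding kmult_eq_kapp by (subst kapp_gkern[OF v]) (auto simp: comb_def gkern_def mult_ac intro!: sum.cong)
qed

text \<open>\<open>C\<close> bounds the eigenvalues \<open>b e * q e\<close>, so the norm bound is
  Bessel's inequality; the quadratic form is a sum of the terms \<open>b e\<close> times a squared
  modulus.\<close>

lemma positive_op_gkern:
  assumes u: "ortho_family u q" and q: "\<And>e. 0 < q e"
    and b: "\<And>e. 0 \<le> b e" "\<And>e. b e * q e \<le> C"
  shows "positive_op (gkern b u u)"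
proof -
  have ell: "ell2 (u e)" for e using u by (simp add: ortho_family_def)
  have C: "0 \<le> C" using mult_nonneg_nonneg[OF b(1) less_imp_le[OF q]] b(2) order_trans by blast
  define a where "a f e = b e * cinner (u e) f" for f e
  have kapp: "kapp (gkern b u u) f = comb (a f) u" if "ell2 f" for f
    unfolding kapp_gkern[OF ell that] a_def ..
  have bound: "(\<Sum>e\<in>E. (cmod (a f e))\<^sup>2 * q e) \<le> C\<^sup>2 * (norm2 f)\<^sup>2" if f: "ell2 f" and E: "finite E" for f E
  proof -
    have "(\<Sum>e\<in>E. (cmod (a f e))\<^sup>2 * q e) = (\<Sum>e\<in>E. (b e * q e)\<^sup>2 * ((cmod (cinner (u e) f))\<^sup>2 / q e))"
      by (rule sum.cong[OF refl])
        (use q in \<open>simp add: a_def norm_mult power_mult_distrib power2_eq_square less_imp_neq[symmetric]\<close>)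
    also have "\<dots> \<le> (\<Sum>e\<in>E. C\<^sup>2 * ((cmod (cinner (u e) f))\<^sup>2 / q e))"
      by (intro sum_mono mult_right_mono power_mono b)
        (auto simp: b less_imp_le[OF q] intro!: divide_nonneg_nonneg mult_nonneg_nonneg)
    also have "\<dots> = C\<^sup>2 * (\<Sum>e\<in>E. (cmod (cinner (u e) f))\<^sup>2 / q e)" by (simp add: sum_distrib_left)
    also have "\<dots> \<le> C\<^sup>2 * (norm2 f)\<^sup>2" by (intro mult_left_mono bessel[OF u q f E]) simp
    finally show ?thesis .
  qed
  have "bounded_map (kapp (gkern b u u))"
    unfolding bounded_map_def
  proof (intro exI[of _ C] allI impI conjI)
    fix f :: "'b \<Rightarrow> complex" assume f: "ell2 f"
    show "ell2 (kapp (gkern b u u) f)"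
      unfolding kapp[OF f] by (rule ell2_comb(1)[OF u bound[OF f]])
    have "(norm2 (kapp (gkern b u u) f))\<^sup>2 \<le> (C * norm2 f)\<^sup>2"
      unfolding kapp[OF f] power_mult_distrib by (rule ell2_comb(2)[OF u bound[OF f]])
    then show "norm2 (kapp (gkern b u u) f) \<le> C * norm2 f"
      by (rule power2_le_imp_le) (simp add: C)
  qed
  then have bd: "bounded_op (gkern b u u)"
    unfolding bounded_op_def using ell2_gkern_row[of u b u, OF ell] by blast
  have "cinner f (kapp (gkern b u u) f) \<in> \<real>\<^sub>\<ge>\<^sub>0" if f: "ell2 f" for f
  proof -
    have "(\<lambda>e. (cmod (a f e))\<^sup>2 * q e) summable_on UNIV"
      by (rule nonneg_bdd_above_summable_on)
        (auto simp: less_imp_le[OF q] intro!: bdd_aboveI[where M = "C\<^sup>2 * (norm2 f)\<^sup>2"] bound[OF f])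
    from cinner_comb_has_sum[OF u this f]
    have "((\<lambda>e. a f e * cinner f (u e)) has_sum cinner f (kapp (gkern b u u) f)) UNIV"
      by (simp add: kapp[OF f])
    moreover have "a f e * cinner f (u e) = complex_of_real (b e * (cmod (cinner (u e) f))\<^sup>2)" for e
      unfolding a_def cnj_cinner[of "u e" f, symmetric] by (simp add: complex_norm_square del: of_real_power)
    ultimately have s: "((\<lambda>e. complex_of_real (b e * (cmod (cinner (u e) f))\<^sup>2)) has_sum cinner f (kapp (gkern b u u) f)) UNIV"
      by simp
    have "0 \<le> Re (cinner f (kapp (gkern b u u) f))"
      by (rule has_sum_nonneg[OF has_sum_Re[OF s]]) (simp add: b)
    moreover have "Im (cinner f (kapp (gkern b u u) f)) = 0"
      using has_sum_Im[OF s] by (simp add: has_sum_0 has_sum_unique)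
    ultimately show ?thesis by (simp add: complex_nonneg_Reals_iff)
  qed
  with bd show ?thesis by (simp add: positive_op_def)
qed

lemma is_op_sqrt_gkern:
  assumes u: "ortho_family u q" and q: "\<And>e. 0 < q e"
    and d: "\<And>e. 0 \<le> d e" "\<And>e. d e * q e \<le> C"
  shows "is_op_sqrt (gkern (\<lambda>e. d e * d e * q e) u u) (gkern d u u)"
proof -
  have "kmult (gkern d u u) (gkern d u u) = gkern (\<lambda>e. d e * d e * q e) u u"
    by (rule kmult_gkern) (use u ortho_family_cinner[OF u] in \<open>auto simp: ortho_family_def\<close>)
  with positive_op_gkern[OF u q d] show ?thesis by (simp add: is_op_sqrt_def)
qed

text \<open>A positive square root \<open>B\<close> acts on the eigenvector \<open>u e\<close> as a scalar, since
  \<open>(B + \<mu>) (B - \<mu>) (u e) = 0\<close> and \<open>B + \<mu>\<close> is injective.  So the range of \<open>B - gkern d u u\<close> is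
  orthogonal to all \<open>u e\<close>, hence in the kernel of both square roots.\<close>

lemma op_sqrt_gkern:
  assumes u: "ortho_family u q" and q: "\<And>e. 0 < q e"
    and d: "\<And>e. 0 \<le> d e" "\<And>e. d e * q e \<le> C"
  shows "op_sqrt (gkern (\<lambda>e. d e * d e * q e) u u) = gkern d u u"
proof -
  let ?A = "gkern (\<lambda>e. d e * d e * q e) u u" and ?C = "gkern d u u"
  note C = is_op_sqrt_gkern[OF u q d]
  note Cp = is_op_sqrt_positive[OF C]
  have ell: "ell2 (u e)" for e using u by (simp add: ortho_family_def)
  have fin: "finite {e. u e x \<noteq> 0}" for x using u by (simp add: ortho_family_def)
  have eig: "kapp (gkern b u u) (u e) = (\<lambda>x. (b e * q e) * u e x)" for b e
  proof
    fix x
    have "comb (\<lambda>e'. b e' * cinner (u e') (u e)) u x = (\<Sum>e'\<in>{e}. b e' * cinner (u e') (u e) * u e' x)"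
      by (rule comb_eq[OF _ _ fin]) (auto simp: ortho_family_cinner[OF u] split: if_splits)
    then show "kapp (gkern b u u) (u e) x = (b e * q e) * u e x"
      by (simp add: kapp_gkern[OF ell ell] ortho_family_cinner[OF u])
  qed
  have "B = ?C" if B: "is_op_sqrt ?A B" for B
  proof -
    note Bp = is_op_sqrt_positive[OF B]
    note Bb = positive_op_bounded[OF Bp] and Cb = positive_op_bounded[OF Cp]
    have Beig: "kapp B (u e) = (\<lambda>x. (d e * q e) * u e x)" if "d e \<noteq> 0" for e
    proof -
      define \<mu> where "\<mu> = d e * q e"
      have \<mu>: "\<mu> > 0" using that d(1)[of e] q[of e] by (simp add: \<mu>_def)
      define g where "g = (\<lambda>x. kapp B (u e) x - \<mu> * u e x)"
      have Bu: "ell2 (kapp B (u e))" by (rule bounded_op_ell2[OF Bb ell])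
      have g: "ell2 g" unfolding g_def by (intro ell2_diff ell2_scale ell Bu)
      have "kapp B (kapp B (u e)) = (\<lambda>x. (\<mu> * \<mu>) * u e x)"
        unfolding kapp_is_op_sqrt[OF B ell, symmetric] eig by (simp add: \<mu>_def mult_ac)
      then have "kapp B g = (\<lambda>x. - \<mu> * g x)"
        unfolding g_def
        by (subst kapp_diff[OF Bb Bu ell2_scale[OF ell]]) (simp add: kapp_scale fun_eq_iff algebra_simps)
      then have "cinner g (kapp B g) = - \<mu> * (norm2 g)\<^sup>2"
        by (simp only: cinner_scale_right cinner_self[OF g]) simp
      then have "- (\<mu> * (norm2 g)\<^sup>2) \<ge> 0"
        using positive_op_cinner[OF Bp g] by (simp add: complex_nonneg_Reals_iff)
      then have "\<mu> * (norm2 g)\<^sup>2 = 0" using \<mu> by (smt (verit) mult_nonneg_nonneg zero_le_power2)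
      then have "g = (\<lambda>_. 0)" using \<mu> norm2_eq_0[OF g] by simp
      then show ?thesis by (auto simp: g_def fun_eq_iff \<mu>_def)
    qed
    have "B x y = ?C x y" for x y
    proof -
      define h where "h = (\<lambda>x. B x y - ?C x y)"
      have h_eq: "h = (\<lambda>x. kapp B (basis y) x - kapp ?C (basis y) x)" by (simp add: h_def kapp_basis)
      have ellB: "ell2 (kapp B (basis y))" and ellC: "ell2 (kapp ?C (basis y))"
        by (rule bounded_op_ell2[OF Bb ell2_basis], rule bounded_op_ell2[OF Cb ell2_basis])
      have h: "ell2 h" unfolding h_eq by (rule ell2_diff[OF ellB ellC])
      have "cinner (u e) h = 0" if "d e \<noteq> 0" for e
        unfolding h_eq cinner_diff_right[OF ell ellB ellC] positive_op_hermitian[OF Bp ell ell2_basis]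
          positive_op_hermitian[OF Cp ell ell2_basis] Beig[OF that] eig by simp
      \<comment> \<open>Members with \<open>d e = 0\<close> are not controlled by
        \<open>Beig\<close>, but their weight in \<open>?A\<close> is 0, so \<open>h\<close> is
        still in the kernel of \<open>?A\<close>.\<close>
      then have "complex_of_real (d e * d e * q e) * cinner (u e) h = 0" for e
        by auto
      then have Ah: "kapp ?A h = (\<lambda>_. 0)"
        unfolding kapp_gkern[OF ell h] comb_def by (simp only: mult_zero_left sum.neutral_const)
      \<comment> \<open>Every root \<open>D\<close> kills the kernel of \<open>?A\<close>, since the
        squared norm of \<open>D h\<close> is the quadratic form of \<open>?A\<close> at
        \<open>h\<close>.\<close>
      have kz: "kapp D h = (\<lambda>_. 0)" if D: "is_op_sqrt ?A D" for D
      proof -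
        note Dp = is_op_sqrt_positive[OF D]
        have Dh: "ell2 (kapp D h)" by (rule bounded_op_ell2[OF positive_op_bounded[OF Dp] h])
        have "cinner (kapp D h) (kapp D h) = cinner h (kapp ?A h)"
          unfolding kapp_is_op_sqrt[OF D h] by (rule positive_op_hermitian[OF Dp h Dh, symmetric])
        then show ?thesis using cinner_self[OF Dh] norm2_eq_0[OF Dh] by (simp add: Ah)
      qed
      \<comment> \<open>\<open>h\<close> is itself the difference of the two roots applied to a
        basis vector; moving the roots onto the other copy of \<open>h\<close> gives 0.\<close>
      have "cinner h h = cinner h (kapp B (basis y)) - cinner h (kapp ?C (basis y))"
        unfolding h_eq by (rule cinner_diff_right[OF h[unfolded h_eq] ellB ellC])
      also have "\<dots> = 0"
        unfolding positive_op_hermitian[OF Bp h ell2_basis] positive_op_hermitian[OF Cp h ell2_basis]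
          kz[OF B] kz[OF C] by simp
      finally have "h = (\<lambda>_. 0)" using cinner_self[OF h] norm2_eq_0[OF h] by simp
      then show ?thesis by (simp add: h_def fun_eq_iff)
    qed
    then show ?thesis by blast
  qed
  then show ?thesis
    unfolding op_sqrt_def by (rule the_equality[where P = "is_op_sqrt ?A", OF C])
qed

text \<open>Tonelli: it lets traces and averages over inputs be evaluated in whichever order of
  summation is explicit.\<close>

lemma has_sum_prod_swap_nonneg:
  fixes f :: "'x \<Rightarrow> 'e \<Rightarrow> real"
  assumes nn: "\<And>x e. 0 \<le> f x e"
    and rows: "\<And>e. ((\<lambda>x. f x e) has_sum g e) UNIV" and g: "(g has_sum S) UNIV"
    and cols: "\<And>x. ((\<lambda>e. f x e) has_sum h x) UNIV"
  shows "(h has_sum S) UNIV"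
proof -
  have s: "(\<lambda>(e, x). f x e) summable_on UNIV \<times> UNIV"
    by (rule summable_on_SigmaI[where g = g]) (use rows nn g in \<open>auto intro: has_sum_imp_summable\<close>)
  have "((\<lambda>(e, x). f x e) has_sum S) (UNIV \<times> UNIV)"
    by (rule has_sum_SigmaI[where g = g]) (use rows g s in auto)
  from has_sum_prod_cols[OF this[unfolded UNIV_Times_UNIV], of h] cols show ?thesis by simp
qed

text \<open>Summing over basis states first turns each member into its squared norm
  \<open>q e\<close>.\<close>

lemma trace_op_gkern:
  assumes u: "ortho_family u q" and d: "\<And>e. 0 \<le> d e" and s: "((\<lambda>e. d e * q e) has_sum S) UNIV"
  shows "trace_op (gkern d u u) = complex_of_real S"
proof -
  have ell: "ell2 (u e)" and nrm: "(norm2 (u e))\<^sup>2 = q e" for e using u by (simp_all add: ortho_family_def)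
  have fin: "finite {e. u e x \<noteq> 0}" for x using u by (simp add: ortho_family_def)
  let ?h = "\<lambda>x. \<Sum>e | u e x \<noteq> 0. d e * (cmod (u e x))\<^sup>2"
  have "(?h has_sum S) UNIV"
  proof (rule has_sum_prod_swap_nonneg[OF _ _ s])
    show "((\<lambda>x. d e * (cmod (u e x))\<^sup>2) has_sum d e * q e) UNIV" for e
      using has_sum_cmult_right[OF norm2_power2_has_sum[OF ell[of e]], of "d e"] by (simp add: nrm)
    show "((\<lambda>e. d e * (cmod (u e x))\<^sup>2) has_sum ?h x) UNIV" for x
      by (rule has_sum_finite_neutralI[OF fin]) auto
  qed (simp add: d)
  then have "((\<lambda>x. complex_of_real (?h x)) has_sum complex_of_real S) UNIV"
    by (rule has_sum_of_real)
  moreover have "gkern d u u x x = complex_of_real (?h x)" for x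
    by (simp add: gkern_def complex_norm_square mult.assoc del: of_real_power)
  ultimately show ?thesis unfolding trace_op_def by (simp add: infsumI)
qed

section \<open>Negative binomial sums\<close>

text \<open>Newton's binomial series with exponent \<open>- (n + 1)\<close>; the signs of the
  generalised binomial coefficient cancel those of \<open>(- x) ^ e\<close>.\<close>

lemma negbin_sums:
  fixes x :: real
  assumes "\<bar>x\<bar> < 1"
  shows "(\<lambda>e. real ((n + e) choose e) * x ^ e) sums (1 / (1 - x)) ^ (n + 1)"
proof -
  have "(\<lambda>e. ((- real (n + 1)) gchoose e) * (- x) ^ e) sums (1 + - x) powr (- real (n + 1))"
    by (rule gen_binomial_real) (use assms in simp)
  moreover have "((- real (n + 1)) gchoose e) * (- x) ^ e = real ((n + e) choose e) * x ^ e" for e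
  proof -
    have "((- real (n + 1)) gchoose e) = (- 1) ^ e * real ((n + e) choose e)"
      using gbinomial_minus[of "real (n + 1)" e] by (simp add: binomial_gbinomial add_ac)
    then show ?thesis by (simp add: power_mult_distrib[symmetric] mult_ac)
  qed
  moreover have "(1 + - x) powr (- real (n + 1)) = (1 / (1 - x)) ^ (n + 1)"
  proof -
    have "0 < 1 - x" using assms by simp
    then show ?thesis
      by (simp only: powr_minus powr_realpow add_uminus_conv_diff) (simp add: power_one_over inverse_eq_divide)
  qed
  ultimately show ?thesis by (simp only:)
qed

definition negbin_weight :: "('m::finite \<Rightarrow> nat) \<Rightarrow> ('m \<Rightarrow> nat) \<Rightarrow> real" where
  "negbin_weight n e = (\<Prod>i\<in>UNIV. real ((n i + e i) choose e i))"

lemma negbin_weight_pos: "0 < negbin_weight n e"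
  unfolding negbin_weight_def by (intro prod_pos) simp

text \<open>A product of one-mode series: mode \<open>i\<close> contributes the exponent
  \<open>n i + 1\<close>, and these add up to the total number plus the number of modes.\<close>

lemma negbin_has_sum:
  fixes n :: "'m::finite \<Rightarrow> nat"
  assumes x: "\<bar>x\<bar> < 1"
  shows "((\<lambda>e. negbin_weight n e * x ^ total_number e) has_sum
           (1 / (1 - x)) ^ (total_number n + CARD('m))) UNIV"
proof -
  let ?f = "\<lambda>i e. real ((n i + e) choose e) * x ^ e"
  have abs: "(\<lambda>e. norm (?f i e)) summable_on UNIV" for i
  proof -
    have "(\<lambda>e. real ((n i + e) choose e) * \<bar>x\<bar> ^ e) sums (1 / (1 - \<bar>x\<bar>)) ^ (n i + 1)"
      by (rule negbin_sums) (use x in simp)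
    then have "((\<lambda>e. real ((n i + e) choose e) * \<bar>x\<bar> ^ e) has_sum (1 / (1 - \<bar>x\<bar>)) ^ (n i + 1)) UNIV"
      by (rule sums_nonneg_imp_has_sum) simp
    then show ?thesis by (auto simp: abs_mult power_abs dest: has_sum_imp_summable)
  qed
  have single: "infsum (?f i) UNIV = (1 / (1 - x)) ^ (n i + 1)" for i
  proof -
    have "(?f i has_sum infsum (?f i) UNIV) UNIV"
      using abs_summable_summable[OF abs] by simp
    from has_sum_imp_sums[OF this] negbin_sums[OF x, of "n i"] show ?thesis
      by (rule sums_unique2)
  qed
  have "infsum (\<lambda>e. \<Prod>i\<in>UNIV. ?f i (e i)) (PiE UNIV (\<lambda>_. UNIV)) = (\<Prod>i\<in>UNIV. infsum (?f i) UNIV)"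
    by (rule infsum_prod_PiE_abs) (use abs in auto)
  moreover have "(\<Prod>i\<in>UNIV. infsum (?f i) UNIV) = (1 / (1 - x)) ^ (total_number n + CARD('m))"
    unfolding single total_number_def
    by (simp only: prod.distrib power_add power_sum prod_constant power_one_right)
  moreover have "(\<Prod>i\<in>UNIV. ?f i (e i)) = negbin_weight n e * x ^ total_number e" for e
    by (simp add: negbin_weight_def total_number_def prod.distrib power_sum)
  ultimately have inf: "infsum (\<lambda>e. negbin_weight n e * x ^ total_number e) UNIV
      = (1 / (1 - x)) ^ (total_number n + CARD('m))"
    by simp
  \<comment> \<open>\<open>infsum\<close> defaults to 0 when the sum does not exist, so a non-zero
    value certifies summability.\<close>
  moreover have "(1 / (1 - x)) ^ (total_number n + CARD('m)) \<noteq> 0" using x by simp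
  ultimately have "(\<lambda>e. negbin_weight n e * x ^ total_number e) summable_on UNIV"
    using infsum_not_exists by metis
  then show ?thesis using inf by (simp add: has_sum_iff)
qed

lemma finite_total_number: "finite {k :: 'm::finite \<Rightarrow> nat. total_number k = j}"
proof (rule finite_subset)
  show "{k :: 'm \<Rightarrow> nat. total_number k = j} \<subseteq> PiE UNIV (\<lambda>_. {..j})"
    unfolding total_number_def by (auto intro!: member_le_sum)
qed (intro finite_PiE; simp)

lemma bij_betw_total_number:
  "bij_betw snd (Sigma UNIV (\<lambda>j. {k :: 'm::finite \<Rightarrow> nat. total_number k = j})) UNIV"
  by (rule bij_betwI[where g = "\<lambda>k. (total_number k, k)"]) auto

lemma has_sum_total_number:
  fixes f :: "('m::finite \<Rightarrow> nat) \<Rightarrow> real"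
  assumes "(f has_sum S) UNIV"
  shows "(\<lambda>j. \<Sum>k | total_number k = j. f k) sums S"
proof (rule has_sum_imp_sums)
  have "((\<lambda>p. f (snd p)) has_sum S) (Sigma UNIV (\<lambda>j. {k. total_number k = j}))"
    using has_sum_reindex_bij_betw[OF bij_betw_total_number, of f S] assms by simp
  then show "((\<lambda>j. \<Sum>k | total_number k = j. f k) has_sum S) UNIV"
    by (rule has_sum_SigmaD) (simp add: finite_total_number)
qed

lemma has_sum_total_numberI:
  fixes f :: "('m::finite \<Rightarrow> nat) \<Rightarrow> real"
  assumes nn: "\<And>k. 0 \<le> f k" and s: "(\<lambda>j. \<Sum>k | total_number k = j. f k) sums S"
  shows "(f has_sum S) UNIV"
proof -
  let ?g = "\<lambda>j. \<Sum>k | total_number k = j. f k"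
  have g: "(?g has_sum S) UNIV"
    by (rule sums_nonneg_imp_has_sum[OF s]) (simp add: nn sum_nonneg)
  have rows: "((\<lambda>k. f (snd (j, k))) has_sum ?g j) {k. total_number k = j}" for j
    by (simp add: finite_total_number)
  have "(\<lambda>p. f (snd p)) summable_on (Sigma UNIV (\<lambda>j. {k. total_number k = j}))"
    by (rule summable_on_SigmaI[OF rows has_sum_imp_summable[OF g]]) (simp add: nn)
  from has_sum_SigmaI[OF rows g this]
  have "((\<lambda>p. f (snd p)) has_sum S) (Sigma UNIV (\<lambda>j. {k. total_number k = j}))" .
  then show ?thesis using has_sum_reindex_bij_betw[OF bij_betw_total_number, of f S] by simp
qed

text \<open>Unnormalised second central moment of a negative binomial law with mean
  \<open>r * x / (1 - x)\<close>. Grouping by total number gives a power series in one variable,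
  whose factorial moments come from differentiating the closed form twice.\<close>

lemma negbin_variance:
  fixes n :: "'m::finite \<Rightarrow> nat"
  assumes x: "0 \<le> x" "x < 1"
  defines "r \<equiv> total_number n + CARD('m)"
  shows "((\<lambda>e. (real (total_number e) - r * x / (1 - x))\<^sup>2 * (negbin_weight n e * x ^ total_number e)) has_sum
           (1 / (1 - x)) ^ r * (r * x / (1 - x)\<^sup>2)) UNIV"
proof (rule has_sum_total_numberI)
  define W where "W j = (\<Sum>e | total_number e = j. negbin_weight n e)" for j
  have grp: "(\<Sum>e | total_number e = j. h (total_number e) * (negbin_weight n e * z ^ total_number e)) = h j * (W j * z ^ j)"
    for h :: "nat \<Rightarrow> real" and z j
    by (simp add: W_def sum_distrib_left sum_distrib_right)
  have F0: "(\<lambda>j. W j * z ^ j) sums (1 / (1 - z)) ^ r" if "norm z < 1" for z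
    using has_sum_total_number[OF negbin_has_sum[of z n]] grp[of "\<lambda>_. 1" z] that by (simp add: r_def)
  have der: "((\<lambda>z. (1 / (1 - z)) ^ s) has_field_derivative s * (1 / (1 - z)) ^ (s + 1)) (at z)"
    if "norm z < 1" for z :: real and s
  proof (cases s)
    case (Suc s')
    have "((\<lambda>z. 1 / (1 - z)) has_field_derivative (1 / (1 - z))\<^sup>2) (at z)"
      by (rule derivative_eq_intros refl)+ (use that in \<open>auto simp: power2_eq_square\<close>)
    from DERIV_power_Suc[OF this, of s'] show ?thesis
      unfolding Suc by (simp add: power2_eq_square mult_ac)
  qed simp
  have F1: "(\<lambda>j. diffs W j * z ^ j) sums (r * (1 / (1 - z)) ^ (r + 1))" if "norm z < 1" for z
    by (rule termdiffs_sums_strong[OF F0 der]) (use that in auto)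
  have F2: "(\<lambda>j. diffs (diffs W) j * x ^ j) sums (r * ((r + 1) * (1 / (1 - x)) ^ (r + 1 + 1)))"
  proof (rule termdiffs_sums_strong[OF F1])
    show "((\<lambda>z. r * (1 / (1 - z)) ^ (r + 1)) has_field_derivative r * ((r + 1) * (1 / (1 - x)) ^ (r + 1 + 1))) (at x)"
      using DERIV_cmult[OF der[of x "r + 1"], of "real r"] x by simp
  qed (use x in auto)
  have x1: "norm x < 1" using x by simp
  let ?g = "1 / (1 - x)"
  \<comment> \<open>The factor \<open>j\<close>, and below \<open>j * (j - 1)\<close>, vanishes at
    the indices that differentiation drops, so shifting the index back adds only zeros.\<close>
  have "(\<lambda>j. real (Suc j) * (W (Suc j) * x ^ Suc j)) sums (x * (r * ?g ^ (r + 1)))"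
    using sums_mult[OF F1[OF x1], of x] by (simp add: diffs_def mult_ac)
  then have M1: "(\<lambda>j. real j * (W j * x ^ j)) sums (x * (r * ?g ^ (r + 1)))"
    by (subst (asm) sums_Suc_iff) simp
  have "(\<lambda>j. (real (Suc (Suc j)) * (real (Suc (Suc j)) - 1)) * (W (Suc (Suc j)) * x ^ Suc (Suc j))) sums
      (x * (x * (r * ((r + 1) * ?g ^ (r + 1 + 1)))))"
    using sums_mult[OF sums_mult[OF F2, of x], of x] by (simp add: diffs_def algebra_simps)
  then have M2: "(\<lambda>j. (real j * (real j - 1)) * (W j * x ^ j)) sums
      (x * (x * (r * ((r + 1) * ?g ^ (r + 1 + 1)))))"
    by (subst (asm) sums_Suc_iff, subst (asm) sums_Suc_iff) simp
  let ?\<mu> = "r * x / (1 - x)"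
  \<comment> \<open>The combination comes from
    \<open>(j - \<mu>)^2 = j (j - 1) + (1 - 2 \<mu>) j + \<mu>^2\<close>.\<close>
  have "(\<lambda>j. (real j * (real j - 1)) * (W j * x ^ j) + (1 - 2 * ?\<mu>) * (real j * (W j * x ^ j)) + ?\<mu>\<^sup>2 * (W j * x ^ j))
     sums (x * (x * (r * ((r + 1) * ?g ^ (r + 1 + 1)))) + (1 - 2 * ?\<mu>) * (x * (r * ?g ^ (r + 1))) + ?\<mu>\<^sup>2 * ?g ^ r)"
    by (intro sums_add sums_mult M1 M2 F0[OF x1])
  moreover have "(real j * (real j - 1)) * (W j * x ^ j) + (1 - 2 * ?\<mu>) * (real j * (W j * x ^ j)) + ?\<mu>\<^sup>2 * (W j * x ^ j)
      = (real j - ?\<mu>)\<^sup>2 * (W j * x ^ j)" for j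
    unfolding power2_diff by (simp add: algebra_simps power2_eq_square)
  moreover have "x * (x * (r * ((r + 1) * ?g ^ (r + 1 + 1)))) + (1 - 2 * ?\<mu>) * (x * (r * ?g ^ (r + 1))) + ?\<mu>\<^sup>2 * ?g ^ r
      = ?g ^ r * (r * x / (1 - x)\<^sup>2)"
  proof -
    have ne: "1 - x \<noteq> 0" using x by simp
    have mu: "?\<mu> = r * x * ?g" by simp
    \<comment> \<open>A polynomial identity in an arbitrary \<open>g\<close>. The relation
      \<open>x * g = g - 1\<close> of the actual value enters afterwards and turns
      \<open>x * g + 1\<close> into \<open>g\<close>.\<close>
    have id: "x * (x * (r * ((r + 1) * g ^ (r + 1 + 1)))) + (1 - 2 * (r * x * g)) * (x * (r * g ^ (r + 1))) + (r * x * g)\<^sup>2 * g ^ r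
        = g ^ r * (r * (x * g) * (x * g + 1))" for g :: real
      by (simp add: algebra_simps power2_eq_square)
    have xg: "x * ?g = ?g - 1" using ne by (simp add: field_simps)
    have "x * (x * (r * ((r + 1) * ?g ^ (r + 1 + 1)))) + (1 - 2 * ?\<mu>) * (x * (r * ?g ^ (r + 1))) + ?\<mu>\<^sup>2 * ?g ^ r
        = ?g ^ r * (r * (x * ?g) * (x * ?g + 1))"
      unfolding mu by (rule id)
    also have "\<dots> = ?g ^ r * (r * (x * ?g) * ?g)" by (simp only: xg) simp
    also have "\<dots> = ?g ^ r * (r * x / (1 - x)\<^sup>2)" by (simp add: power2_eq_square)
    finally show ?thesis .
  qed
  ultimately have "(\<lambda>j. (real j - ?\<mu>)\<^sup>2 * (W j * x ^ j)) sums (?g ^ r * (r * x / (1 - x)\<^sup>2))"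
    by (simp only:)
  then show "(\<lambda>j. \<Sum>e | total_number e = j. (real (total_number e) - ?\<mu>)\<^sup>2 * (negbin_weight n e * x ^ total_number e))
      sums (?g ^ r * (r * x / (1 - x)\<^sup>2))"
    using grp[of "\<lambda>j. (real j - ?\<mu>)\<^sup>2" x] by simp
  show "0 \<le> (real (total_number e) - ?\<mu>)\<^sup>2 * (negbin_weight n e * x ^ total_number e)" for e
    using negbin_weight_pos[of n e] x by simp
qed

section \<open>The amplifier in coordinates\<close>

text \<open>The amplitude from input \<open>n\<close> to output \<open>n + e\<close> with
  environment number \<open>e\<close>, that is the product of \<open>squeeze_coeff\<close> over the
  modes.\<close>

definition amp :: "real \<Rightarrow> ('m::finite \<Rightarrow> nat) \<Rightarrow> ('m \<Rightarrow> nat) \<Rightarrow> real" where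
  "amp \<tau> n e = sech \<tau> ^ (total_number n + CARD('m)) * tanh \<tau> ^ total_number e * sqrt (negbin_weight n e)"

lemma amp_pos: "0 < \<tau> \<Longrightarrow> 0 < amp \<tau> n e"
  by (simp add: amp_def sech_def negbin_weight_pos)

lemma prod_squeeze_coeff:
  "(\<Prod>i\<in>UNIV. squeeze_coeff \<tau> (n i) (k i) (e i)) = (if k = (\<lambda>i. n i + e i) then amp \<tau> n e else 0)"
    for n :: "'m::finite \<Rightarrow> nat"
proof (cases "k = (\<lambda>i. n i + e i)")
  case True
  have "sqrt (negbin_weight n e) = (\<Prod>i\<in>UNIV. sqrt (real ((n i + e i) choose e i)))"
    unfolding negbin_weight_def by (induction rule: finite_induct[OF finite[of UNIV]]) (simp_all add: real_sqrt_mult)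
  with True show ?thesis
    by (simp add: squeeze_coeff_def amp_def prod.distrib total_number_def power_sum power_add mult_ac)
next
  case False
  then obtain i where "k i \<noteq> n i + e i" by auto
  then have "squeeze_coeff \<tau> (n i) (k i) (e i) = 0" by (simp add: squeeze_coeff_def)
  with False show ?thesis by (auto intro!: prod_zero)
qed

text \<open>Amplitude with which \<open>e\<close> environment photons accompany the output number state \<open>k\<close>.\<close>

definition kraus :: "real \<Rightarrow> ('m::finite \<Rightarrow> nat) \<Rightarrow> ('m \<Rightarrow> nat) \<Rightarrow> real" where
  "kraus \<tau> e k = (if e \<le> k then amp \<tau> (\<lambda>i. k i - e i) e else 0)"

lemma finite_below: "finite {e :: 'm::finite \<Rightarrow> nat. e \<le> k}"
proof (rule finite_subset)
  show "{e :: 'm \<Rightarrow> nat. e \<le> k} \<subseteq> PiE UNIV (\<lambda>i. {..k i})" by (auto simp: le_fun_def)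
qed (intro finite_PiE; simp)

text \<open>A row \<open>((a, k), e)\<close> of the dilation has at most one non-zero entry, the one
  with signal number \<open>k - e\<close>. Truncated subtraction does no harm since
  \<open>kraus\<close> is 0 unless \<open>e \<le> k\<close>.\<close>

lemma dilation_sum:
  "(\<Sum>\<^sub>\<infinity>p. dilation \<tau> ((a, k), e) p * g p) = complex_of_real (kraus \<tau> e k) * g (a, \<lambda>i. k i - e i)"
proof (rule infsumI, rule has_sum_finite_neutralI[where B = "{(a, \<lambda>i. k i - e i)}"])
  fix p :: "'a \<times> ('b \<Rightarrow> nat)"
  assume p: "p \<in> UNIV - {(a, \<lambda>i. k i - e i)}"
  obtain b n where [simp]: "p = (b, n)" by (cases p)
  have "\<not> (a = b \<and> k = (\<lambda>i. n i + e i))" using p by auto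
  then show "dilation \<tau> ((a, k), e) p * g p = 0"
    by (auto simp: dilation_def prod_squeeze_coeff)
next
  have "(k = (\<lambda>i. k i - e i + e i)) = (e \<le> k)" by (auto simp: fun_eq_iff le_fun_def) (metis le_add2)
  then show "complex_of_real (kraus \<tau> e k) * g (a, \<lambda>i. k i - e i) = (\<Sum>p\<in>{(a, \<lambda>i. k i - e i)}. dilation \<tau> ((a, k), e) p * g p)"
    by (simp add: dilation_def prod_squeeze_coeff kraus_def)
qed auto

text \<open>The partial trace over the environment as a finite sum, and free of
  \<open>arcosh\<close>: the form that gets differentiated in \<open>\<tau>\<close>.\<close>

definition amp_out :: "real \<Rightarrow> ('a \<times> ('m::finite \<Rightarrow> nat), 'a \<times> ('m \<Rightarrow> nat)) kernel
     \<Rightarrow> ('a \<times> ('m \<Rightarrow> nat), 'a \<times> ('m \<Rightarrow> nat)) kernel" where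
  "amp_out \<tau> \<rho> = (\<lambda>(a, k) (b, l). \<Sum>e | e \<le> k.
      complex_of_real (kraus \<tau> e k * kraus \<tau> e l) * \<rho> (a, \<lambda>i. k i - e i) (b, \<lambda>i. l i - e i))"

lemma amplifier_eq_amp_out:
  assumes "0 \<le> \<tau>"
  shows "amplifier ((cosh \<tau>)\<^sup>2) \<rho> = amp_out \<tau> \<rho>"
proof (intro ext, clarify)
  fix a k b l
  have \<tau>: "arcosh (sqrt ((cosh \<tau>)\<^sup>2)) = \<tau>" using assms by (simp add: arcosh_cosh_real cosh_real_nonneg)
  have 1: "kmult (dilation \<tau>) \<rho> ((a, k), e) y = kraus \<tau> e k * \<rho> (a, \<lambda>i. k i - e i) y" for a e y and k :: "'b \<Rightarrow> nat"
    unfolding kmult_def by (rule dilation_sum[where g = "\<lambda>p. \<rho> p y"])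
  have 2: "kmult (kmult (dilation \<tau>) \<rho>) (kadj (dilation \<tau>)) ((a, k), e) ((b, l), e)
      = kraus \<tau> e k * kraus \<tau> e l * \<rho> (a, \<lambda>i. k i - e i) (b, \<lambda>i. l i - e i)" for e
  proof -
    have "kmult (kmult (dilation \<tau>) \<rho>) (kadj (dilation \<tau>)) ((a, k), e) ((b, l), e)
        = cnj (\<Sum>\<^sub>\<infinity>p. dilation \<tau> ((b, l), e) p * cnj (kraus \<tau> e k * \<rho> (a, \<lambda>i. k i - e i) p))"
      unfolding kmult_def[of "kmult _ _"] kadj_def 1 infsum_cnj[symmetric] by (simp add: mult_ac)
    then show ?thesis unfolding dilation_sum by simp
  qed
  have "amplifier ((cosh \<tau>)\<^sup>2) \<rho> (a, k) (b, l)
      = (\<Sum>\<^sub>\<infinity>e. kraus \<tau> e k * kraus \<tau> e l * \<rho> (a, \<lambda>i. k i - e i) (b, \<lambda>i. l i - e i))"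
    unfolding amplifier_def Let_def \<tau> ptrace_def 2 ..
  also have "\<dots> = amp_out \<tau> \<rho> (a, k) (b, l)"
    unfolding amp_out_def prod.case
    by (rule infsumI, rule has_sum_finite_neutralI[OF finite_below[of k]]) (auto simp: kraus_def)
  finally show "amplifier ((cosh \<tau>)\<^sup>2) \<rho> (a, k) (b, l) = amp_out \<tau> \<rho> (a, k) (b, l)" .
qed

text \<open>Negative binomial series at \<open>tanh \<tau> * tanh \<tau>'\<close>. The addition
  theorem gives \<open>1 - tanh \<tau> * tanh \<tau>' = cosh (\<tau>' - \<tau>) / (cosh \<tau> *
  cosh \<tau>')\<close>, and the prefactors \<open>sech\<close> cancel the denominator.\<close>

lemma amp_overlap_has_sum:
  fixes n :: "'m::finite \<Rightarrow> nat"
  assumes "0 < \<tau>" "0 < \<tau>'"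
  shows "((\<lambda>e. amp \<tau> n e * amp \<tau>' n e) has_sum sech (\<tau>' - \<tau>) ^ (total_number n + CARD('m))) UNIV"
proof -
  let ?x = "tanh \<tau> * tanh \<tau>'" and ?r = "total_number n + CARD('m)"
  have c: "cosh \<tau> > 0" "cosh \<tau>' > 0" by (simp_all add: cosh_real_pos)
  have d: "1 - ?x = cosh (\<tau>' - \<tau>) / (cosh \<tau> * cosh \<tau>')"
    using c by (simp add: tanh_def cosh_diff field_simps)
  then have "1 - ?x > 0" using c by (simp add: cosh_real_pos)
  moreover have "?x > 0" using assms by simp
  ultimately have x: "\<bar>?x\<bar> < 1" by simp
  have "((\<lambda>e. (sech \<tau> * sech \<tau>') ^ ?r * (negbin_weight n e * ?x ^ total_number e)) has_sum
      (sech \<tau> * sech \<tau>') ^ ?r * (1 / (1 - ?x)) ^ ?r) UNIV"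
    by (intro has_sum_cmult_right negbin_has_sum x)
  moreover have "(sech \<tau> * sech \<tau>') ^ ?r * (1 / (1 - ?x)) ^ ?r = sech (\<tau>' - \<tau>) ^ ?r"
    unfolding power_mult_distrib[symmetric] d using c by (simp add: sech_def)
  moreover have "(sech \<tau> * sech \<tau>') ^ ?r * (negbin_weight n e * ?x ^ total_number e) = amp \<tau> n e * amp \<tau>' n e" for e
    using less_imp_le[OF negbin_weight_pos[of n e]] by (simp add: amp_def power_mult_distrib)
  ultimately show ?thesis by simp
qed

lemma amp_norm_has_sum:
  fixes n :: "'m::finite \<Rightarrow> nat"
  assumes "0 < \<tau>"
  shows "((\<lambda>e. (amp \<tau> n e)\<^sup>2) has_sum 1) UNIV"
  using amp_overlap_has_sum[OF assms assms, of n] by (simp add: power2_eq_square sech_def)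

text \<open>Derivative of the logarithm of \<open>amp\<close>. The subtracted term is the mean
  environment photon number for input \<open>n\<close>, so this is a centred variable up to
  scaling.\<close>

definition amp_log_deriv :: "real \<Rightarrow> ('m::finite \<Rightarrow> nat) \<Rightarrow> ('m \<Rightarrow> nat) \<Rightarrow> real" where
  "amp_log_deriv \<tau> n e =
     (real (total_number e) - real (total_number n + CARD('m)) * (sinh \<tau>)\<^sup>2) / (sinh \<tau> * cosh \<tau>)"

lemma one_minus_tanh_squared: "1 - (tanh x)\<^sup>2 = 1 / (cosh x)\<^sup>2" for x :: real
proof -
  have "cosh x \<noteq> 0" using cosh_real_pos[of x] by simp
  then have "1 - (tanh x)\<^sup>2 = ((cosh x)\<^sup>2 - (sinh x)\<^sup>2) / (cosh x)\<^sup>2"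
    by (simp only: tanh_def power_divide diff_divide_distrib) simp
  then show ?thesis by (simp only: hyperbolic_pythagoras)
qed

lemma amp_has_derivative:
  assumes \<tau>: "0 < \<tau>"
  shows "((\<lambda>t. amp t n e) has_real_derivative amp_log_deriv \<tau> n e * amp \<tau> n e) (at \<tau>)"
proof -
  have s: "sinh \<tau> > 0" and c: "cosh \<tau> > 0" using \<tau> by (simp_all add: cosh_real_pos)
  \<comment> \<open>Derivatives are kept in the form \<open>l * f\<close>, so that logarithmic
    derivatives scale with powers and add over products.\<close>
  have pow: "((\<lambda>t. f t ^ r) has_real_derivative (real r * l) * f \<tau> ^ r) (at \<tau>)"
    if "(f has_real_derivative l * f \<tau>) (at \<tau>)" for f :: "real \<Rightarrow> real" and r l
  proof (cases r)
    case (Suc r')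
    show ?thesis unfolding Suc by (rule derivative_eq_intros that refl)+ (simp add: algebra_simps)
  qed simp
  have 1: "(sech has_real_derivative (- (sinh \<tau> / cosh \<tau>)) * sech \<tau>) (at \<tau>)"
    unfolding sech_def[abs_def] using c by (auto intro!: derivative_eq_intros simp: field_simps)
  have 2: "(tanh has_real_derivative (1 / (sinh \<tau> * cosh \<tau>)) * tanh \<tau>) (at \<tau>)"
  proof -
    have "1 - (tanh \<tau>)\<^sup>2 = (1 / (sinh \<tau> * cosh \<tau>)) * tanh \<tau>"
      unfolding one_minus_tanh_squared using s c by (simp add: tanh_def power2_eq_square)
    then show ?thesis using c by (auto intro!: derivative_eq_intros)
  qed
  let ?r = "total_number n + CARD('a)" and ?j = "total_number e"
  have "((\<lambda>t. sech t ^ ?r * tanh t ^ ?j * sqrt (negbin_weight n e)) has_real_derivative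
      ((real ?r * (- (sinh \<tau> / cosh \<tau>))) * sech \<tau> ^ ?r * tanh \<tau> ^ ?j
        + (real ?j * (1 / (sinh \<tau> * cosh \<tau>))) * tanh \<tau> ^ ?j * sech \<tau> ^ ?r) * sqrt (negbin_weight n e)) (at \<tau>)"
    by (rule DERIV_cmult_right[OF DERIV_mult[OF pow[OF 1] pow[OF 2], simplified add.commute]]) 
  moreover have "((real ?r * (- (sinh \<tau> / cosh \<tau>))) * sech \<tau> ^ ?r * tanh \<tau> ^ ?j
        + (real ?j * (1 / (sinh \<tau> * cosh \<tau>))) * tanh \<tau> ^ ?j * sech \<tau> ^ ?r) * sqrt (negbin_weight n e)
      = amp_log_deriv \<tau> n e * amp \<tau> n e"
  proof -
    have l: "amp_log_deriv \<tau> n e = real ?j * (1 / (sinh \<tau> * cosh \<tau>)) - real ?r * (sinh \<tau> / cosh \<tau>)"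
      unfolding amp_log_deriv_def using s c by (simp add: field_simps power2_eq_square)
    show ?thesis unfolding l amp_def by (simp only: algebra_simps minus_mult_left minus_mult_right)
  qed
  ultimately show ?thesis unfolding amp_def by (simp only:)
qed

text \<open>The environment number is negative binomial with parameter
  \<open>(tanh \<tau>)^2\<close> and variance \<open>r * (sinh \<tau> * cosh \<tau>)^2\<close>; the
  squared denominator of \<open>amp_log_deriv\<close> reduces this to \<open>r\<close>.\<close>

lemma amp_log_deriv_has_sum:
  fixes n :: "'m::finite \<Rightarrow> nat"
  assumes \<tau>: "0 < \<tau>"
  shows "((\<lambda>e. (amp_log_deriv \<tau> n e)\<^sup>2 * (amp \<tau> n e)\<^sup>2) has_sum real (total_number n + CARD('m))) UNIV"
proof -
  have s: "sinh \<tau> > 0" and c: "cosh \<tau> > 0" using \<tau> by (simp_all add: cosh_real_pos)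
  let ?x = "(tanh \<tau>)\<^sup>2" and ?r = "total_number n + CARD('m)"
  note x1 = one_minus_tanh_squared[of \<tau>]
  have x: "0 \<le> ?x" "?x < 1"
  proof -
    have "0 < 1 - ?x" unfolding x1 using c by simp
    then show "?x < 1" by simp
  qed simp
  have mu: "?r * ?x / (1 - ?x) = ?r * (sinh \<tau>)\<^sup>2"
    unfolding x1 using c by (simp add: tanh_def power_divide)
  have v: "?r * ?x / (1 - ?x)\<^sup>2 = ?r * (sinh \<tau> * cosh \<tau>)\<^sup>2"
    unfolding x1 using c by (simp add: tanh_def power_divide power2_eq_square)
  have g: "1 / (1 - ?x) = (cosh \<tau>)\<^sup>2" unfolding x1 by simp
  let ?C = "((sech \<tau>)\<^sup>2) ^ ?r / (sinh \<tau> * cosh \<tau>)\<^sup>2"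
  have "((\<lambda>e. ?C * ((real (total_number e) - ?r * (sinh \<tau>)\<^sup>2)\<^sup>2 * (negbin_weight n e * ?x ^ total_number e))) has_sum
      ?C * (((cosh \<tau>)\<^sup>2) ^ ?r * (?r * (sinh \<tau> * cosh \<tau>)\<^sup>2))) UNIV"
    using has_sum_cmult_right[OF negbin_variance[OF x, of n], of ?C] unfolding mu v g .
  moreover have "?C * (((cosh \<tau>)\<^sup>2) ^ ?r * (?r * (sinh \<tau> * cosh \<tau>)\<^sup>2)) = real ?r"
  proof -
    have "((sech \<tau>)\<^sup>2) ^ ?r * ((cosh \<tau>)\<^sup>2) ^ ?r = 1"
      unfolding power_mult_distrib[symmetric] using c by (simp add: sech_def)
    moreover have "(sinh \<tau> * cosh \<tau>)\<^sup>2 \<noteq> 0" using s c by simp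
    ultimately show ?thesis by (simp add: field_simps)
  qed
  moreover have "?C * ((real (total_number e) - ?r * (sinh \<tau>)\<^sup>2)\<^sup>2 * (negbin_weight n e * ?x ^ total_number e))
      = (amp_log_deriv \<tau> n e)\<^sup>2 * (amp \<tau> n e)\<^sup>2" for e
  proof -
    have "(amp \<tau> n e)\<^sup>2 = ((sech \<tau>)\<^sup>2) ^ ?r * (?x ^ total_number e) * negbin_weight n e"
      using less_imp_le[OF negbin_weight_pos[of n e]]
      by (simp add: amp_def power_mult_distrib power_mult[symmetric] mult.commute)
    then show ?thesis by (simp add: amp_log_deriv_def power_divide mult_ac)
  qed
  ultimately show ?thesis by simp
qed

lemma kraus_has_derivative:
  assumes "0 < \<tau>"
  shows "((\<lambda>t. kraus t e k) has_real_derivative amp_log_deriv \<tau> (\<lambda>i. k i - e i) e * kraus \<tau> e k) (at \<tau>)"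
  using amp_has_derivative[OF assms, of "\<lambda>i. k i - e i" e]
  by (cases "e \<le> k") (simp_all add: kraus_def)

lemma amp_out_has_derivative:
  assumes "0 < \<tau>"
  shows "((\<lambda>t. amp_out t \<rho> (a, k) (b, l)) has_vector_derivative
      (\<Sum>e | e \<le> k.
         complex_of_real ((amp_log_deriv \<tau> (\<lambda>i. k i - e i) e + amp_log_deriv \<tau> (\<lambda>i. l i - e i) e)
           * (kraus \<tau> e k * kraus \<tau> e l)) * \<rho> (a, \<lambda>i. k i - e i) (b, \<lambda>i. l i - e i))) (at \<tau>)"
proof -
  have "((\<lambda>t. complex_of_real (kraus t e k * kraus t e l) * c) has_vector_derivative
      complex_of_real ((amp_log_deriv \<tau> (\<lambda>i. k i - e i) e + amp_log_deriv \<tau> (\<lambda>i. l i - e i) e)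
           * (kraus \<tau> e k * kraus \<tau> e l)) * c) (at \<tau>)" for c e
  proof -
    have "((\<lambda>t. kraus t e k * kraus t e l) has_real_derivative
        (amp_log_deriv \<tau> (\<lambda>i. k i - e i) e + amp_log_deriv \<tau> (\<lambda>i. l i - e i) e)
           * (kraus \<tau> e k * kraus \<tau> e l)) (at \<tau>)"
      using DERIV_mult[OF kraus_has_derivative[OF assms, of e k] kraus_has_derivative[OF assms, of e l]]
      by (simp add: algebra_simps)
    then show ?thesis
      by (intro has_vector_derivative_mult_left has_vector_derivative_of_real)
        (simp add: has_real_derivative_iff_has_vector_derivative)
  qed
  then show ?thesis unfolding amp_out_def prod.case by (intro has_vector_derivative_sum)
qed

section \<open>Number-diagonal-signal probes\<close>

text \<open>Translates sums over inputs \<open>n\<close> into sums over outputs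
  \<open>k = n + e\<close>.\<close>

lemma has_sum_shift:
  fixes f :: "('m \<Rightarrow> nat) \<Rightarrow> 'a :: {topological_comm_monoid_add, t2_space}"
  assumes "(f has_sum S) UNIV"
  shows "((\<lambda>k. if e \<le> k then f (\<lambda>i. k i - e i) else 0) has_sum S) UNIV"
proof -
  let ?g = "\<lambda>k. if e \<le> k then f (\<lambda>i. k i - e i) else 0"
  have inj: "inj (\<lambda>n i. n i + e i)" by (auto simp: inj_def fun_eq_iff)
  have "(?g has_sum S) (range (\<lambda>n i. n i + e i))"
    by (subst has_sum_reindex[OF inj]) (use assms in \<open>simp add: o_def le_fun_def\<close>)
  moreover have "(?g has_sum S) (range (\<lambda>n i. n i + e i)) \<longleftrightarrow> (?g has_sum S) UNIV"
  proof (rule has_sum_cong_neutral)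
    fix k assume k: "k \<in> UNIV - range (\<lambda>n i. n i + e i)"
    have "\<not> e \<le> k"
    proof
      assume "e \<le> k"
      then have "k = (\<lambda>i. (k i - e i) + e i)" by (auto simp: le_fun_def)
      then show False using k by (metis DiffD2 rangeI)
    qed
    then show "?g k = 0" by simp
  qed auto
  ultimately show ?thesis by simp
qed

text \<open>The \<open>e\<close>-th Kraus branch of \<open>\<psi>\<close> with the amplitudes
  \<open>\<kappa>\<close> left free: later they are \<open>amp\<close> at either parameter, or
  \<open>damp\<close> once the logarithmic derivative has acted.\<close>

definition chan :: "(('m::finite \<Rightarrow> nat) \<Rightarrow> ('m \<Rightarrow> nat) \<Rightarrow> real) \<Rightarrow> ('a \<times> ('m \<Rightarrow> nat) \<Rightarrow> complex)
    \<Rightarrow> ('m \<Rightarrow> nat) \<Rightarrow> 'a \<times> ('m \<Rightarrow> nat) \<Rightarrow> complex" where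
  "chan \<kappa> \<psi> e = (\<lambda>(a, k). if e \<le> k then complex_of_real (\<kappa> (\<lambda>i. k i - e i) e) * \<psi> (a, \<lambda>i. k i - e i) else 0)"

lemma finite_chan: "finite {e. chan \<kappa> \<psi> e x \<noteq> 0}"
proof -
  obtain a k where x: "x = (a, k)" by (cases x)
  show ?thesis by (rule finite_subset[OF _ finite_below[of k]]) (auto simp: chan_def x)
qed

lemma amp_out_ketbra: "amp_out \<tau> (ketbra \<psi>) = gkern (\<lambda>_. 1) (chan (amp \<tau>) \<psi>) (chan (amp \<tau>) \<psi>)"
proof (intro ext, clarify)
  fix a k b l
  let ?U = "chan (amp \<tau>) \<psi>"
  have "gkern (\<lambda>_. 1) ?U ?U (a, k) (b, l) = (\<Sum>e | e \<le> k. ?U e (a, k) * cnj (?U e (b, l)))"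
    unfolding gkern_def by (rule sum.mono_neutral_cong_left[OF finite_below]) (auto simp: chan_def)
  also have "\<dots> = amp_out \<tau> (ketbra \<psi>) (a, k) (b, l)"
    unfolding amp_out_def prod.case
    by (rule sum.cong) (auto simp: chan_def kraus_def ketbra_def)
  finally show "amp_out \<tau> (ketbra \<psi>) (a, k) (b, l) = gkern (\<lambda>_. 1) ?U ?U (a, k) (b, l)" ..
qed

context
  fixes p :: "('m::finite \<Rightarrow> nat) \<Rightarrow> real" and \<xi> :: "('m \<Rightarrow> nat) \<Rightarrow> 'a \<Rightarrow> complex" and N :: real
  assumes probe: "nds_probe p \<xi> N"
begin

lemma p_nonneg: "0 \<le> p n" and p_has_sum: "(p has_sum 1) UNIV"
  using probe by (auto simp: nds_probe_def)

lemma \<xi>_ell2: "p n \<noteq> 0 \<Longrightarrow> ell2 (\<xi> n)"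
  and \<xi>_cinner: "p n \<noteq> 0 \<Longrightarrow> p m \<noteq> 0 \<Longrightarrow> cinner (\<xi> n) (\<xi> m) = (if n = m then 1 else 0)"
  using probe by (auto simp: nds_probe_def orthonormal_on_def)

lemma photon_has_sum: "((\<lambda>n. p n * real (total_number n + CARD('m))) has_sum N + real CARD('m)) UNIV"
proof -
  have "((\<lambda>n. real (total_number n) * p n) has_sum N) UNIV"
  proof (rule has_sum_total_numberI)
    have "(\<Sum>k | total_number k = j. real (total_number k) * p k) = real j * total_dist p j" for j
      by (simp add: total_dist_def sum_distrib_left)
    then show "(\<lambda>j. \<Sum>k | total_number k = j. real (total_number k) * p k) sums N"
      using probe by (simp add: nds_probe_def)
  qed (simp add: p_nonneg)
  from has_sum_add[OF this has_sum_cmult_right[OF p_has_sum, of "real CARD('m)"]]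
  show ?thesis by (simp add: algebra_simps)
qed

abbreviation (input) "\<psi> \<equiv> nds_vector p \<xi>"

lemma
  shows ell2_\<psi>_slice: "ell2 (\<lambda>a. \<psi> (a, n))"
    and cinner_\<psi>_slice: "cinner (\<lambda>a. \<psi> (a, n)) (\<lambda>a. \<psi> (a, m)) = (if n = m then complex_of_real (p n) else 0)"
proof -
  show "ell2 (\<lambda>a. \<psi> (a, n))" 
    by (cases "p n = 0") (auto simp: nds_vector_def intro: ell2_scale \<xi>_ell2)
  show "cinner (\<lambda>a. \<psi> (a, n)) (\<lambda>a. \<psi> (a, m)) = (if n = m then complex_of_real (p n) else 0)"
    by (cases "p n = 0 \<or> p m = 0")
      (auto simp: nds_vector_def cinner_scale_left cinner_scale_right \<xi>_cinner p_nonneg simp flip: of_real_mult)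
qed

text \<open>Here the number-diagonal form enters: at a fixed output \<open>k\<close>, different
  environment numbers stem from different inputs \<open>k - e\<close>, whose ancilla vectors are
  orthogonal. So branches with different \<open>e\<close> are orthogonal whatever the amplitudes
  are.\<close>

lemma cinner_chan_slice:
  "cinner (\<lambda>a. chan \<kappa> \<psi> e (a, k)) (\<lambda>a. chan \<kappa>' \<psi> e' (a, k)) =
     (if e = e' then complex_of_real (if e \<le> k
        then (\<lambda>n. p n * (\<kappa> n e * \<kappa>' n e)) (\<lambda>i. k i - e i) else 0) else 0)"
proof (cases "(e \<le> k) \<and> (e' \<le> k)")
  case True
  have "(\<lambda>i. k i - e i) = (\<lambda>i. k i - e' i) \<longleftrightarrow> e = e'"
    using True by (auto simp: fun_eq_iff le_fun_def) (metis diff_diff_cancel)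
  with True show ?thesis
    by (auto simp: chan_def cinner_scale_left cinner_scale_right cinner_\<psi>_slice)
next
  case False
  have "(\<lambda>a. chan \<kappa> \<psi> e (a, k)) = (\<lambda>_. 0)" if "\<not> (e \<le> k)" for \<kappa> e
    using that by (simp add: chan_def)
  with False show ?thesis by auto
qed

lemma ell2_chan_slice: "ell2 (\<lambda>a. chan \<kappa> \<psi> e (a, k))"
  by (cases "e \<le> k") (auto simp: chan_def intro: ell2_scale ell2_\<psi>_slice)

definition overlap where "overlap \<kappa> \<kappa>' e = (\<Sum>\<^sub>\<infinity>n. p n * (\<kappa> n e * \<kappa>' n e))"

lemma ell2_chan:
  assumes "(\<lambda>n. p n * (\<kappa> n e)\<^sup>2) summable_on UNIV"
  shows "ell2 (chan \<kappa> \<psi> e)"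
proof (rule ell2_colsI(1))
  show slice: "ell2 (\<lambda>a. chan \<kappa> \<psi> e (a, k))" for k
    by (rule ell2_chan_slice)
  have "((\<lambda>n. p n * (\<kappa> n e * \<kappa> n e)) has_sum overlap \<kappa> \<kappa> e) UNIV"
    unfolding overlap_def using assms by (simp add: power2_eq_square)
  from has_sum_shift[OF this, of e]
  show "((\<lambda>k. (norm2 (\<lambda>a. chan \<kappa> \<psi> e (a, k)))\<^sup>2) has_sum overlap \<kappa> \<kappa> e) UNIV"
  proof (rule has_sum_cong[THEN iffD1, rotated])
    fix k
    have "complex_of_real ((norm2 (\<lambda>a. chan \<kappa> \<psi> e (a, k)))\<^sup>2) = complex_of_real (if e \<le> k
        then (\<lambda>n. p n * (\<kappa> n e * \<kappa> n e)) (\<lambda>i. k i - e i) else 0)"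
      unfolding cinner_self[OF slice, symmetric] cinner_chan_slice by simp
    then show "(if e \<le> k then p (\<lambda>i. k i - e i) * (\<kappa> (\<lambda>i. k i - e i) e * \<kappa> (\<lambda>i. k i - e i) e) else 0)
        = (norm2 (\<lambda>a. chan \<kappa> \<psi> e (a, k)))\<^sup>2"
      by (simp only: of_real_eq_iff)
  qed
qed

lemma cinner_chan:
  assumes "\<And>e. (\<lambda>n. p n * (\<kappa> n e)\<^sup>2) summable_on UNIV" "\<And>e. (\<lambda>n. p n * (\<kappa>' n e)\<^sup>2) summable_on UNIV"
    and s: "\<And>e. (\<lambda>n. p n * (\<kappa> n e * \<kappa>' n e)) summable_on UNIV"
  shows "cinner (chan \<kappa> \<psi> e) (chan \<kappa>' \<psi> e') = (if e = e' then complex_of_real (overlap \<kappa> \<kappa>' e) else 0)"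
proof -
  have c: "((\<lambda>k. cinner (\<lambda>a. chan \<kappa> \<psi> e (a, k)) (\<lambda>a. chan \<kappa>' \<psi> e' (a, k)))
      has_sum cinner (chan \<kappa> \<psi> e) (chan \<kappa>' \<psi> e')) UNIV"
    by (intro cinner_cols ell2_chan assms)
  show ?thesis
  proof (cases "e = e'")
    case True
    have "((\<lambda>n. p n * (\<kappa> n e * \<kappa>' n e)) has_sum overlap \<kappa> \<kappa>' e) UNIV"
      unfolding overlap_def using s by simp
    from has_sum_of_real[where ?'a = complex, OF has_sum_shift[OF this, of e]] c
    show ?thesis unfolding cinner_chan_slice using True by (auto intro: has_sum_unique)
  next
    case False
    with c show ?thesis
      unfolding cinner_chan_slice by (simp add: has_sum_unique has_sum_0)
  qed
qed

lemma ortho_family_chan: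
  assumes "\<And>e. (\<lambda>n. p n * (\<kappa> n e)\<^sup>2) summable_on UNIV"
  shows "ortho_family (chan \<kappa> \<psi>) (overlap \<kappa> \<kappa>)"
proof -
  have s: "(\<lambda>n. p n * (\<kappa> n e * \<kappa> n e)) summable_on UNIV" for e
    using assms by (simp add: power2_eq_square)
  note ell = ell2_chan[OF assms]
  have "complex_of_real ((norm2 (chan \<kappa> \<psi> e))\<^sup>2) = complex_of_real (overlap \<kappa> \<kappa> e)" for e
    unfolding cinner_self[OF ell, symmetric] by (simp add: cinner_chan[OF assms assms s])
  then have "(norm2 (chan \<kappa> \<psi> e))\<^sup>2 = overlap \<kappa> \<kappa> e" for e by (simp only: of_real_eq_iff)
  then show ?thesis
    unfolding ortho_family_def by (auto simp: ell cinner_chan[OF assms assms s] finite_chan)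
qed

section \<open>Overlaps of branches and the fidelity\<close>

lemma amp_le_1: "0 < \<tau> \<Longrightarrow> amp \<tau> n e \<le> 1"
proof -
  assume \<tau>: "0 < \<tau>"
  have "(amp \<tau> n e)\<^sup>2 \<le> 1"
    using finite_sum_le_has_sum[OF amp_norm_has_sum[OF \<tau>, of n], of "{e}"] by simp
  then show ?thesis by (simp add: abs_square_le_1 abs_le_iff)
qed

lemma amp_summable:
  assumes "0 < \<tau>" "0 < \<tau>'"
  shows "(\<lambda>n. p n * (amp \<tau> n e * amp \<tau>' n e)) summable_on UNIV"
proof (rule summable_on_comparison_test[OF has_sum_imp_summable[OF p_has_sum]])
  fix n
  have "amp \<tau> n e * amp \<tau>' n e \<le> 1 * 1"
    by (intro mult_mono amp_le_1 assms less_imp_le[OF amp_pos]) simp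
  then show "p n * (amp \<tau> n e * amp \<tau>' n e) \<le> p n"
    using mult_left_mono[OF _ p_nonneg[of n], of "amp \<tau> n e * amp \<tau>' n e" 1] by simp
  show "0 \<le> p n * (amp \<tau> n e * amp \<tau>' n e)"
    using p_nonneg[of n] amp_pos[OF assms(1), of n e] amp_pos[OF assms(2), of n e] by simp
qed

lemma amp_summable_sq: "0 < \<tau> \<Longrightarrow> (\<lambda>n. p n * (amp \<tau> n e)\<^sup>2) summable_on UNIV"
  using amp_summable[of \<tau> \<tau> e] by (simp add: power2_eq_square)

lemma overlap_amp_has_sum:
  assumes "0 < \<tau>" "0 < \<tau>'"
  shows "((\<lambda>n. p n * (amp \<tau> n e * amp \<tau>' n e)) has_sum overlap (amp \<tau>) (amp \<tau>') e) UNIV"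
  unfolding overlap_def using amp_summable[OF assms] by simp

text \<open>The diagonal operators divide by the squared norms of the branches. These are strictly
  positive because every amplitude is for \<open>\<tau> > 0\<close>, and some \<open>p n\<close>
  is.\<close>

lemma overlap_amp_pos:
  assumes "0 < \<tau>" "0 < \<tau>'"
  shows "0 < overlap (amp \<tau>) (amp \<tau>') e"
proof -
  have "\<exists>n. p n \<noteq> 0"
  proof (rule ccontr)
    assume "\<not> (\<exists>n. p n \<noteq> 0)"
    then have "p = (\<lambda>_. 0)" by auto
    then have "(p has_sum 0) UNIV" by simp
    with p_has_sum show False using has_sum_unique by fastforce
  qed
  then obtain n where n: "0 < p n" using p_nonneg by (metis less_eq_real_def)
  have "0 < p n * (amp \<tau> n e * amp \<tau>' n e)"
    using n amp_pos[OF assms(1), of n e] amp_pos[OF assms(2), of n e] by simp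
  also have "\<dots> \<le> overlap (amp \<tau>) (amp \<tau>') e"
  proof -
    have "0 \<le> p m * (amp \<tau> m e * amp \<tau>' m e)" for m
      using p_nonneg[of m] amp_pos[OF assms(1), of m e] amp_pos[OF assms(2), of m e] by simp
    then show ?thesis
      using finite_sum_le_has_sum[OF overlap_amp_has_sum[OF assms, of e], of "{n}"] by simp
  qed
  finally show ?thesis .
qed

lemma overlap_amp_le_1:
  assumes "0 < \<tau>" "0 < \<tau>'"
  shows "overlap (amp \<tau>) (amp \<tau>') e \<le> 1"
proof (rule has_sum_mono[OF overlap_amp_has_sum[OF assms] p_has_sum])
  fix n
  have "amp \<tau> n e * amp \<tau>' n e \<le> 1 * 1"
    by (intro mult_mono amp_le_1 assms less_imp_le[OF amp_pos]) simp
  then show "p n * (amp \<tau> n e * amp \<tau>' n e) \<le> p n"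
    using mult_left_mono[OF _ p_nonneg[of n], of "amp \<tau> n e * amp \<tau>' n e" 1] by simp
qed

text \<open>Summing over \<open>e\<close> first gives a power of
  \<open>sech (\<tau>' - \<tau>)\<close> for each input; grouping inputs by total number gives the
  series in \<open>total_dist\<close>. \<open>S\<close> is later identified with the
  fidelity.\<close>

lemma overlap_amp_sum:
  assumes "0 < \<tau>" "0 < \<tau>'"
  obtains S where "(overlap (amp \<tau>) (amp \<tau>') has_sum S) UNIV"
    "(\<lambda>j. total_dist p j * sech (\<tau>' - \<tau>) ^ (j + CARD('m))) sums S"
proof -
  let ?\<nu> = "sech (\<tau>' - \<tau>)"
  have \<nu>: "0 < ?\<nu>" "?\<nu> \<le> 1"
    using cosh_real_ge_1[of "\<tau>' - \<tau>"] by (simp_all add: sech_def divide_le_eq_1)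
  define S where "S = (\<Sum>\<^sub>\<infinity>n. p n * ?\<nu> ^ (total_number n + CARD('m)))"
  have "(\<lambda>n. p n * ?\<nu> ^ (total_number n + CARD('m))) summable_on UNIV"
  proof (rule summable_on_comparison_test[OF has_sum_imp_summable[OF p_has_sum]])
    show "p n * ?\<nu> ^ (total_number n + CARD('m)) \<le> p n" for n
      using mult_left_mono[OF power_le_one[OF less_imp_le[OF \<nu>(1)] \<nu>(2)] p_nonneg[of n]] by simp
  qed (use \<nu> p_nonneg in auto)
  then have S: "((\<lambda>n. p n * ?\<nu> ^ (total_number n + CARD('m))) has_sum S) UNIV"
    unfolding S_def by simp
  have "(overlap (amp \<tau>) (amp \<tau>') has_sum S) UNIV"
  proof (rule has_sum_prod_swap_nonneg[OF _ _ S])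
    show "0 \<le> p n * (amp \<tau> n e * amp \<tau>' n e)" for e n
      using p_nonneg[of n] amp_pos[OF assms(1), of n e] amp_pos[OF assms(2), of n e] by simp
    show "((\<lambda>e. p n * (amp \<tau> n e * amp \<tau>' n e)) has_sum p n * ?\<nu> ^ (total_number n + CARD('m))) UNIV" for n
      by (rule has_sum_cmult_right[OF amp_overlap_has_sum[OF assms]])
  qed (rule overlap_amp_has_sum[OF assms])
  moreover have "(\<lambda>j. total_dist p j * ?\<nu> ^ (j + CARD('m))) sums S"
    using has_sum_total_number[OF S] by (simp add: total_dist_def sum_distrib_right)
  ultimately show ?thesis by (rule that)
qed

text \<open>With \<open>q\<close> the squared norms and \<open>s\<close> the overlaps, the root of
  the first state has weights \<open>1 / sqrt q\<close>, the sandwiched second state has weights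
  \<open>s^2 / q\<close>, its root has weights \<open>s / q\<close>, and the trace of that root is
  the sum of \<open>s\<close>.\<close>

lemma fidelity_nds:
  assumes \<tau>: "0 < \<tau>" and \<tau>': "0 < \<tau>'"
  shows "(\<lambda>n. total_dist p n * sech (\<tau>' - \<tau>) ^ (n + CARD('m))) sums
          fidelity (amp_out \<tau> (ketbra \<psi>)) (amp_out \<tau>' (ketbra \<psi>))"
proof -
  let ?U = "chan (amp \<tau>) \<psi>" and ?V = "chan (amp \<tau>') \<psi>"
  let ?q = "overlap (amp \<tau>) (amp \<tau>)" and ?s = "overlap (amp \<tau>) (amp \<tau>')"
  note u = ortho_family_chan[OF amp_summable_sq[OF \<tau>]]
  note q = overlap_amp_pos[OF \<tau> \<tau>] and q1 = overlap_amp_le_1[OF \<tau> \<tau>]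
  note s = overlap_amp_pos[OF \<tau> \<tau>'] and s1 = overlap_amp_le_1[OF \<tau> \<tau>']
  have ellU: "ell2 (?U e)" and ellV: "ell2 (?V e)" for e
    by (intro ell2_chan amp_summable_sq \<tau> \<tau>')+
  obtain S where S: "(?s has_sum S) UNIV" 
    "(\<lambda>j. total_dist p j * sech (\<tau>' - \<tau>) ^ (j + CARD('m))) sums S"
    using overlap_amp_sum[OF \<tau> \<tau>'] by blast
  have UV: "cinner (?U e) (?V e') = (if e = e' then complex_of_real (?s e) else 0)" for e e'
    by (rule cinner_chan[OF amp_summable_sq[OF \<tau>] amp_summable_sq[OF \<tau>'] amp_summable[OF \<tau> \<tau>']])
  have VU: "cinner (?V e) (?U e') = (if e = e' then complex_of_real (?s e) else 0)" for e e'
    using cnj_cinner[of "?U e'" "?V e"] by (auto simp: UV)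
  define d where "d e = 1 / sqrt (?q e)" for e
  have dd: "d e * d e * ?q e = 1" for e
    using q[of e] by (simp add: d_def)
  have dq: "d e * ?q e \<le> 1" for e
    using q[of e] q1[of e] by (simp add: d_def real_div_sqrt real_sqrt_le_1_iff)
  have "op_sqrt (gkern (\<lambda>e. d e * d e * ?q e) ?U ?U) = gkern d ?U ?U"
    by (rule op_sqrt_gkern[OF u q _ dq]) (use q in \<open>simp add: d_def less_imp_le\<close>)
  then have R: "op_sqrt (gkern (\<lambda>_. 1) ?U ?U) = gkern d ?U ?U"
    by (simp add: dd)
  have "kmult (gkern d ?U ?U) (gkern (\<lambda>_. 1) ?V ?V) = gkern (\<lambda>e. d e * ?s e) ?U ?V"
    using kmult_gkern[OF finite_chan ellU ellV finite_chan finite_chan UV, where b = d and d = "\<lambda>_. 1"] by simp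
  moreover have "kmult (gkern (\<lambda>e. d e * ?s e) ?U ?V) (gkern d ?U ?U) = gkern (\<lambda>e. d e * ?s e * d e * ?s e) ?U ?U"
    by (rule kmult_gkern[OF finite_chan ellV ellU finite_chan finite_chan VU])
  \<comment> \<open>Brought into the pattern \<open>d * d * q\<close> of
    \<open>op_sqrt_gkern\<close>, now with \<open>s / q\<close> for \<open>d\<close>; the
    eigenvalues of that root are the overlaps \<open>s\<close>, at most 1.\<close>
  moreover have "d e * ?s e * d e * ?s e = (?s e / ?q e) * (?s e / ?q e) * ?q e" for e
  proof -
    have "d e * ?s e * d e * ?s e = (d e * d e) * (?s e * ?s e)" by simp
    also have "d e * d e = 1 / ?q e" using dd[of e] q[of e] by (simp add: field_simps)
    finally show ?thesis using q[of e] by simp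
  qed
  ultimately have "kmult (kmult (op_sqrt (gkern (\<lambda>_. 1) ?U ?U)) (gkern (\<lambda>_. 1) ?V ?V)) (op_sqrt (gkern (\<lambda>_. 1) ?U ?U))
      = gkern (\<lambda>e. (?s e / ?q e) * (?s e / ?q e) * ?q e) ?U ?U"
    by (simp only: R)
  moreover have sq: "(?s e / ?q e) * ?q e = ?s e" for e using q[of e] by simp
  moreover have "op_sqrt (gkern (\<lambda>e. (?s e / ?q e) * (?s e / ?q e) * ?q e) ?U ?U) = gkern (\<lambda>e. ?s e / ?q e) ?U ?U"
    by (rule op_sqrt_gkern[OF u q, where C = 1]) (use q s s1 in \<open>simp_all only: sq divide_nonneg_pos less_imp_le\<close>)
  moreover have "trace_op (gkern (\<lambda>e. ?s e / ?q e) ?U ?U) = complex_of_real S"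
    by (rule trace_op_gkern[OF u]) (use q s S in \<open>simp_all only: sq divide_nonneg_pos less_imp_le\<close>)
  ultimately have "fidelity (amp_out \<tau> (ketbra \<psi>)) (amp_out \<tau>' (ketbra \<psi>)) = S"
    unfolding fidelity_def amp_out_ketbra by simp
  with S show ?thesis by simp
qed

text \<open>The symmetric logarithmic derivative is diagonal in the orthonormal set of vectors
  \<open>\<xi> n \<otimes> |n + e\<rangle>\<close>, with eigenvalues \<open>2 * amp_log_deriv \<tau> n e\<close>.\<close>

definition SLD :: "real \<Rightarrow> ('a \<times> ('m \<Rightarrow> nat) \<Rightarrow> complex) \<Rightarrow> 'a \<times> ('m \<Rightarrow> nat) \<Rightarrow> complex" where
  "SLD \<tau> f = (\<lambda>(a, k). \<Sum>e | (e \<le> k) \<and> p (\<lambda>i. k i - e i) \<noteq> 0.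
     complex_of_real (2 * amp_log_deriv \<tau> (\<lambda>i. k i - e i) e)
       * cinner (\<xi> (\<lambda>i. k i - e i)) (\<lambda>b. f (b, k)) * \<xi> (\<lambda>i. k i - e i) a)"

definition SLD_dom :: "real \<Rightarrow> ('a \<times> ('m \<Rightarrow> nat) \<Rightarrow> complex) set" where
  "SLD_dom \<tau> = {f. ell2 f \<and> ell2 (SLD \<tau> f)}"

text \<open>At fixed \<open>k\<close> the operator is a finite combination of ancilla projections
  with real coefficients, so symmetry holds slice by slice; square-summability of both images allows
  the sum over \<open>k\<close>.\<close>

lemma hermitian_SLD: "hermitian_on (SLD_dom \<tau>) (SLD \<tau>)"
proof -
  have add: "SLD \<tau> (\<lambda>x. f x + g x) = (\<lambda>x. SLD \<tau> f x + SLD \<tau> g x)" if "ell2 f" "ell2 g" for f g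
    by (auto simp: SLD_def fun_eq_iff cinner_add_right \<xi>_ell2 ell2_rows(2) that ring_distribs sum.distrib)
  have scale: "SLD \<tau> (\<lambda>x. c * f x) = (\<lambda>x. c * SLD \<tau> f x)" for c f
    by (auto simp: SLD_def fun_eq_iff cinner_scale_right sum_distrib_left mult_ac)
  have sym: "cinner f (SLD \<tau> g) = cinner (SLD \<tau> f) g"
    if "ell2 f" "ell2 g" "ell2 (SLD \<tau> f)" "ell2 (SLD \<tau> g)" for f g
  proof -
    let ?I = "\<lambda>k. {e. (e \<le> k) \<and> p (\<lambda>i. k i - e i) \<noteq> 0}"
    have ell: "ell2 (\<lambda>a. c * \<xi> (\<lambda>i. k i - e i) a)" if "e \<in> ?I k" for c k e
      using that by (intro ell2_scale \<xi>_ell2) simp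
    have "cinner (\<lambda>a. f (a, k)) (\<lambda>a. SLD \<tau> g (a, k)) = (\<Sum>e\<in>?I k. 2 * amp_log_deriv \<tau> (\<lambda>i. k i - e i) e
        * cinner (\<xi> (\<lambda>i. k i - e i)) (\<lambda>b. g (b, k)) * cinner (\<lambda>a. f (a, k)) (\<xi> (\<lambda>i. k i - e i)))" for k
      unfolding SLD_def prod.case
      by (subst cinner_sum_right, rule ell2_rows(2)[OF that(1)], rule ell, assumption)
        (simp only: cinner_scale_right)
    moreover have "cinner (\<lambda>a. SLD \<tau> f (a, k)) (\<lambda>a. g (a, k)) = (\<Sum>e\<in>?I k. 2 * amp_log_deriv \<tau> (\<lambda>i. k i - e i) e
        * cinner (\<xi> (\<lambda>i. k i - e i)) (\<lambda>b. g (b, k)) * cinner (\<lambda>a. f (a, k)) (\<xi> (\<lambda>i. k i - e i)))" for k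
      unfolding SLD_def prod.case
      by (subst cinner_sum_left, rule ell2_rows(2)[OF that(2)], rule ell, assumption)
        (simp only: cinner_scale_left, simp add: cnj_cinner mult_ac)
    ultimately have "cinner (\<lambda>a. f (a, k)) (\<lambda>a. SLD \<tau> g (a, k)) = cinner (\<lambda>a. SLD \<tau> f (a, k)) (\<lambda>a. g (a, k))" for k
      by (simp only:)
    then show ?thesis
      using cinner_cols[OF that(1,4)] cinner_cols[OF that(3,2)] by (simp add: has_sum_unique)
  qed
  have zero: "SLD \<tau> (\<lambda>_. 0) = (\<lambda>_. 0)" using scale[of 0 "\<lambda>_. 0"] by simp
  show ?thesis
    unfolding hermitian_on_def SLD_dom_def
    by (auto simp: zero add scale sym intro: ell2_add ell2_scale)
qed

text \<open>Twice the derivative of \<open>amp\<close>: the amplitude times its eigenvalue of the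
  symmetric logarithmic derivative.\<close>

definition damp :: "real \<Rightarrow> ('m \<Rightarrow> nat) \<Rightarrow> ('m \<Rightarrow> nat) \<Rightarrow> real" where
  "damp \<tau> n e = 2 * amp_log_deriv \<tau> n e * amp \<tau> n e"

text \<open>In branch \<open>e\<close> the vector at output \<open>k\<close> is a multiple of
  \<open>\<xi> (k - e)\<close>, an eigenvector. The coefficients \<open>c\<close> are arbitrary
  because everything is a finite sum at each point.\<close>

lemma SLD_comb: "SLD \<tau> (comb c (chan (amp \<tau>) \<psi>)) = comb c (chan (damp \<tau>) \<psi>)"
proof (rule ext, clarify)
  fix a k
  let ?B = "{e. e \<le> k}" and ?I = "{e. (e \<le> k) \<and> p (\<lambda>i. k i - e i) \<noteq> 0}"
  have sub: "comb c (chan \<kappa> \<psi>) (b, k) = (\<Sum>e\<in>?B. c e * chan \<kappa> \<psi> e (b, k))" for \<kappa> b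
    by (rule comb_eq[OF finite_below _ finite_chan]) (auto simp: chan_def)
  \<comment> \<open>Orthonormality of \<open>\<xi>\<close> holds only where \<open>p\<close> is
    non-zero; elsewhere the branch vanishes through the factor \<open>sqrt (p n)\<close>.\<close>
  have in1: "cinner (\<xi> (\<lambda>i. k i - e i)) (\<lambda>b. chan (amp \<tau>) \<psi> e' (b, k))
      = (if e = e' then complex_of_real (amp \<tau> (\<lambda>i. k i - e i) e * sqrt (p (\<lambda>i. k i - e i))) else 0)"
    if e: "e \<in> ?I" and e': "e' \<in> ?B" for e e'
  proof -
    have "(\<lambda>i. k i - e i) = (\<lambda>i. k i - e' i) \<longleftrightarrow> e = e'"
      using e e' by (auto simp: fun_eq_iff le_fun_def) (metis diff_diff_cancel)
    moreover have "cinner (\<xi> (\<lambda>i. k i - e i)) (\<lambda>b. chan (amp \<tau>) \<psi> e' (b, k))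
        = amp \<tau> (\<lambda>i. k i - e' i) e' * (sqrt (p (\<lambda>i. k i - e' i)) * cinner (\<xi> (\<lambda>i. k i - e i)) (\<xi> (\<lambda>i. k i - e' i)))"
      using e' by (simp add: chan_def nds_vector_def cinner_scale_right)
    moreover have "p (\<lambda>i. k i - e' i) \<noteq> 0 \<Longrightarrow> cinner (\<xi> (\<lambda>i. k i - e i)) (\<xi> (\<lambda>i. k i - e' i))
        = (if (\<lambda>i. k i - e i) = (\<lambda>i. k i - e' i) then 1 else 0)"
      using e by (intro \<xi>_cinner) auto
    ultimately show ?thesis
      by (cases "p (\<lambda>i. k i - e' i) = 0") auto
  qed
  have "SLD \<tau> (comb c (chan (amp \<tau>) \<psi>)) (a, k) = (\<Sum>e\<in>?I. 2 * amp_log_deriv \<tau> (\<lambda>i. k i - e i) e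
      * (\<Sum>e'\<in>?B. c e' * cinner (\<xi> (\<lambda>i. k i - e i)) (\<lambda>b. chan (amp \<tau>) \<psi> e' (b, k))) * \<xi> (\<lambda>i. k i - e i) a)"
    unfolding SLD_def prod.case sub
  proof (intro sum.cong refl)
    fix e assume "e \<in> ?I"
    then have "ell2 (\<xi> (\<lambda>i. k i - e i))" by (simp add: \<xi>_ell2)
    moreover have "ell2 (\<lambda>b. chan (amp \<tau>) \<psi> e' (b, k))" for e'
      by (rule ell2_chan_slice)
    ultimately have "cinner (\<xi> (\<lambda>i. k i - e i)) (\<lambda>b. \<Sum>e'\<in>?B. c e' * chan (amp \<tau>) \<psi> e' (b, k))
        = (\<Sum>e'\<in>?B. c e' * cinner (\<xi> (\<lambda>i. k i - e i)) (\<lambda>b. chan (amp \<tau>) \<psi> e' (b, k)))"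
      by (simp add: cinner_sum_right ell2_scale cinner_scale_right)
    then show "complex_of_real (2 * amp_log_deriv \<tau> (\<lambda>i. k i - e i) e)
        * cinner (\<xi> (\<lambda>i. k i - e i)) (\<lambda>b. \<Sum>e'\<in>?B. c e' * chan (amp \<tau>) \<psi> e' (b, k)) * \<xi> (\<lambda>i. k i - e i) a
      = complex_of_real (2 * amp_log_deriv \<tau> (\<lambda>i. k i - e i) e)
        * (\<Sum>e'\<in>?B. c e' * cinner (\<xi> (\<lambda>i. k i - e i)) (\<lambda>b. chan (amp \<tau>) \<psi> e' (b, k))) * \<xi> (\<lambda>i. k i - e i) a"
      by (simp only:)
  qed
  also have "\<dots> = (\<Sum>e\<in>?I. c e * chan (damp \<tau>) \<psi> e (a, k))"
  proof (intro sum.cong refl)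
    fix e assume e: "e \<in> ?I"
    have "(\<Sum>e'\<in>?B. c e' * cinner (\<xi> (\<lambda>i. k i - e i)) (\<lambda>b. chan (amp \<tau>) \<psi> e' (b, k)))
        = (\<Sum>e'\<in>?B. if e = e' then c e * (amp \<tau> (\<lambda>i. k i - e i) e * sqrt (p (\<lambda>i. k i - e i))) else 0)"
      by (intro sum.cong refl) (simp add: in1[OF e])
    also have "\<dots> = c e * (amp \<tau> (\<lambda>i. k i - e i) e * sqrt (p (\<lambda>i. k i - e i)))"
      using e by (simp add: sum.delta finite_below)
    finally show "2 * amp_log_deriv \<tau> (\<lambda>i. k i - e i) e
        * (\<Sum>e'\<in>?B. c e' * cinner (\<xi> (\<lambda>i. k i - e i)) (\<lambda>b. chan (amp \<tau>) \<psi> e' (b, k))) * \<xi> (\<lambda>i. k i - e i) a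
        = c e * chan (damp \<tau>) \<psi> e (a, k)"
      using e by (simp add: chan_def nds_vector_def damp_def)
  qed
  \<comment> \<open>Inputs of probability 0 can be put back, their branches being 0.\<close>
  also have "\<dots> = (\<Sum>e\<in>?B. c e * chan (damp \<tau>) \<psi> e (a, k))"
    by (rule sum.mono_neutral_left[OF finite_below]) (auto simp: chan_def nds_vector_def)
  finally show "SLD \<tau> (comb c (chan (amp \<tau>) \<psi>)) (a, k) = comb c (chan (damp \<tau>) \<psi>) (a, k)"
    by (simp only: sub)
qed

lemma damp_has_sum:
  assumes \<tau>: "0 < \<tau>"
  shows "((\<lambda>e. (damp \<tau> n e)\<^sup>2) has_sum 4 * real (total_number n + CARD('m))) UNIV"
  using has_sum_cmult_right[OF amp_log_deriv_has_sum[OF \<tau>, of n], of 4]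
  by (simp add: damp_def power_mult_distrib mult_ac)

lemma damp_summable:
  assumes \<tau>: "0 < \<tau>"
  shows "(\<lambda>n. p n * (damp \<tau> n e)\<^sup>2) summable_on UNIV"
proof (rule summable_on_comparison_test)
  show "(\<lambda>n. 4 * (p n * real (total_number n + CARD('m)))) summable_on UNIV"
    by (rule summable_on_cmult_right[OF has_sum_imp_summable[OF photon_has_sum]])
  show "p n * (damp \<tau> n e)\<^sup>2 \<le> 4 * (p n * real (total_number n + CARD('m)))" for n
    using mult_left_mono[OF finite_sum_le_has_sum[OF damp_has_sum[OF \<tau>, of n], of "{e}"] p_nonneg[of n]]
    by (simp add: mult_ac)
  show "0 \<le> p n * (damp \<tau> n e)\<^sup>2" for n by (simp add: p_nonneg)
qed

text \<open>For each input the sum over \<open>e\<close> is four times \<open>n + M\<close>, and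
  \<open>photon_has_sum\<close> averages this over the probe. It is the value of the trace in
  \<open>has_QFI_nds\<close>.\<close>

lemma overlap_damp_has_sum:
  assumes \<tau>: "0 < \<tau>"
  shows "(overlap (damp \<tau>) (damp \<tau>) has_sum 4 * (N + real CARD('m))) UNIV"
proof (rule has_sum_prod_swap_nonneg)
  show "((\<lambda>e. p n * (damp \<tau> n e)\<^sup>2) has_sum p n * (4 * real (total_number n + CARD('m)))) UNIV" for n
    by (rule has_sum_cmult_right[OF damp_has_sum[OF \<tau>]])
  show "((\<lambda>n. p n * (4 * real (total_number n + CARD('m)))) has_sum 4 * (N + real CARD('m))) UNIV"
    using has_sum_cmult_right[OF photon_has_sum, of 4] by (simp add: mult_ac)
  show "((\<lambda>n. p n * (damp \<tau> n e)\<^sup>2) has_sum overlap (damp \<tau>) (damp \<tau>) e) UNIV" for e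
    unfolding overlap_def using damp_summable[OF \<tau>, of e] by (simp add: power2_eq_square)
qed (simp add: p_nonneg)

text \<open>\<open>R\<close> sends the basis vector at \<open>x\<close> to a combination of the
  branches \<open>?U e\<close>, and \<open>SLD\<close> replaces these by the orthogonal vectors
  \<open>?W e\<close>. The squared norm of the image is the sum of
  \<open>|?U e x|^2 * ?m e / ?q e\<close>; summing over \<open>x\<close> cancels \<open>?q e\<close>
  and leaves the sum of \<open>?m e\<close>.\<close>

lemma has_QFI_nds:
  assumes \<tau>: "0 < \<tau>"
  shows "has_QFI (\<lambda>t. amp_out t (ketbra \<psi>)) \<tau> (4 * (N + real CARD('m)))"
proof -
  let ?U = "chan (amp \<tau>) \<psi>" and ?W = "chan (damp \<tau>) \<psi>"
  let ?q = "overlap (amp \<tau>) (amp \<tau>)" and ?m = "overlap (damp \<tau>) (damp \<tau>)"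
  let ?K = "4 * (N + real CARD('m))"
  note u = ortho_family_chan[OF amp_summable_sq[OF \<tau>]]
  note w = ortho_family_chan[OF damp_summable[OF \<tau>]]
  note q = overlap_amp_pos[OF \<tau> \<tau>] and q1 = overlap_amp_le_1[OF \<tau> \<tau>]
  have ellU: "ell2 (?U e)" for e by (intro ell2_chan amp_summable_sq \<tau>)
  have ellW: "ell2 (?W e)" for e by (intro ell2_chan damp_summable \<tau>)
  have m0: "0 \<le> ?m e" for e by (rule ortho_family_nonneg[OF w])
  note K = overlap_damp_has_sum[OF \<tau>]
  have mK: "?m e \<le> ?K" for e
    using finite_sum_le_has_sum[OF K, of "{e}"] m0 by simp
  have K0: "0 \<le> ?K" using order_trans[OF m0 mK] .
  define d where "d e = 1 / sqrt (?q e)" for e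
  have dd: "d e * d e * ?q e = 1" for e
    using q[of e] by (simp add: d_def)
  have d2: "(d e)\<^sup>2 = 1 / ?q e" for e
    using q[of e] by (simp add: d_def power_divide)
  have dq: "d e * ?q e \<le> 1" for e
    using q[of e] q1[of e] by (simp add: d_def real_div_sqrt real_sqrt_le_1_iff)
  have d0: "0 \<le> d e" for e using q[of e] by (simp add: d_def less_imp_le)
  define R where "R = gkern d ?U ?U"
  have sq: "is_op_sqrt (amp_out \<tau> (ketbra \<psi>)) R"
    using is_op_sqrt_gkern[OF u q d0 dq] unfolding amp_out_ketbra R_def by (simp add: dd)
  note Rb = positive_op_bounded[OF is_op_sqrt_positive[OF sq]]
  have LR: "SLD \<tau> (kapp R f) = comb (\<lambda>e. d e * cinner (?U e) f) ?W" if "ell2 f" for f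
    unfolding R_def kapp_gkern[OF ellU that] by (rule SLD_comb)
  \<comment> \<open>Bessel in the family \<open>?U\<close> together with
    \<open>?m e \<le> ?K\<close> bounds \<open>L R\<close> by \<open>sqrt ?K\<close>.\<close>
  have bound: "(\<Sum>e\<in>E. (cmod (d e * cinner (?U e) f))\<^sup>2 * ?m e) \<le> ?K * (norm2 f)\<^sup>2"
    if f: "ell2 f" and E: "finite E" for f E
  proof -
    have "(\<Sum>e\<in>E. (cmod (d e * cinner (?U e) f))\<^sup>2 * ?m e) = (\<Sum>e\<in>E. ((cmod (cinner (?U e) f))\<^sup>2 / ?q e) * ?m e)"
      by (simp add: norm_mult power_mult_distrib d2)
    also have "\<dots> \<le> (\<Sum>e\<in>E. ((cmod (cinner (?U e) f))\<^sup>2 / ?q e) * ?K)"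
      by (intro sum_mono mult_left_mono mK) (simp add: less_imp_le[OF q])
    also have "\<dots> = ?K * (\<Sum>e\<in>E. (cmod (cinner (?U e) f))\<^sup>2 / ?q e)"
      by (simp add: sum_distrib_left mult.commute)
    also have "\<dots> \<le> ?K * (norm2 f)\<^sup>2" by (intro mult_left_mono bessel[OF u q f E] K0)
    finally show ?thesis .
  qed
  have ellLR: "ell2 (SLD \<tau> (kapp R f))" and normLR: "(norm2 (SLD \<tau> (kapp R f)))\<^sup>2 \<le> ?K * (norm2 f)\<^sup>2"
    if f: "ell2 f" for f
    unfolding LR[OF f] by (rule ell2_comb[OF w bound[OF f]]; assumption)+
  have dom: "kapp R f \<in> SLD_dom \<tau>" if "ell2 f" for f
    unfolding SLD_dom_def using bounded_op_ell2[OF Rb that] ellLR[OF that] by simp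
  have bd: "bounded_map (\<lambda>f. SLD \<tau> (kapp R f))"
    unfolding bounded_map_def
  proof (intro exI[of _ "sqrt ?K"] allI impI conjI)
    fix f :: "'a \<times> ('m \<Rightarrow> nat) \<Rightarrow> complex" assume f: "ell2 f"
    show "ell2 (SLD \<tau> (kapp R f))" by (rule ellLR[OF f])
    show "norm2 (SLD \<tau> (kapp R f)) \<le> sqrt ?K * norm2 f"
      by (rule power2_le_imp_le) (use normLR[OF f] K0 in \<open>simp_all add: power_mult_distrib\<close>)
  qed
  have ub: "cinner (?U e) (basis x) = cnj (?U e x)" for e x
    using cnj_cinner[of "basis x" "?U e"] by simp
  have HS: "((\<lambda>x. (norm2 (SLD \<tau> (\<lambda>z. R z x)))\<^sup>2) has_sum ?K) UNIV"
  proof (rule has_sum_prod_swap_nonneg[OF _ _ K])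
    show "0 \<le> ((cmod (?U e x))\<^sup>2 / ?q e) * ?m e" for x e
      using q[of e] m0[of e] by simp
    show "((\<lambda>x. ((cmod (?U e x))\<^sup>2 / ?q e) * ?m e) has_sum ?m e) UNIV" for e
    proof -
      have "(norm2 (?U e))\<^sup>2 = ?q e" using u by (simp add: ortho_family_def)
      then have "((\<lambda>x. (cmod (?U e x))\<^sup>2 * (?m e / ?q e)) has_sum ?q e * (?m e / ?q e)) UNIV"
        using has_sum_cmult_left[OF norm2_power2_has_sum[OF ellU[of e]], of "?m e / ?q e"] by simp
      then show ?thesis using q[of e] by simp
    qed
    show "((\<lambda>e. ((cmod (?U e x))\<^sup>2 / ?q e) * ?m e) has_sum (norm2 (SLD \<tau> (\<lambda>z. R z x)))\<^sup>2) UNIV" for x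
    proof (rule has_sum_finite_neutralI)
      let ?E = "{e. ?U e x \<noteq> 0}"
      have "SLD \<tau> (\<lambda>z. R z x) = comb (\<lambda>e. d e * cnj (?U e x)) ?W"
        using LR[of "basis x"] by (simp add: kapp_basis ub)
      also have "\<dots> = (\<lambda>z. \<Sum>e\<in>?E. (d e * cnj (?U e x)) * ?W e z)"
        by (rule ext, rule comb_eq[OF finite_chan _ finite_chan]) auto
      finally have "(norm2 (SLD \<tau> (\<lambda>z. R z x)))\<^sup>2 = (\<Sum>e\<in>?E. (cmod (d e * cnj (?U e x)))\<^sup>2 * ?m e)"
        using pythagoras[OF w finite_chan, of "\<lambda>e. d e * cnj (?U e x)"] by simp
      then show "(norm2 (SLD \<tau> (\<lambda>z. R z x)))\<^sup>2 = (\<Sum>e\<in>?E. ((cmod (?U e x))\<^sup>2 / ?q e) * ?m e)"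
        by (simp add: norm_mult power_mult_distrib d2)
      show "finite ?E" by (rule finite_chan)
    qed auto
  qed
  have Lrho: "SLD \<tau> (\<lambda>z. amp_out \<tau> (ketbra \<psi>) z y) = comb (\<lambda>e. cnj (?U e y)) ?W" for y
  proof -
    have "(\<lambda>z. amp_out \<tau> (ketbra \<psi>) z y) = kapp (gkern (\<lambda>_. 1) ?U ?U) (basis y)"
      unfolding amp_out_ketbra kapp_basis ..
    also have "\<dots> = comb (\<lambda>e. cnj (?U e y)) ?U"
      by (simp add: kapp_gkern[OF ellU ell2_basis] ub)
    finally show ?thesis by (simp only: SLD_comb)
  qed
  have sld: "is_SLD (\<lambda>t. amp_out t (ketbra \<psi>)) \<tau> (SLD_dom \<tau>) (SLD \<tau>)"
    unfolding is_SLD_def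
  proof (intro conjI allI)
    show "hermitian_on (SLD_dom \<tau>) (SLD \<tau>)" by (rule hermitian_SLD)
    show "(\<lambda>z. amp_out \<tau> (ketbra \<psi>) z y) \<in> SLD_dom \<tau>" for y
      unfolding is_op_sqrt_col[OF sq] by (rule dom[OF bounded_op_col[OF Rb]])
    show "((\<lambda>t. amp_out t (ketbra \<psi>) x y) has_vector_derivative
        (1 / 2) * (SLD \<tau> (\<lambda>z. amp_out \<tau> (ketbra \<psi>) z y) x + cnj (SLD \<tau> (\<lambda>z. amp_out \<tau> (ketbra \<psi>) z x) y))) (at \<tau>)" for x y
    proof -
      obtain a k b l where [simp]: "x = (a, k)" "y = (b, l)" by (cases x, cases y)
      let ?B = "{e. e \<le> k}"
      have 1: "comb (\<lambda>e. cnj (?U e y)) ?W x = (\<Sum>e\<in>?B. cnj (?U e y) * ?W e x)"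
        by (rule comb_eq[OF finite_below _ finite_chan]) (auto simp: chan_def)
      have 2: "comb (\<lambda>e. cnj (?U e x)) ?W y = (\<Sum>e\<in>?B. cnj (?U e x) * ?W e y)"
        by (rule comb_eq[OF finite_below _ finite_chan]) (auto simp: chan_def)
      \<comment> \<open>The factor \<open>1 / 2\<close> cancels the 2 in \<open>damp\<close>,
        leaving the product rule for the two amplitudes of each branch.\<close>
      have "(1 / 2) * (SLD \<tau> (\<lambda>z. amp_out \<tau> (ketbra \<psi>) z y) x + cnj (SLD \<tau> (\<lambda>z. amp_out \<tau> (ketbra \<psi>) z x) y))
          = (\<Sum>e\<in>?B. (1 / 2) * (cnj (?U e y) * ?W e x + ?U e x * cnj (?W e y)))"
        unfolding Lrho 1 2 by (simp add: sum.distrib sum_distrib_left ring_distribs)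
      also have "\<dots> = (\<Sum>e\<in>?B. complex_of_real ((amp_log_deriv \<tau> (\<lambda>i. k i - e i) e + amp_log_deriv \<tau> (\<lambda>i. l i - e i) e)
           * (kraus \<tau> e k * kraus \<tau> e l)) * ketbra \<psi> (a, \<lambda>i. k i - e i) (b, \<lambda>i. l i - e i))"
        by (intro sum.cong refl) (auto simp: chan_def damp_def kraus_def ketbra_def algebra_simps)
      finally show ?thesis using amp_out_has_derivative[OF \<tau>, of "ketbra \<psi>" a k b l] by simp
    qed
  qed
  show ?thesis
    unfolding has_QFI_def using sld sq dom bd HS by blast
qed

end

section \<open>Optimality\<close>

text \<open>The quadratic form of \<open>A\<close> at a finitely supported vector. The relabelling
  \<open>s\<close> is arbitrary, which matters because truncated subtraction may identify different
  outputs.\<close>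

lemma positive_op_sum_nonneg:
  assumes A: "positive_op A" and F: "finite F"
  shows "0 \<le> Re (\<Sum>x\<in>F. \<Sum>y\<in>F. cnj (d x) * A (s x) (s y) * d y)"
proof -
  let ?f = "\<lambda>z. \<Sum>x\<in>F. d x * basis (s x) z"
  note b = positive_op_bounded[OF A]
  have ell: "ell2 ?f" by (intro ell2_sum ell2_scale ell2_basis)
  have "kapp A ?f z = (\<Sum>y\<in>F. d y * A z (s y))" for z
    unfolding kapp_eq_cinner
    by (subst cinner_sum_right)
      (auto intro: ell2_cnj bounded_op_row[OF b] ell2_scale simp: cinner_scale_right kapp_eq_cinner[symmetric] kapp_basis)
  then have "cinner ?f (kapp A ?f) = (\<Sum>x\<in>F. cnj (d x) * (\<Sum>y\<in>F. d y * A (s x) (s y)))"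
    by (subst cinner_sum_left)
      (auto intro: bounded_op_ell2[OF b] ell ell2_scale simp: cinner_scale_left)
  also have "\<dots> = (\<Sum>x\<in>F. \<Sum>y\<in>F. cnj (d x) * A (s x) (s y) * d y)"
    by (simp add: sum_distrib_left mult_ac)
  finally show ?thesis
    using positive_op_cinner[OF A ell] by (simp add: complex_nonneg_Reals_iff)
qed

text \<open>Expanding \<open>Tr ((2 \<Lambda> - H) P (2 \<Lambda> - H)) \<ge> 0\<close> with \<open>\<Lambda>\<close> the diagonal matrix of \<open>l\<close>.\<close>

lemma qfi_objective_le:
  assumes F: "finite F" and H: "\<And>x y. cnj (H x y) = H y x"
    and pos: "\<And>c. 0 \<le> Re (\<Sum>x\<in>F. \<Sum>y\<in>F. cnj (c x) * P x y * c y)"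
  shows "qfi_objective F (\<lambda>x y. complex_of_real (l x + l y) * P x y) P H \<le> 4 * (\<Sum>z\<in>F. (l z)\<^sup>2 * Re (P z z))"
proof -
  \<comment> \<open>\<open>?c z\<close> is column \<open>z\<close> of
    \<open>2 \<Lambda> - H\<close>; the form of \<open>P\<close> at it is the diagonal entry
    \<open>z\<close> of the trace being expanded.\<close>
  let ?c = "\<lambda>z x. (if x = z then complex_of_real (2 * l z) else 0) - H x z"
  have ex: "(\<Sum>x\<in>F. \<Sum>y\<in>F. cnj (?c z x) * P x y * ?c z y)
      = 4 * (complex_of_real ((l z)\<^sup>2) * P z z) - 2 * (\<Sum>y\<in>F. complex_of_real (l z) * P z y * H y z)
        - 2 * (\<Sum>x\<in>F. complex_of_real (l z) * P x z * H z x)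
        + (\<Sum>x\<in>F. \<Sum>y\<in>F. H z x * P x y * H y z)" if z: "z \<in> F" for z
  proof -
    let ?L = "complex_of_real (2 * l z)"
    have "cnj (?c z x) * P x y * ?c z y = (if x = z then (if y = z then ?L * P z z * ?L else 0) else 0)
        - (if x = z then ?L * P z y * H y z else 0) - (if y = z then H z x * P x z * ?L else 0) + H z x * P x y * H y z" for x y
      by (auto simp: H algebra_simps)
    then have "(\<Sum>x\<in>F. \<Sum>y\<in>F. cnj (?c z x) * P x y * ?c z y)
        = (\<Sum>x\<in>F. \<Sum>y\<in>F. (if x = z then (if y = z then ?L * P z z * ?L else 0) else 0))
         - (\<Sum>y\<in>F. \<Sum>x\<in>F. (if x = z then ?L * P z y * H y z else 0))
         - (\<Sum>x\<in>F. \<Sum>y\<in>F. (if y = z then H z x * P x z * ?L else 0)) + (\<Sum>x\<in>F. \<Sum>y\<in>F. H z x * P x y * H y z)"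
      by (simp only: sum.distrib sum_subtractf sum.swap[of "\<lambda>y x. if x = z then ?L * P z y * H y z else 0"])
    also have "(\<Sum>x\<in>F. \<Sum>y\<in>F. (if x = z then (if y = z then ?L * P z z * ?L else 0) else 0))
        = (\<Sum>x\<in>F. if x = z then ?L * P z z * ?L else 0)"
      using F z by (intro sum.cong refl) (simp add: sum.delta)
    finally show ?thesis
      using F z by (simp add: sum.delta sum_distrib_left mult_ac power2_eq_square)
  qed
  let ?X = "\<Sum>x\<in>F. \<Sum>y\<in>F. complex_of_real (l x) * P x y * H y x"
  let ?Y = "\<Sum>x\<in>F. \<Sum>y\<in>F. complex_of_real (l y) * P x y * H y x"
  let ?W = "\<Sum>x\<in>F. \<Sum>y\<in>F. \<Sum>w\<in>F. H x y * P y w * H w x"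
  have "0 \<le> (\<Sum>z\<in>F. Re (\<Sum>x\<in>F. \<Sum>y\<in>F. cnj (?c z x) * P x y * ?c z y))"
    by (intro sum_nonneg pos)
  also have "\<dots> = Re (\<Sum>z\<in>F. \<Sum>x\<in>F. \<Sum>y\<in>F. cnj (?c z x) * P x y * ?c z y)" by simp
  also have "(\<Sum>z\<in>F. \<Sum>x\<in>F. \<Sum>y\<in>F. cnj (?c z x) * P x y * ?c z y)
      = 4 * (\<Sum>z\<in>F. complex_of_real ((l z)\<^sup>2) * P z z) - 2 * ?X
        - 2 * (\<Sum>z\<in>F. \<Sum>x\<in>F. complex_of_real (l z) * P x z * H z x) + ?W"
    by (simp only: ex sum.distrib sum_subtractf sum_distrib_left cong: sum.cong)
  also have "(\<Sum>z\<in>F. \<Sum>x\<in>F. complex_of_real (l z) * P x z * H z x) = ?Y"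
    by (rule sum.swap)
  finally have "0 \<le> 4 * (\<Sum>z\<in>F. (l z)\<^sup>2 * Re (P z z)) - 2 * Re ?X - 2 * Re ?Y + Re ?W"
    by simp
  moreover have "(\<Sum>x\<in>F. \<Sum>y\<in>F. complex_of_real (l x + l y) * P x y * H y x) = ?X + ?Y"
    by (simp add: sum.distrib ring_distribs)
  ultimately show ?thesis unfolding qfi_objective_def by simp
qed

text \<open>For fixed \<open>H\<close> the objective is linear in the pair of derivative and state,
  so an estimate may be made branch by branch.\<close>

lemma qfi_objective_sum:
  "qfi_objective F (\<lambda>x y. \<Sum>e\<in>E. D e x y) (\<lambda>x y. \<Sum>e\<in>E. P e x y) H = (\<Sum>e\<in>E. qfi_objective F (D e) (P e) H)"
proof -
  have "(\<Sum>x\<in>F. \<Sum>y\<in>F. (\<Sum>e\<in>E. D e x y) * H y x) = (\<Sum>x\<in>F. \<Sum>y\<in>F. \<Sum>e\<in>E. D e x y * H y x)"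
    by (simp add: sum_distrib_right)
  also have "\<dots> = (\<Sum>x\<in>F. \<Sum>e\<in>E. \<Sum>y\<in>F. D e x y * H y x)" by (intro sum.cong refl sum.swap)
  also have "\<dots> = (\<Sum>e\<in>E. \<Sum>x\<in>F. \<Sum>y\<in>F. D e x y * H y x)" by (rule sum.swap)
  finally have 1: "(\<Sum>x\<in>F. \<Sum>y\<in>F. (\<Sum>e\<in>E. D e x y) * H y x) = (\<Sum>e\<in>E. \<Sum>x\<in>F. \<Sum>y\<in>F. D e x y * H y x)" .
  have "(\<Sum>x\<in>F. \<Sum>y\<in>F. \<Sum>w\<in>F. H x y * (\<Sum>e\<in>E. P e y w) * H w x)
      = (\<Sum>x\<in>F. \<Sum>y\<in>F. \<Sum>w\<in>F. \<Sum>e\<in>E. H x y * P e y w * H w x)"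
    by (simp add: sum_distrib_left sum_distrib_right)
  also have "\<dots> = (\<Sum>x\<in>F. \<Sum>y\<in>F. \<Sum>e\<in>E. \<Sum>w\<in>F. H x y * P e y w * H w x)" by (intro sum.cong refl sum.swap)
  also have "\<dots> = (\<Sum>x\<in>F. \<Sum>e\<in>E. \<Sum>y\<in>F. \<Sum>w\<in>F. H x y * P e y w * H w x)" by (intro sum.cong refl sum.swap)
  also have "\<dots> = (\<Sum>e\<in>E. \<Sum>x\<in>F. \<Sum>y\<in>F. \<Sum>w\<in>F. H x y * P e y w * H w x)" by (rule sum.swap)
  finally show ?thesis
    unfolding qfi_objective_def 1 by (simp add: sum_subtractf sum_distrib_left)
qed

lemma qfi_objective_cong:
  assumes "\<And>x y. x \<in> F \<Longrightarrow> y \<in> F \<Longrightarrow> D x y = D' x y" "\<And>x y. x \<in> F \<Longrightarrow> y \<in> F \<Longrightarrow> P x y = P' x y"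
  shows "qfi_objective F D P H = qfi_objective F D' P' H"
  unfolding qfi_objective_def using assms by simp

text \<open>Each branch \<open>e\<close> obeys \<open>qfi_objective_le\<close> with its own
  logarithmic derivative \<open>l e\<close>. The bounds involve only diagonal entries of
  \<open>\<rho>\<close>, so coherences drop out, and together they form a finite part of a double
  series with value \<open>N + M\<close>.\<close>

lemma has_QFI_amp_out_le:
  fixes \<rho> :: "('b \<times> ('m::finite \<Rightarrow> nat), 'b \<times> ('m \<Rightarrow> nat)) kernel"
  assumes \<rho>: "density_op \<rho>" and mean: "has_mean_photon_number \<rho> N" and \<tau>: "0 < \<tau>"
    and Q: "has_QFI (\<lambda>t. amp_out t \<rho>) \<tau> K"
  shows "K \<le> 4 * (N + real CARD('m))"
proof -
  have pos: "positive_op \<rho>" and tr: "((\<lambda>x. \<rho> x x) has_sum 1) UNIV"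
    using \<rho> by (auto simp: density_op_def)
  have diag: "0 \<le> Re (\<rho> x x)" for x
    using positive_op_sum_nonneg[OF pos, of "{x}" "\<lambda>_. 1" id] by simp
  define \<kappa> where "\<kappa> e x = kraus \<tau> e (snd x)" for e :: "'m \<Rightarrow> nat" and x :: "'b \<times> ('m \<Rightarrow> nat)"
  define sh where "sh e x = (fst x, \<lambda>i. snd x i - e i)" for e :: "'m \<Rightarrow> nat" and x :: "'b \<times> ('m \<Rightarrow> nat)"
  define l where "l e x = amp_log_deriv \<tau> (snd (sh e x)) e" for e x
  define P where "P e x y = complex_of_real (\<kappa> e x * \<kappa> e y) * \<rho> (sh e x) (sh e y)" for e x y
  define \<rho>' where "\<rho>' x y = (\<Sum>e | e \<le> snd x. complex_of_real (l e x + l e y) * P e x y)" for x y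
  have d: "((\<lambda>t. amp_out t \<rho> x y) has_vector_derivative \<rho>' x y) (at \<tau>)" for x y
  proof -
    obtain a k b m where [simp]: "x = (a, k)" "y = (b, m)" by (cases x, cases y)
    show ?thesis
      using amp_out_has_derivative[OF \<tau>, of \<rho> a k b m]
      by (simp add: \<rho>'_def l_def P_def \<kappa>_def sh_def mult.assoc)
  qed
  have out: "amp_out \<tau> \<rho> x y = (\<Sum>e | e \<le> snd x. P e x y)" for x y
    by (cases x, cases y) (simp add: amp_out_def P_def \<kappa>_def sh_def)
  have P0: "P e x y = 0" if "\<not> e \<le> snd x" for e x y
    using that by (simp add: P_def \<kappa>_def kraus_def)
  \<comment> \<open>Indexed by input state and environment number. Summing over the latter gives
    \<open>n + M\<close> by \<open>amp_log_deriv_has_sum\<close>, so the total is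
    \<open>N + M\<close>.\<close>
  let ?g = "\<lambda>((a, n), e). (amp_log_deriv \<tau> n e)\<^sup>2 * (amp \<tau> n e)\<^sup>2 * Re (\<rho> (a, n) (a, n))"
  have photon: "((\<lambda>(a, n). real (total_number n + CARD('m)) * Re (\<rho> (a, n) (a, n))) has_sum (N + real CARD('m))) UNIV"
    using has_sum_add[OF mean[unfolded has_mean_photon_number_def]
        has_sum_cmult_right[OF has_sum_Re[OF tr], of "real CARD('m)"]]
    by (simp add: case_prod_unfold ring_distribs)
  have rows: "((\<lambda>e. ?g (x, e)) has_sum (case x of (a, n) \<Rightarrow> real (total_number n + CARD('m)) * Re (\<rho> (a, n) (a, n)))) UNIV" for x
    using has_sum_cmult_left[OF amp_log_deriv_has_sum[OF \<tau>, of "snd x"], of "Re (\<rho> x x)"]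
    by (cases x) simp
  have "?g summable_on UNIV \<times> UNIV"
    by (rule summable_on_SigmaI[OF rows has_sum_imp_summable[OF photon]]) (auto simp: diag)
  from has_sum_SigmaI[OF rows photon this]
  have tot: "(?g has_sum (N + real CARD('m))) UNIV" by simp
  show ?thesis
  proof (rule has_QFI_le[OF Q d])
    fix F and H :: "('b \<times> ('m \<Rightarrow> nat), 'b \<times> ('m \<Rightarrow> nat)) kernel"
    assume FH: "fin_herm F H"
    have F: "finite F" and Hc: "\<And>x y. cnj (H x y) = H y x" using FH by (auto simp: fin_herm_def)
    \<comment> \<open>One finite set of environment numbers for all of \<open>F\<close>; the
      additional ones contribute 0 because \<open>kraus\<close> vanishes unless \<open>e\<close> is
      below the output.\<close>
    define E where "E = (\<Union>x\<in>F. {e. e \<le> snd x})"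
    have E: "finite E" unfolding E_def using F finite_below by auto
    have ext: "(\<Sum>e | e \<le> snd x. h e * P e x y) = (\<Sum>e\<in>E. h e * P e x y)" if "x \<in> F" for x y and h :: "_ \<Rightarrow> complex"
      by (rule sum.mono_neutral_left[OF E]) (use that in \<open>auto simp: E_def P0\<close>)
    have "qfi_objective F \<rho>' (amp_out \<tau> \<rho>) H
        = qfi_objective F (\<lambda>x y. \<Sum>e\<in>E. complex_of_real (l e x + l e y) * P e x y) (\<lambda>x y. \<Sum>e\<in>E. P e x y) H"
      by (rule qfi_objective_cong) (use ext[where h = "\<lambda>_. 1"] in \<open>simp_all add: \<rho>'_def out ext\<close>)
    also have "\<dots> = (\<Sum>e\<in>E. qfi_objective F (\<lambda>x y. complex_of_real (l e x + l e y) * P e x y) (P e) H)"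
      by (rule qfi_objective_sum)
    also have "\<dots> \<le> (\<Sum>e\<in>E. 4 * (\<Sum>z\<in>F. (l e z)\<^sup>2 * Re (P e z z)))"
    proof (intro sum_mono qfi_objective_le F Hc)
      fix e c
      show "0 \<le> Re (\<Sum>x\<in>F. \<Sum>y\<in>F. cnj (c x) * P e x y * c y)"
        using positive_op_sum_nonneg[OF pos F, of "\<lambda>x. \<kappa> e x * c x" "sh e"] by (simp add: P_def mult_ac)
    qed
    also have "\<dots> = 4 * (\<Sum>(e, z)\<in>E \<times> F. (l e z)\<^sup>2 * Re (P e z z))"
      by (simp add: sum_distrib_left[symmetric] sum.cartesian_product)
    \<comment> \<open>Only pairs with \<open>e \<le> snd z\<close> survive. On them the shift is
      genuine subtraction, so \<open>(e, z)\<close> can be recovered from \<open>(sh e z, e)\<close>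
      and no term of the double series is counted twice.\<close>
    also have "(\<Sum>(e, z)\<in>E \<times> F. (l e z)\<^sup>2 * Re (P e z z))
        = (\<Sum>(e, z)\<in>{(e, z). e \<in> E \<and> z \<in> F \<and> e \<le> snd z}. ?g (sh e z, e))"
    proof (rule sum.mono_neutral_cong_right)
      show "finite (E \<times> F)" using E F by simp
      show "\<forall>i\<in>E \<times> F - {(e, z). e \<in> E \<and> z \<in> F \<and> e \<le> snd z}. (case i of (e, z) \<Rightarrow> (l e z)\<^sup>2 * Re (P e z z)) = 0"
      proof
        fix i assume i: "i \<in> E \<times> F - {(e, z). e \<in> E \<and> z \<in> F \<and> e \<le> snd z}"
        obtain e z where ez: "i = (e, z)" by (cases i)
        have "\<not> e \<le> snd z" using i unfolding ez by blast
        then show "(case i of (e, z) \<Rightarrow> (l e z)\<^sup>2 * Re (P e z z)) = 0" by (simp add: ez P0)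
      qed
      show "(case i of (e, z) \<Rightarrow> (l e z)\<^sup>2 * Re (P e z z)) = (case i of (e, z) \<Rightarrow> ?g (sh e z, e))"
        if "i \<in> {(e, z). e \<in> E \<and> z \<in> F \<and> e \<le> snd z}" for i
        using that by (auto simp: l_def P_def \<kappa>_def kraus_def sh_def power2_eq_square)
    qed auto
    also have "\<dots> = sum ?g ((\<lambda>(e, z). (sh e z, e)) ` {(e, z). e \<in> E \<and> z \<in> F \<and> e \<le> snd z})"
    proof (subst sum.reindex)
      show "inj_on (\<lambda>(e, z). (sh e z, e)) {(e, z). e \<in> E \<and> z \<in> F \<and> e \<le> snd z}"
      proof (rule inj_onI)
        fix i j
        assume i: "i \<in> {(e, z). e \<in> E \<and> z \<in> F \<and> e \<le> snd z}" and j: "j \<in> {(e, z). e \<in> E \<and> z \<in> F \<and> e \<le> snd z}"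
          and eq: "(case i of (e, z) \<Rightarrow> (sh e z, e)) = (case j of (e, z) \<Rightarrow> (sh e z, e))"
        obtain e a k where i': "i = (e, (a, k))" by (metis surj_pair)
        obtain e' a' k' where j': "j = (e', (a', k'))" by (metis surj_pair)
        have e: "e' = e" and a: "a' = a" and s: "(\<lambda>i. k i - e i) = (\<lambda>i. k' i - e i)"
          using eq by (auto simp: i' j' sh_def)
        have "k i = k' i" for i
        proof -
          have "e i \<le> k i" "e i \<le> k' i" using i j by (auto simp: i' j' e le_fun_def)
          then show ?thesis using fun_cong[OF s, of i] by simp
        qed
        then show "i = j" by (simp add: i' j' e a fun_eq_iff)
      qed
    qed (simp add: case_prod_unfold o_def)
    also have "\<dots> \<le> N + real CARD('m)"
    proof (rule finite_sum_le_has_sum[OF tot])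
      show "finite ((\<lambda>(e, z). (sh e z, e)) ` {(e, z). e \<in> E \<and> z \<in> F \<and> e \<le> snd z})"
        by (rule finite_imageI, rule finite_subset[of _ "E \<times> F"]) (use E F in auto)
    qed (auto simp: diag)
    finally show "qfi_objective F \<rho>' (amp_out \<tau> \<rho>) H \<le> 4 * (N + real CARD('m))" by simp
  qed
qed

section \<open>Parametrisation by the gain\<close>

text \<open>\<open>amplifier\<close> recovers the parameter through \<open>arcosh\<close>, so the
  closed form is at hand for \<open>t \<ge> 0\<close>; a positive \<open>\<tau>\<close> has a
  neighbourhood of such \<open>t\<close>.\<close>

lemma amp_out_eventually:
  "0 < \<tau> \<Longrightarrow> eventually (\<lambda>t. amp_out t \<rho> = amplifier ((cosh t)\<^sup>2) \<rho>) (at \<tau>)"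
  by (rule eventually_mono[OF eventually_at_in_open'[of "{0<..}"]]) (auto simp: amplifier_eq_amp_out)

lemma has_QFI_amplifier_cosh:
  assumes \<tau>: "0 < \<tau>"
  shows "has_QFI (\<lambda>t. amplifier ((cosh t)\<^sup>2) \<rho>) \<tau> K \<longleftrightarrow> has_QFI (\<lambda>t. amp_out t \<rho>) \<tau> K"
proof
  assume "has_QFI (\<lambda>t. amplifier ((cosh t)\<^sup>2) \<rho>) \<tau> K"
  from has_QFI_reparam[OF this, of "\<lambda>t. t" \<tau> 1 "\<lambda>t. amp_out t \<rho>"]
  show "has_QFI (\<lambda>t. amp_out t \<rho>) \<tau> K"
    using \<tau> amp_out_eventually[OF \<tau>, of \<rho>] by (simp add: amplifier_eq_amp_out)
next
  assume Q: "has_QFI (\<lambda>t. amp_out t \<rho>) \<tau> K"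
  have "eventually (\<lambda>t. amplifier ((cosh t)\<^sup>2) \<rho> = amp_out t \<rho>) (at \<tau>)"
    by (rule eventually_mono[OF amp_out_eventually[OF \<tau>, of \<rho>]]) (rule sym)
  with has_QFI_reparam[OF Q, of "\<lambda>t. t" \<tau> 1 "\<lambda>t. amplifier ((cosh t)\<^sup>2) \<rho>"]
  show "has_QFI (\<lambda>t. amplifier ((cosh t)\<^sup>2) \<rho>) \<tau> K"
    using \<tau> by (simp add: amplifier_eq_amp_out)
qed

lemma cosh_real_gt_1: "0 < x \<Longrightarrow> 1 < cosh x" for x :: real
  using cosh_real_ge_1[of x] cosh_real_one_iff[of x] by (simp add: less_le)

text \<open>Change of variable with derivative \<open>2 sinh \<tau> cosh \<tau>\<close> of the gain,
  whose square is \<open>4 G (G - 1)\<close>. The converse direction uses the inverse function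
  \<open>arcosh (sqrt g)\<close> with the reciprocal derivative.\<close>

lemma has_QFI_amplifier_gain:
  assumes \<tau>: "0 < \<tau>" and G: "G = (cosh \<tau>)\<^sup>2"
  shows "has_QFI (\<lambda>g. amplifier g \<rho>) G K \<longleftrightarrow> has_QFI (\<lambda>t. amp_out t \<rho>) \<tau> (4 * (G * (G - 1)) * K)"
proof -
  let ?c = "2 * sinh \<tau> * cosh \<tau>"
  have s: "sinh \<tau> > 0" and c: "cosh \<tau> > 1" using \<tau> by (simp_all add: cosh_real_gt_1)
  have G1: "G - 1 = (sinh \<tau>)\<^sup>2" unfolding G by (simp add: cosh_square_eq)
  have c2: "?c\<^sup>2 = 4 * (G * (G - 1))" unfolding G1 by (simp add: G power_mult_distrib)
  have Gg: "G > 1" using c unfolding G by (simp add: one_less_power)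
  show ?thesis
  proof
    assume Q: "has_QFI (\<lambda>g. amplifier g \<rho>) G K"
    have "((\<lambda>t. (cosh t)\<^sup>2) has_real_derivative ?c) (at \<tau>)"
      by (auto intro!: derivative_eq_intros)
    from has_QFI_reparam[OF Q G[symmetric] this, of "\<lambda>t. amp_out t \<rho>"] amp_out_eventually[OF \<tau>, of \<rho>]
    show "has_QFI (\<lambda>t. amp_out t \<rho>) \<tau> (4 * (G * (G - 1)) * K)"
      using \<tau> amplifier_eq_amp_out[of \<tau> \<rho>] by (simp add: c2 G)
  next
    assume Q: "has_QFI (\<lambda>t. amp_out t \<rho>) \<tau> (4 * (G * (G - 1)) * K)"
    have sq: "sqrt G = cosh \<tau>" unfolding G using c by simp
    have 1: "arcosh (sqrt G) = \<tau>" unfolding sq using \<tau> by (simp add: arcosh_cosh_real)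
    have "(cosh \<tau>)\<^sup>2 - 1 = (sinh \<tau>)\<^sup>2" using G1 by (simp only: G)
    then have s': "sqrt ((cosh \<tau>)\<^sup>2 - 1) = sinh \<tau>" using s by simp
    have "(arcosh has_real_derivative 1 / sqrt ((sqrt G)\<^sup>2 - 1)) (at (sqrt G))"
      using c by (intro arcosh_real_has_field_derivative) (simp add: sq)
    from DERIV_chain2[OF this DERIV_real_sqrt[of G]]
    have 2: "((\<lambda>g. arcosh (sqrt g)) has_real_derivative 1 / ?c) (at G)"
      using Gg by (simp add: sq s' inverse_eq_divide mult_ac)
    have "eventually (\<lambda>g. g > 1) (at G)"
      using eventually_at_in_open'[of "{1<..}" G] Gg by simp
    then have 3: "eventually (\<lambda>g. amplifier g \<rho> = amp_out (arcosh (sqrt g)) \<rho>) (at G)"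
    proof (rule eventually_mono)
      fix g :: real assume g: "g > 1"
      have "(cosh (arcosh (sqrt g)))\<^sup>2 = g" using g by (simp add: cosh_arcosh_real)
      moreover have "0 \<le> arcosh (sqrt g)" using g by simp
      ultimately show "amplifier g \<rho> = amp_out (arcosh (sqrt g)) \<rho>"
        using amplifier_eq_amp_out[of "arcosh (sqrt g)" \<rho>] by simp
    qed
    have 4: "amplifier G \<rho> = amp_out \<tau> \<rho>"
      using amplifier_eq_amp_out[of \<tau> \<rho>] \<tau> by (simp add: G)
    have "has_QFI (\<lambda>g. amplifier g \<rho>) G ((1 / ?c)\<^sup>2 * (4 * (G * (G - 1)) * K))"
      by (rule has_QFI_reparam[OF Q 1 2 3 4])
    moreover have "(1 / ?c)\<^sup>2 * (4 * (G * (G - 1)) * K) = K"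
      unfolding power_divide c2 using Gg by simp
    ultimately show "has_QFI (\<lambda>g. amplifier g \<rho>) G K" by simp
  qed
qed

theorem mainTheorem5:
  fixes N :: real
    and p :: "('m::finite \<Rightarrow> nat) \<Rightarrow> real"
    and \<xi> :: "('m \<Rightarrow> nat) \<Rightarrow> 'a \<Rightarrow> complex"
  assumes "0 \<le> N" and "nds_probe p \<xi> N"
  shows
    "(\<forall>\<tau> > 0. \<forall>\<tau>' > 0.
        (\<lambda>n. total_dist p n * sech (\<tau>' - \<tau>) ^ (n + CARD('m))) sums
          fidelity (amplifier ((cosh \<tau>)\<^sup>2) (ketbra (nds_vector p \<xi>)))
                   (amplifier ((cosh \<tau>')\<^sup>2) (ketbra (nds_vector p \<xi>))))
     \<and> (\<forall>\<tau> > 0. \<forall>G. G = (cosh \<tau>)\<^sup>2 \<longrightarrow>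
          (\<forall>K. has_QFI (\<lambda>t. amplifier ((cosh t)\<^sup>2) (ketbra (nds_vector p \<xi>))) \<tau> K
                 \<longleftrightarrow> K = 4 * (N + real CARD('m))) \<and>
          (\<forall>K. has_QFI (\<lambda>g. amplifier g (ketbra (nds_vector p \<xi>))) G K
                 \<longleftrightarrow> K = (N + real CARD('m)) / (G * (G - 1))))
     \<and> (\<forall>\<rho> :: ('b \<times> ('m \<Rightarrow> nat), 'b \<times> ('m \<Rightarrow> nat)) kernel.
          density_op \<rho> \<and> has_mean_photon_number \<rho> N \<longrightarrow>
          (\<forall>\<tau> > 0. \<forall>G. G = (cosh \<tau>)\<^sup>2 \<longrightarrow>
             (\<forall>K. has_QFI (\<lambda>t. amplifier ((cosh t)\<^sup>2) \<rho>) \<tau> K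
                    \<longrightarrow> K \<le> 4 * (N + real CARD('m))) \<and>
             (\<forall>K. has_QFI (\<lambda>g. amplifier g \<rho>) G K
                    \<longrightarrow> K \<le> (N + real CARD('m)) / (G * (G - 1)))))"
proof (intro conjI allI impI; (elim conjE)?)
  note probe = assms(2)
  have gain: "0 < G * (G - 1)" if "0 < \<tau>" "G = (cosh \<tau>)\<^sup>2" for \<tau> G :: real
  proof -
    have "cosh \<tau> > 1" using that by (simp add: cosh_real_gt_1)
    then have "G > 1" unfolding that(2) by (simp add: one_less_power)
    then show ?thesis by simp
  qed
  let ?\<rho> = "ketbra (nds_vector p \<xi>)"
  \<comment> \<open>Existence and uniqueness together turn \<open>has_QFI\<close> into an equation
    for \<open>K\<close>; the statement for the gain follows by rescaling.\<close>
  have nds: "has_QFI (\<lambda>t. amp_out t ?\<rho>) \<tau> K \<longleftrightarrow> K = 4 * (N + real CARD('m))" if "0 < \<tau>" for \<tau> K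
    using has_QFI_nds[OF probe that] has_QFI_unique by blast
  {
    fix \<tau> \<tau>' :: real assume "0 < \<tau>" "0 < \<tau>'"
    then show "(\<lambda>n. total_dist p n * sech (\<tau>' - \<tau>) ^ (n + CARD('m))) sums
          fidelity (amplifier ((cosh \<tau>)\<^sup>2) ?\<rho>) (amplifier ((cosh \<tau>')\<^sup>2) ?\<rho>)"
      using fidelity_nds[OF probe] by (simp add: amplifier_eq_amp_out)
  next
    fix \<tau> G K :: real assume "0 < \<tau>"
    then show "has_QFI (\<lambda>t. amplifier ((cosh t)\<^sup>2) ?\<rho>) \<tau> K \<longleftrightarrow> K = 4 * (N + real CARD('m))"
      by (simp only: has_QFI_amplifier_cosh nds)
  next
    fix \<tau> G K :: real assume *: "0 < \<tau>" "G = (cosh \<tau>)\<^sup>2"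
    show "has_QFI (\<lambda>g. amplifier g ?\<rho>) G K \<longleftrightarrow> K = (N + real CARD('m)) / (G * (G - 1))"
    proof -
      have "4 * c * K = 4 * n \<longleftrightarrow> K = n / c" if "0 < c" for c n :: real
        using that by (auto simp: field_simps)
      from this[OF gain[OF *]] show ?thesis
        unfolding has_QFI_amplifier_gain[OF *] nds[OF *(1)] .
    qed
  next
    fix \<rho> :: "('b \<times> ('m \<Rightarrow> nat), 'b \<times> ('m \<Rightarrow> nat)) kernel" and \<tau> G K :: real
    assume "density_op \<rho>" "has_mean_photon_number \<rho> N" "0 < \<tau>"
      "has_QFI (\<lambda>t. amplifier ((cosh t)\<^sup>2) \<rho>) \<tau> K"
    then show "K \<le> 4 * (N + real CARD('m))"
      using has_QFI_amp_out_le by (simp only: has_QFI_amplifier_cosh)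
  next
    fix \<rho> :: "('b \<times> ('m \<Rightarrow> nat), 'b \<times> ('m \<Rightarrow> nat)) kernel" and \<tau> G K :: real
    assume \<rho>: "density_op \<rho>" "has_mean_photon_number \<rho> N" and *: "0 < \<tau>" "G = (cosh \<tau>)\<^sup>2"
      and Q: "has_QFI (\<lambda>g. amplifier g \<rho>) G K"
    have "4 * c * K \<le> 4 * n \<Longrightarrow> K \<le> n / c" if "0 < c" for c n :: real
      using that by (simp add: field_simps)
    note this[OF gain[OF *]]
    moreover have "4 * (G * (G - 1)) * K \<le> 4 * (N + real CARD('m))"
      using Q unfolding has_QFI_amplifier_gain[OF *] by (rule has_QFI_amp_out_le[OF \<rho> *(1)])
    ultimately show "K \<le> (N + real CARD('m)) / (G * (G - 1))" .
  }
qed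

end
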